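(* Let $m\ge 1$, $q,q_1,\dots,q_m\in[1,\infty)$ and $\alpha,\alpha_1,\dots,\alpha_m\in\mathbb R$ with $\alpha_i>-n$ for all $i$, such that $$\frac1{q_1}+\cdots+\frac1{q_m}=\frac1q,\qquad \frac{\alpha_1}{q_1}+\cdots+\frac{\alpha_m}{q_m}=\frac{\alpha}{q}.$$ Let $\omega_i(x)=|x|_p^{\alpha_i}$ ($i=1,\dots,m$) and $\omega(x)=|x|_p^{\alpha}$. Assume condition (DK1) holds. Then $\mathcal H^p_{\Phi,\vec A}$ is bounded from $L^{q_1}_{\omega_1}(\mathbb Q_p^n)\times\cdots\times L^{q_m}_{\omega_m}(\mathbb Q_p^n)$ to $L^q_\omega(\mathbb Q_p^n)$ if and only if $$\mathcal C_1=\int_{\mathbb Q_p^n}\frac{\Phi(y)}{|y|_p^n}\prod_{i=1}^m\|A_i^{-1}(y)\|_p^{\frac{\alpha_i+n}{q_i}}\,dy<\infty.$$ Moreover, the operator norm of $\mathcal H^p_{\Phi,\vec A}$ between these spaces is comparable to $\mathcal C_1$, i.e. $C^{-1}\mathcal C_1\le \|\mathcal H^p_{\Phi,\vec A}\|\le C\,\mathcal C_1$ for a constant $C>0$ independent of $\Phi$.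
   Context: Let $p$ be a prime, $\mathbb Q_p$ the field of $p$-adic numbers with $p$-adic absolute value $|\cdot|_p$; for $x=(x_1,\dots,x_n)\in\mathbb Q_p^n$ put $|x|_p=\max_{1\le j\le n}|x_j|_p$. $dx$ is the Haar measure on $\mathbb Q_p^n$ normalized so that $B_0$ has measure $1$, where $B_\gamma=\{x\in\mathbb Q_p^n:|x|_p\le p^\gamma\}$, $\gamma\in\mathbb Z$. For an $n\times n$ matrix $A=(a_{ij})$ with entries in $\mathbb Q_p$, $\|A\|_p=\max_{i,j}|a_{ij}|_p$. For a weight (nonnegative locally integrable function) $\omega$ and $0<q<\infty$, $L^q_\omega(\mathbb Q_p^n)$ is the space of measurable $f$ with $\|f\|_{L^q_\omega}=(\int_{\mathbb Q_p^n}|f(x)|^q\omega(x)dx)^{1/q}<\infty$. Let $\Phi:\mathbb Q_p^n\to[0,\infty)$ be measurable and let $A_1(y),\dots,A_m(y)$ be $n\times n$ matrices over $\mathbb Q_p$ depending measurably on $y\in\mathbb Q_p^n$ and invertible for a.e. $y$. The $p$-adic multilinear Hausdorff operator is $\mathcal H^p_{\Phi,\vec A}(\vec f)(x)=\int_{\mathbb Q_p^n}\frac{\Phi(y)}{|y|_p^n}\prod_{i=1}^m f_i(A_i(y)x)\,dy$ for $\vec f=(f_1,\dots,f_m)$. Condition (DK1): there is $\nu\in\mathbb N$ such that $\|A_i(y)\|_p\,\|A_i^{-1}(y)\|_p\le p^{\nu}$ for all $i=1,\dots,m$ and a.e. $y\in\mathbb Q_p^n$. *)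

theory Defs
  imports "HOL-Analysis.Analysis" "HOL-Computational_Algebra.Computational_Algebra"
begin

definition padic_val_rat :: "nat \<Rightarrow> rat \<Rightarrow> int" where
  "padic_val_rat p r = (case quotient_of r of (a, b) \<Rightarrow>
      int (multiplicity (int p) a) - int (multiplicity (int p) b))"

definition abs_p_rat :: "nat \<Rightarrow> rat \<Rightarrow> real" where
  "abs_p_rat p r = (if r = 0 then 0 else real p powi (- padic_val_rat p r))"

definition p_cauchy :: "nat \<Rightarrow> (nat \<Rightarrow> rat) \<Rightarrow> bool" where
  "p_cauchy p X \<longleftrightarrow> (\<forall>e>0. \<exists>N. \<forall>k\<ge>N. \<forall>l\<ge>N. abs_p_rat p (X k - X l) < e)"

definition p_equiv :: "nat \<Rightarrow> (nat \<Rightarrow> rat) \<Rightarrow> (nat \<Rightarrow> rat) \<Rightarrow> bool" where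
  "p_equiv p X Y \<longleftrightarrow> (\<lambda>k. abs_p_rat p (X k - Y k)) \<longlonglongrightarrow> 0"

text \<open>A p-adic number is an equivalence class of p-Cauchy sequences of rationals.\<close>
type_synonym qp = "(nat \<Rightarrow> rat) set"

definition qp_class :: "nat \<Rightarrow> (nat \<Rightarrow> rat) \<Rightarrow> qp" where
  "qp_class p X = {Y. p_cauchy p Y \<and> p_equiv p X Y}"

definition Qp :: "nat \<Rightarrow> qp set" where
  "Qp p = qp_class p ` {X. p_cauchy p X}"

definition qp_rep :: "qp \<Rightarrow> (nat \<Rightarrow> rat)" where
  "qp_rep x = (SOME X. X \<in> x)"

definition qp_zero :: "nat \<Rightarrow> qp" where "qp_zero p = qp_class p (\<lambda>_. 0)"
definition qp_one :: "nat \<Rightarrow> qp" where "qp_one p = qp_class p (\<lambda>_. 1)"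
definition qp_add :: "nat \<Rightarrow> qp \<Rightarrow> qp \<Rightarrow> qp" where
  "qp_add p x y = qp_class p (\<lambda>k. qp_rep x k + qp_rep y k)"
definition qp_uminus :: "nat \<Rightarrow> qp \<Rightarrow> qp" where
  "qp_uminus p x = qp_class p (\<lambda>k. - qp_rep x k)"
definition qp_mult :: "nat \<Rightarrow> qp \<Rightarrow> qp \<Rightarrow> qp" where
  "qp_mult p x y = qp_class p (\<lambda>k. qp_rep x k * qp_rep y k)"

definition qp_abs :: "nat \<Rightarrow> qp \<Rightarrow> real" where
  "qp_abs p x = lim (\<lambda>k. abs_p_rat p (qp_rep x k))"

definition Qpn :: "nat \<Rightarrow> ('n::finite \<Rightarrow> qp) set" where
  "Qpn p = {x. \<forall>i. x i \<in> Qp p}"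

definition qpv_norm :: "nat \<Rightarrow> ('n::finite \<Rightarrow> qp) \<Rightarrow> real" where
  "qpv_norm p x = Max (range (\<lambda>i. qp_abs p (x i)))"

definition qpm_norm :: "nat \<Rightarrow> ('n::finite \<Rightarrow> 'n \<Rightarrow> qp) \<Rightarrow> real" where
  "qpm_norm p M = Max (range (\<lambda>(i, j). qp_abs p (M i j)))"

definition qp_sum :: "nat \<Rightarrow> ('i \<Rightarrow> qp) \<Rightarrow> 'i set \<Rightarrow> qp" where
  "qp_sum p f A = Finite_Set.fold (\<lambda>j acc. qp_add p (f j) acc) (qp_zero p) A"

definition qp_mat_vec :: "nat \<Rightarrow> ('n::finite \<Rightarrow> 'n \<Rightarrow> qp) \<Rightarrow> ('n \<Rightarrow> qp) \<Rightarrow> ('n \<Rightarrow> qp)" where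
  "qp_mat_vec p M x = (\<lambda>i. qp_sum p (\<lambda>j. qp_mult p (M i j) (x j)) UNIV)"

definition qp_mat_mult :: "nat \<Rightarrow> ('n::finite \<Rightarrow> 'n \<Rightarrow> qp) \<Rightarrow> ('n \<Rightarrow> 'n \<Rightarrow> qp) \<Rightarrow> ('n \<Rightarrow> 'n \<Rightarrow> qp)" where
  "qp_mat_mult p M N = (\<lambda>i k. qp_sum p (\<lambda>j. qp_mult p (M i j) (N j k)) UNIV)"

definition qp_mat_id :: "nat \<Rightarrow> ('n::finite \<Rightarrow> 'n \<Rightarrow> qp)" where
  "qp_mat_id p = (\<lambda>i j. if i = j then qp_one p else qp_zero p)"

definition qp_matrix :: "nat \<Rightarrow> ('n::finite \<Rightarrow> 'n \<Rightarrow> qp) \<Rightarrow> bool" where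
  "qp_matrix p M \<longleftrightarrow> (\<forall>i j. M i j \<in> Qp p)"

definition qp_invertible :: "nat \<Rightarrow> ('n::finite \<Rightarrow> 'n \<Rightarrow> qp) \<Rightarrow> bool" where
  "qp_invertible p M \<longleftrightarrow> qp_matrix p M \<and>
     (\<exists>N. qp_matrix p N \<and> qp_mat_mult p M N = qp_mat_id p \<and> qp_mat_mult p N M = qp_mat_id p)"

definition qp_mat_inv :: "nat \<Rightarrow> ('n::finite \<Rightarrow> 'n \<Rightarrow> qp) \<Rightarrow> ('n \<Rightarrow> 'n \<Rightarrow> qp)" where
  "qp_mat_inv p M = (SOME N. qp_matrix p N \<and> qp_mat_mult p M N = qp_mat_id p \<and> qp_mat_mult p N M = qp_mat_id p)"

definition qpn_ball :: "nat \<Rightarrow> ('n::finite \<Rightarrow> qp) \<Rightarrow> int \<Rightarrow> ('n \<Rightarrow> qp) set" where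
  "qpn_ball p a k = {x \<in> Qpn p. qpv_norm p (\<lambda>i. qp_add p (x i) (qp_uminus p (a i))) \<le> real p powi k}"

text \<open>The Haar measure: the (unique) measure on the sigma-algebra generated by the balls
  giving the ball of radius p^k the mass p^(k n); so B_0 has measure 1.\<close>
definition haar :: "nat \<Rightarrow> ('n::finite \<Rightarrow> qp) measure" where
  "haar p = extend_measure (Qpn p) {(a, k). a \<in> Qpn p} (\<lambda>(a, k). qpn_ball p a k)
      (\<lambda>(a, k). ennreal (real p powi (k * int CARD('n))))"

definition qp_ball :: "nat \<Rightarrow> qp \<Rightarrow> int \<Rightarrow> qp set" where
  "qp_ball p a k = {x \<in> Qp p. qp_abs p (qp_add p x (qp_uminus p a)) \<le> real p powi k}"

definition qp_borel :: "nat \<Rightarrow> qp measure" where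
  "qp_borel p = sigma (Qp p) {qp_ball p a k |a k. a \<in> Qp p}"

definition pow_weight :: "nat \<Rightarrow> real \<Rightarrow> ('n::finite \<Rightarrow> qp) \<Rightarrow> real" where
  "pow_weight p a x = qpv_norm p x powr a"

definition in_Lq :: "nat \<Rightarrow> real \<Rightarrow> (('n::finite \<Rightarrow> qp) \<Rightarrow> real) \<Rightarrow> (('n \<Rightarrow> qp) \<Rightarrow> real) \<Rightarrow> bool" where
  "in_Lq p q w f \<longleftrightarrow> f \<in> borel_measurable (haar p) \<and>
     (\<integral>\<^sup>+ x. ennreal (\<bar>f x\<bar> powr q * w x) \<partial>haar p) < \<infinity>"

definition Lq_norm :: "nat \<Rightarrow> real \<Rightarrow> (('n::finite \<Rightarrow> qp) \<Rightarrow> real) \<Rightarrow> (('n \<Rightarrow> qp) \<Rightarrow> real) \<Rightarrow> real" where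
  "Lq_norm p q w f = enn2real (\<integral>\<^sup>+ x. ennreal (\<bar>f x\<bar> powr q * w x) \<partial>haar p) powr (1 / q)"

definition hausdorff_integrand ::
  "nat \<Rightarrow> nat \<Rightarrow> (('n::finite \<Rightarrow> qp) \<Rightarrow> real) \<Rightarrow> (nat \<Rightarrow> ('n \<Rightarrow> qp) \<Rightarrow> ('n \<Rightarrow> 'n \<Rightarrow> qp))
     \<Rightarrow> (nat \<Rightarrow> ('n \<Rightarrow> qp) \<Rightarrow> real) \<Rightarrow> ('n \<Rightarrow> qp) \<Rightarrow> ('n \<Rightarrow> qp) \<Rightarrow> real" where
  "hausdorff_integrand p m \<Phi> A f x y =
     \<Phi> y / qpv_norm p y ^ CARD('n) * (\<Prod>i<m. f i (qp_mat_vec p (A i y) x))"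

definition hausdorff_op ::
  "nat \<Rightarrow> nat \<Rightarrow> (('n::finite \<Rightarrow> qp) \<Rightarrow> real) \<Rightarrow> (nat \<Rightarrow> ('n \<Rightarrow> qp) \<Rightarrow> ('n \<Rightarrow> 'n \<Rightarrow> qp))
     \<Rightarrow> (nat \<Rightarrow> ('n \<Rightarrow> qp) \<Rightarrow> real) \<Rightarrow> ('n \<Rightarrow> qp) \<Rightarrow> real" where
  "hausdorff_op p m \<Phi> A f x = (\<integral>y. hausdorff_integrand p m \<Phi> A f x y \<partial>haar p)"

definition hausdorff_bound ::
  "nat \<Rightarrow> nat \<Rightarrow> (('n::finite \<Rightarrow> qp) \<Rightarrow> real) \<Rightarrow> (nat \<Rightarrow> ('n \<Rightarrow> qp) \<Rightarrow> ('n \<Rightarrow> 'n \<Rightarrow> qp))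
     \<Rightarrow> (nat \<Rightarrow> real) \<Rightarrow> (nat \<Rightarrow> (('n \<Rightarrow> qp) \<Rightarrow> real)) \<Rightarrow> real \<Rightarrow> (('n \<Rightarrow> qp) \<Rightarrow> real)
     \<Rightarrow> real \<Rightarrow> bool" where
  "hausdorff_bound p m \<Phi> A qs ws q w C \<longleftrightarrow>
     (\<forall>f. (\<forall>i<m. in_Lq p (qs i) (ws i) (f i)) \<longrightarrow>
        (AE x in haar p. integrable (haar p) (hausdorff_integrand p m \<Phi> A f x)) \<and>
        in_Lq p q w (hausdorff_op p m \<Phi> A f) \<and>
        Lq_norm p q w (hausdorff_op p m \<Phi> A f) \<le> C * (\<Prod>i<m. Lq_norm p (qs i) (ws i) (f i)))"

definition hausdorff_bounded where
  "hausdorff_bounded p m \<Phi> A qs ws q w \<longleftrightarrow> (\<exists>C. hausdorff_bound p m \<Phi> A qs ws q w C)"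

definition hausdorff_opnorm where
  "hausdorff_opnorm p m \<Phi> A qs ws q w = Inf {C. C \<ge> 0 \<and> hausdorff_bound p m \<Phi> A qs ws q w C}"

definition const_C1 ::
  "nat \<Rightarrow> nat \<Rightarrow> (('n::finite \<Rightarrow> qp) \<Rightarrow> real) \<Rightarrow> (nat \<Rightarrow> ('n \<Rightarrow> qp) \<Rightarrow> ('n \<Rightarrow> 'n \<Rightarrow> qp))
     \<Rightarrow> (nat \<Rightarrow> real) \<Rightarrow> (nat \<Rightarrow> real) \<Rightarrow> ennreal" where
  "const_C1 p m \<Phi> A qs \<alpha>s = (\<integral>\<^sup>+ y. ennreal (\<Phi> y / qpv_norm p y ^ CARD('n) *
      (\<Prod>i<m. qpm_norm p (qp_mat_inv p (A i y)) powr ((\<alpha>s i + real CARD('n)) / qs i))) \<partial>haar p)"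

end

theory Submission
  imports Defs
begin

text \<open>
  If no measure with the prescribed ball masses existed, \<open>haar p\<close> would be the null measure and all
  claims would hold trivially, so Haar measure never has to be constructed. If it exists, two measures
  on the Borel sets agree as soon as they agree on balls. This gives translation invariance, and it
  shows that the push-forward under an invertible matrix \<open>A\<close> is a multiple of Haar measure with
  factor at most \<open>\<parallel>A\<^sup>-\<^sup>1\<parallel>\<^sup>n\<close>; no determinants are needed.

  By (DK1), \<open>|A\<^sub>i(y) x|\<close> is comparable to \<open>\<parallel>A\<^sub>i(y)\<parallel> |x|\<close>, so \<open>f \<mapsto> f (A\<^sub>i(y) \<cdot>)\<close> scales the
  weighted norm by at most a constant times \<open>\<parallel>A\<^sub>i(y)\<parallel>\<close> to the power \<open>-(\<alpha>\<^sub>i + n) / q\<^sub>i\<close>. Hoelder in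
  \<open>x\<close> and Jensen in \<open>y\<close> then bound the operator. For the converse one tests with
  \<open>f\<^sub>i(x) = |x| powr (-(\<alpha>\<^sub>i + n) / q\<^sub>i)\<close> cut off to a long range of spheres: each sphere contributes
  the same mass to all norms involved, and restricting the \<open>y\<close>-integral to moderate \<open>\<parallel>A\<^sub>i(y)\<parallel>\<close> loses
  only boundedly many spheres, at most half of the range.
\<close>

subsection \<open>Absolute values and Cauchy sequences\<close>

text \<open>Write \<open>n = CARD('n)\<close>. The exponent
  \<open>s i = (\<alpha>s i + n) / qs i\<close> is dictated by scaling:
  \<open>|x| powr (- s i)\<close> only just fails to lie in the i-th space, its norm integral
  diverging logarithmically at 0 and at infinity. The two balance conditions give
  \<open>q * (\<Sum>i<m. s i) = \<alpha> + n\<close>, so the product of these critical powers is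
  critical for the target space too. Inserted into the operator they come back multiplied, up to
  constants, by C1, which is why C1 is the norm up to constants. By (DK1) each matrix is a
  similarity up to the factor p^\<nu>; the final constants are built from powers of this factor and
  a 2 that comes from testing on twice as many spheres as are kept. Q_p is a carrier set inside a
  type of sets of sequences, so algebra and measurability are developed relative to
  \<open>Qp p\<close>: identities are read off representing sequences of rationals, and the
  countability of the set of balls takes the place of topology.\<close>

locale padic =
  fixes p :: nat
  assumes prime_p: "prime p"
begin

lemma p_gt_1: "real p > 1"
  using prime_gt_1_nat[OF prime_p] by simp

lemma p_pos: "real p > 0"
  using p_gt_1 by simp

lemma powi_le_iff: "real p powi a \<le> real p powi b \<longleftrightarrow> a \<le> b"
  using p_gt_1 by (meson linorder_not_le power_int_increasing power_int_strict_increasing less_imp_le)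

lemma powi_less_iff: "real p powi a < real p powi b \<longleftrightarrow> a < b"
  using powi_le_iff by (meson not_le)

lemma powi_eq_iff: "real p powi a = real p powi b \<longleftrightarrow> a = b"
  using powi_le_iff[of a b] powi_le_iff[of b a] by auto

lemma powi_pos: "real p powi a > 0"
  using p_pos by simp

lemma powi_tendsto_0:
  assumes "e > 0" shows "\<exists>k::nat. real p powi (- int k) < e"
proof -
  obtain k where "(1 / real p) ^ k < e"
    using real_arch_pow_inv[OF assms, of "1 / real p"] p_gt_1 by auto
  then show ?thesis
    by (auto simp: power_int_minus power_one_over field_simps intro!: exI[of _ k])
qed

lemma powi_unbounded: "\<exists>k::nat. r \<le> real p powi int k"
  using real_arch_pow[OF p_gt_1, of r] by (auto intro: less_imp_le)

lemma prime_int_p: "prime (int p)"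
  using prime_p by simp

text \<open>The definition uses lowest terms. Since multiplicity is additive on products,
  cross-multiplication gives the same exponent for every fraction, so common denominators may be
  used below.\<close>

lemma abs_p_rat_frac:
  assumes "a \<noteq> 0" "b \<noteq> 0"
  shows "abs_p_rat p (of_int a / of_int b)
       = real p powi (int (multiplicity (int p) b) - int (multiplicity (int p) a))"
proof -
  obtain c d where cd: "quotient_of (of_int a / of_int b :: rat) = (c, d)" by fastforce
  have d: "d > 0" using quotient_of_denom_pos[OF cd] .
  have e: "(of_int a / of_int b :: rat) = of_int c / of_int d" using quotient_of_div[OF cd] .
  have "of_int (a * d) = (of_int (c * b) :: rat)" using e assms d by (simp add: field_simps)
  then have ad: "a * d = c * b" by (simp only: of_int_eq_iff)
  then have c: "c \<noteq> 0" using assms d by auto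
  have "multiplicity (int p) (a * d) = multiplicity (int p) (c * b)" using ad by simp
  then have "multiplicity (int p) a + multiplicity (int p) d
      = multiplicity (int p) c + multiplicity (int p) b"
    using prime_int_p assms c d by (simp add: prime_elem_multiplicity_mult_distrib)
  then show ?thesis
    using assms cd unfolding abs_p_rat_def padic_val_rat_def by (simp add: powi_eq_iff)
qed

lemma rat_frac_cases:
  fixes r :: rat
  assumes "r \<noteq> 0"
  obtains a b where "a \<noteq> 0" "b \<noteq> 0" "r = of_int a / of_int b"
  using quotient_of_div[of r] quotient_of_denom_pos[of r] assms
  by (metis div_0 less_irrefl of_int_0 old.prod.exhaust)

lemma abs_p_rat_0 [simp]: "abs_p_rat p 0 = 0"
  by (simp add: abs_p_rat_def)

lemma abs_p_rat_1 [simp]: "abs_p_rat p 1 = 1"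
  using abs_p_rat_frac[of 1 1] by simp

lemma abs_p_rat_range: "r \<noteq> 0 \<Longrightarrow> \<exists>z. abs_p_rat p r = real p powi z"
  by (auto simp: abs_p_rat_def)

lemma abs_p_rat_nonneg [simp]: "abs_p_rat p r \<ge> 0"
  by (simp add: abs_p_rat_def)

lemma abs_p_rat_mult: "abs_p_rat p (r * s) = abs_p_rat p r * abs_p_rat p s"
proof (cases "r = 0 \<or> s = 0")
  case False
  then obtain a b c d where ab: "a \<noteq> 0" "b \<noteq> 0" "r = of_int a / of_int b"
    and cd: "c \<noteq> 0" "d \<noteq> 0" "s = of_int c / of_int d"
    using rat_frac_cases by metis
  have e: "r * s = of_int (a * c) / of_int (b * d)" using ab cd by simp
  have "abs_p_rat p (r * s) = real p powi
     (int (multiplicity (int p) (b * d)) - int (multiplicity (int p) (a * c)))"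
    unfolding e using ab cd by (intro abs_p_rat_frac) auto
  also have "int (multiplicity (int p) (b * d)) - int (multiplicity (int p) (a * c))
      = (int (multiplicity (int p) b) - int (multiplicity (int p) a))
      + (int (multiplicity (int p) d) - int (multiplicity (int p) c))"
    using ab cd prime_int_p by (simp add: prime_elem_multiplicity_mult_distrib)
  also have "real p powi \<dots> = abs_p_rat p r * abs_p_rat p s"
    unfolding ab(3) cd(3) using ab cd p_pos by (simp add: abs_p_rat_frac power_int_add)
  finally show ?thesis .
qed auto

lemma abs_p_rat_minus: "abs_p_rat p (- r) = abs_p_rat p r"
proof -
  have "abs_p_rat p (- 1) * abs_p_rat p (- 1) = 1"
    using abs_p_rat_mult[of "-1" "-1"] by simp
  then have "abs_p_rat p (- 1) = 1"
    by (metis abs_p_rat_nonneg abs_of_nonneg abs_square_eq_1 power2_eq_square)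
  then show ?thesis using abs_p_rat_mult[of "-1" r] by simp
qed

lemma abs_p_rat_minus_commute: "abs_p_rat p (r - s) = abs_p_rat p (s - r)"
  using abs_p_rat_minus[of "r - s"] by simp

lemma abs_p_rat_add: "abs_p_rat p (r + s) \<le> max (abs_p_rat p r) (abs_p_rat p s)"
proof (cases "r = 0 \<or> s = 0 \<or> r + s = 0")
  case True
  then show ?thesis by (auto simp: le_max_iff_disj)
next
  case False
  then obtain a b c d where ab: "a \<noteq> 0" "b \<noteq> 0" "r = of_int a / of_int b"
    and cd: "c \<noteq> 0" "d \<noteq> 0" "s = of_int c / of_int d"
    using rat_frac_cases by metis
  let ?m = "multiplicity (int p)"
  \<comment> \<open>Over the common denominator \<open>b * d\<close> the inequality says that a
    power of p dividing both numerators divides their sum.\<close>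
  have r: "r = of_int (a * d) / of_int (b * d)" and s: "s = of_int (c * b) / of_int (b * d)"
    using ab cd by auto
  have e: "r + s = of_int (a * d + c * b) / of_int (b * d)"
    unfolding r s by (simp add: add_divide_distrib)
  have nz: "a * d + c * b \<noteq> 0" using False e by (metis div_0 of_int_0)
  have "int p ^ min (?m (a * d)) (?m (c * b)) dvd a * d + c * b"
    by (intro dvd_add multiplicity_dvd') auto
  then have "min (?m (a * d)) (?m (c * b)) \<le> ?m (a * d + c * b)"
    using nz prime_int_p by (intro multiplicity_geI) auto
  then have "real p powi (int (?m (b * d)) - int (?m (a * d + c * b)))
     \<le> max (real p powi (int (?m (b * d)) - int (?m (a * d))))
           (real p powi (int (?m (b * d)) - int (?m (c * b))))"
    unfolding le_max_iff_disj powi_le_iff by auto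
  moreover have "abs_p_rat p (r + s) = real p powi (int (?m (b * d)) - int (?m (a * d + c * b)))"
    unfolding e using nz ab cd by (intro abs_p_rat_frac) auto
  moreover have "abs_p_rat p r = real p powi (int (?m (b * d)) - int (?m (a * d)))"
    unfolding r using ab cd by (intro abs_p_rat_frac) auto
  moreover have "abs_p_rat p s = real p powi (int (?m (b * d)) - int (?m (c * b)))"
    unfolding s using ab cd by (intro abs_p_rat_frac) auto
  ultimately show ?thesis by simp
qed

lemma abs_p_rat_diff_le: "abs_p_rat p (r - t) \<le> max (abs_p_rat p (r - s)) (abs_p_rat p (s - t))"
  using abs_p_rat_add[of "r - s" "s - t"] by simp

text \<open>Isosceles triangles: the ultrametric inequality is used in both directions. Hence the
  absolute value is locally constant away from 0.\<close>

lemma abs_p_rat_eq_of_diff_less: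
  assumes "abs_p_rat p (r - s) < abs_p_rat p s"
  shows "abs_p_rat p r = abs_p_rat p s"
  using abs_p_rat_add[of "r - s" s] abs_p_rat_add[of "s - r" r] assms abs_p_rat_minus_commute[of r s] by auto

lemma abs_p_rat_abs_diff_le: "\<bar>abs_p_rat p r - abs_p_rat p s\<bar> \<le> abs_p_rat p (r - s)"
proof -
  have "abs_p_rat p r \<le> abs_p_rat p (r - s) + abs_p_rat p s" for r s
    using abs_p_rat_add[of "r - s" s] abs_p_rat_nonneg[of s] abs_p_rat_nonneg[of "r - s"]
    unfolding diff_add_cancel by linarith
  from this[of r s] this[of s r] show ?thesis
    by (simp add: abs_p_rat_minus_commute[of s r] abs_le_iff)
qed

section \<open>Cauchy sequences and their equivalence\<close>

lemma p_equiv_refl: "p_equiv p X X"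
  by (simp add: p_equiv_def)

lemma p_equiv_sym: "p_equiv p X Y \<Longrightarrow> p_equiv p Y X"
  by (simp add: p_equiv_def abs_p_rat_minus_commute)

lemma tendsto_0_squeeze:
  assumes "\<And>k. (0::real) \<le> f k" "\<And>k. f k \<le> g k" "g \<longlonglongrightarrow> 0"
  shows "f \<longlonglongrightarrow> 0"
  by (rule tendsto_sandwich[OF _ _ tendsto_const assms(3)]) (use assms in auto)

lemma p_equiv_trans: assumes "p_equiv p X Y" "p_equiv p Y Z" shows "p_equiv p X Z"
  unfolding p_equiv_def
proof (rule tendsto_0_squeeze)
  show "abs_p_rat p (X k - Z k) \<le> max (abs_p_rat p (X k - Y k)) (abs_p_rat p (Y k - Z k))" for k
    by (rule abs_p_rat_diff_le)
  show "(\<lambda>k. max (abs_p_rat p (X k - Y k)) (abs_p_rat p (Y k - Z k))) \<longlonglongrightarrow> 0"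
    using tendsto_max[OF assms[unfolded p_equiv_def]] by simp
qed simp

lemma p_equiv_add:
  assumes "p_equiv p X X'" "p_equiv p Y Y'"
  shows "p_equiv p (\<lambda>k. X k + Y k) (\<lambda>k. X' k + Y' k)"
  unfolding p_equiv_def
proof (rule tendsto_0_squeeze)
  show "abs_p_rat p (X k + Y k - (X' k + Y' k))
      \<le> max (abs_p_rat p (X k - X' k)) (abs_p_rat p (Y k - Y' k))" for k
    using abs_p_rat_add[of "X k - X' k" "Y k - Y' k"] by (simp add: algebra_simps)
  show "(\<lambda>k. max (abs_p_rat p (X k - X' k)) (abs_p_rat p (Y k - Y' k))) \<longlonglongrightarrow> 0"
    using tendsto_max[OF assms[unfolded p_equiv_def]] by simp
qed simp

lemma p_equiv_uminus: "p_equiv p X X' \<Longrightarrow> p_equiv p (\<lambda>k. - X k) (\<lambda>k. - X' k)"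
  unfolding p_equiv_def using abs_p_rat_minus_commute by (simp add: abs_p_rat_minus_commute)

lemma p_cauchy_add:
  assumes "p_cauchy p X" "p_cauchy p Y" shows "p_cauchy p (\<lambda>k. X k + Y k)"
  unfolding p_cauchy_def
proof (intro allI impI)
  fix e :: real assume "e > 0"
  then obtain M N where M: "\<forall>k\<ge>M. \<forall>l\<ge>M. abs_p_rat p (X k - X l) < e"
    and N: "\<forall>k\<ge>N. \<forall>l\<ge>N. abs_p_rat p (Y k - Y l) < e"
    using assms unfolding p_cauchy_def by meson
  have "abs_p_rat p (X k + Y k - (X l + Y l)) < e" if "k \<ge> max M N" "l \<ge> max M N" for k l
  proof -
    have "abs_p_rat p (X k + Y k - (X l + Y l)) \<le> max (abs_p_rat p (X k - X l)) (abs_p_rat p (Y k - Y l))"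
      using abs_p_rat_add[of "X k - X l" "Y k - Y l"] by (simp add: algebra_simps)
    also have "\<dots> < e" using M N that by auto
    finally show ?thesis .
  qed
  then show "\<exists>N. \<forall>k\<ge>N. \<forall>l\<ge>N. abs_p_rat p (X k + Y k - (X l + Y l)) < e" by blast
qed

lemma p_cauchy_uminus: "p_cauchy p X \<Longrightarrow> p_cauchy p (\<lambda>k. - X k)"
proof -
  have "abs_p_rat p (- X k - - X l) = abs_p_rat p (X k - X l)" for k l
    using abs_p_rat_minus[of "X k - X l"] by (simp add: algebra_simps)
  then show "p_cauchy p X \<Longrightarrow> p_cauchy p (\<lambda>k. - X k)" by (simp add: p_cauchy_def)
qed

lemma p_cauchy_const: "p_cauchy p (\<lambda>_. c)"
  by (simp add: p_cauchy_def)

text \<open>A sequence not tending to 0 has a term of size at least some \<open>e > 0\<close> beyond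
  the index where differences drop below e; the isosceles principle then fixes the value of all
  later terms. This is why \<open>qp_abs\<close> only takes the value 0 and powers of p.\<close>

lemma abs_seq_cases:
  assumes "p_cauchy p X"
  shows "(\<lambda>k. abs_p_rat p (X k)) \<longlonglongrightarrow> 0
       \<or> (\<exists>z. eventually (\<lambda>k. abs_p_rat p (X k) = real p powi z) sequentially)"
proof (rule disjCI)
  assume "\<nexists>z. eventually (\<lambda>k. abs_p_rat p (X k) = real p powi z) sequentially"
  show "(\<lambda>k. abs_p_rat p (X k)) \<longlonglongrightarrow> 0"
  proof (rule ccontr)
    assume "\<not> ?thesis"
    then obtain e where e: "e > 0" "\<And>N. \<exists>k\<ge>N. \<not> abs_p_rat p (X k) < e"
      unfolding LIMSEQ_def by (auto simp: dist_real_def)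
    then obtain N where N: "\<forall>k\<ge>N. \<forall>l\<ge>N. abs_p_rat p (X k - X l) < e"
      using assms unfolding p_cauchy_def by meson
    obtain l where l: "l \<ge> N" "abs_p_rat p (X l) \<ge> e" using e(2)[of N] by auto
    then have "X l \<noteq> 0" using e(1) by auto
    then obtain z where z: "abs_p_rat p (X l) = real p powi z" using abs_p_rat_range by blast
    have "abs_p_rat p (X k) = real p powi z" if "k \<ge> N" for k
      using abs_p_rat_eq_of_diff_less[of "X k" "X l"] N that l z by fastforce
    then have "eventually (\<lambda>k. abs_p_rat p (X k) = real p powi z) sequentially"
      unfolding eventually_sequentially by blast
    with \<open>\<nexists>z. _ z\<close> show False by blast
  qed
qed

lemma abs_seq_convergent:
  assumes "p_cauchy p X" shows "convergent (\<lambda>k. abs_p_rat p (X k))"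
  using abs_seq_cases[OF assms]
proof
  assume "\<exists>z. eventually (\<lambda>k. abs_p_rat p (X k) = real p powi z) sequentially"
  then obtain z where "eventually (\<lambda>k. abs_p_rat p (X k) = real p powi z) sequentially" ..
  then show ?thesis using convergentI tendsto_eventually by metis
qed (auto simp: convergent_def)

lemma p_cauchy_bounded:
  assumes "p_cauchy p X" shows "\<exists>B>0. \<forall>k. abs_p_rat p (X k) \<le> B"
proof -
  have "Bseq (\<lambda>k. abs_p_rat p (X k))"
    using abs_seq_convergent[OF assms] by (rule convergent_imp_Bseq)
  then show ?thesis unfolding Bseq_def by auto
qed

lemma p_cauchy_mult:
  assumes "p_cauchy p X" "p_cauchy p Y" shows "p_cauchy p (\<lambda>k. X k * Y k)"
  unfolding p_cauchy_def
proof (intro allI impI)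
  fix e :: real assume e: "e > 0"
  obtain B where B: "B > 0" "\<And>k. abs_p_rat p (X k) \<le> B" using p_cauchy_bounded[OF assms(1)] by auto
  obtain C where C: "C > 0" "\<And>k. abs_p_rat p (Y k) \<le> C" using p_cauchy_bounded[OF assms(2)] by auto
  obtain M where M: "\<forall>k\<ge>M. \<forall>l\<ge>M. abs_p_rat p (X k - X l) < e / C"
    using assms(1) e C(1) unfolding p_cauchy_def by (meson divide_pos_pos)
  obtain N where N: "\<forall>k\<ge>N. \<forall>l\<ge>N. abs_p_rat p (Y k - Y l) < e / B"
    using assms(2) e B(1) unfolding p_cauchy_def by (meson divide_pos_pos)
  have "abs_p_rat p (X k * Y k - X l * Y l) < e" if kl: "k \<ge> max M N" "l \<ge> max M N" for k l
  proof -
    have "X k * Y k - X l * Y l = (X k - X l) * Y k + X l * (Y k - Y l)" by (simp add: algebra_simps)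
    then have "abs_p_rat p (X k * Y k - X l * Y l)
       \<le> max (abs_p_rat p (X k - X l) * abs_p_rat p (Y k)) (abs_p_rat p (X l) * abs_p_rat p (Y k - Y l))"
      using abs_p_rat_add abs_p_rat_mult by metis
    also have "\<dots> \<le> max (abs_p_rat p (X k - X l) * C) (B * abs_p_rat p (Y k - Y l))"
      using B C by (intro max.mono mult_left_mono mult_right_mono) auto
    also have "\<dots> < e" using M N kl B(1) C(1) by (auto simp: field_simps)
    finally show ?thesis .
  qed
  then show "\<exists>N. \<forall>k\<ge>N. \<forall>l\<ge>N. abs_p_rat p (X k * Y k - X l * Y l) < e" by blast
qed

text \<open>The telescoping \<open>X Y - X' Y' = (X - X') Y + X' (Y - Y')\<close> calls for bounds
  on \<open>Y\<close> and \<open>X'\<close>, whence the mixed Cauchy hypotheses.\<close>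

lemma p_equiv_mult:
  assumes "p_equiv p X X'" "p_equiv p Y Y'" "p_cauchy p X'" "p_cauchy p Y"
  shows "p_equiv p (\<lambda>k. X k * Y k) (\<lambda>k. X' k * Y' k)"
proof -
  obtain B where B: "\<And>k. abs_p_rat p (X' k) \<le> B" using p_cauchy_bounded[OF assms(3)] by auto
  obtain C where C: "\<And>k. abs_p_rat p (Y k) \<le> C" using p_cauchy_bounded[OF assms(4)] by auto
  show ?thesis
    unfolding p_equiv_def
  proof (rule tendsto_0_squeeze)
    show "abs_p_rat p (X k * Y k - X' k * Y' k)
        \<le> max (abs_p_rat p (X k - X' k) * C) (B * abs_p_rat p (Y k - Y' k))" for k
    proof -
      have "X k * Y k - X' k * Y' k = (X k - X' k) * Y k + X' k * (Y k - Y' k)"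
        by (simp add: algebra_simps)
      then have "abs_p_rat p (X k * Y k - X' k * Y' k)
         \<le> max (abs_p_rat p (X k - X' k) * abs_p_rat p (Y k)) (abs_p_rat p (X' k) * abs_p_rat p (Y k - Y' k))"
        using abs_p_rat_add abs_p_rat_mult by metis
      also have "\<dots> \<le> max (abs_p_rat p (X k - X' k) * C) (B * abs_p_rat p (Y k - Y' k))"
        using B C by (intro max.mono mult_left_mono mult_right_mono) auto
      finally show ?thesis .
    qed
    have "(\<lambda>k. max (abs_p_rat p (X k - X' k) * C) (B * abs_p_rat p (Y k - Y' k))) \<longlonglongrightarrow> max (0 * C) (B * 0)"
      using assms(1,2) unfolding p_equiv_def by (intro tendsto_max tendsto_mult tendsto_const)
    then show "(\<lambda>k. max (abs_p_rat p (X k - X' k) * C) (B * abs_p_rat p (Y k - Y' k))) \<longlonglongrightarrow> 0" by simp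
  qed simp
qed

lemma p_cauchy_sum: "finite I \<Longrightarrow> (\<And>i. i \<in> I \<Longrightarrow> p_cauchy p (X i)) \<Longrightarrow> p_cauchy p (\<lambda>k. \<Sum>i\<in>I. X i k)"
  by (induction I rule: finite_induct) (auto intro: p_cauchy_const p_cauchy_add)

section \<open>Operations on classes and independence of representatives\<close>

lemma qp_class_eqI:
  assumes "p_equiv p X Y" shows "qp_class p X = qp_class p Y"
  unfolding qp_class_def using assms p_equiv_sym p_equiv_trans by blast

lemma qp_class_in_Qp [simp, intro]: "p_cauchy p X \<Longrightarrow> qp_class p X \<in> Qp p"
  by (auto simp: Qp_def)

lemma qp_rep_class:
  assumes "p_cauchy p X"
  shows "p_cauchy p (qp_rep (qp_class p X))" "p_equiv p X (qp_rep (qp_class p X))"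
proof -
  have "X \<in> qp_class p X" using assms p_equiv_refl by (auto simp: qp_class_def)
  then have "qp_rep (qp_class p X) \<in> qp_class p X" unfolding qp_rep_def by (rule someI[where P="\<lambda>Y. Y \<in> qp_class p X"])
  then show "p_cauchy p (qp_rep (qp_class p X))" "p_equiv p X (qp_rep (qp_class p X))"
    by (auto simp: qp_class_def)
qed

lemma p_cauchy_rep: "x \<in> Qp p \<Longrightarrow> p_cauchy p (qp_rep x)"
  unfolding Qp_def using qp_rep_class by auto

lemma qp_class_rep: "x \<in> Qp p \<Longrightarrow> qp_class p (qp_rep x) = x"
  unfolding Qp_def by (metis (no_types, lifting) imageE mem_Collect_eq qp_rep_class(2) qp_class_eqI)

lemma Qp_cases:
  assumes "x \<in> Qp p" obtains X where "p_cauchy p X" "x = qp_class p X"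
  using assms by (auto simp: Qp_def)

text \<open>\<open>qp_rep\<close> picks an unspecified representative, but one equivalent to any
  given one, and \<open>p_equiv\<close> is compatible with the operation. From here on computations
  take place on arbitrary representing sequences.\<close>

lemma qp_add_class:
  assumes "p_cauchy p X" "p_cauchy p Y"
  shows "qp_add p (qp_class p X) (qp_class p Y) = qp_class p (\<lambda>k. X k + Y k)"
  unfolding qp_add_def
  by (intro qp_class_eqI p_equiv_sym[OF p_equiv_add] qp_rep_class assms)

lemma qp_uminus_class:
  assumes "p_cauchy p X" shows "qp_uminus p (qp_class p X) = qp_class p (\<lambda>k. - X k)"
  unfolding qp_uminus_def
  by (intro qp_class_eqI p_equiv_sym[OF p_equiv_uminus] qp_rep_class assms)

lemma qp_mult_class:
  assumes "p_cauchy p X" "p_cauchy p Y"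
  shows "qp_mult p (qp_class p X) (qp_class p Y) = qp_class p (\<lambda>k. X k * Y k)"
  unfolding qp_mult_def
  by (intro qp_class_eqI p_equiv_mult p_equiv_sym[OF qp_rep_class(2)] assms qp_rep_class)

text \<open>By the reverse triangle inequality equivalent sequences have absolute values with the
  same limit, so the limit along the chosen representative can be computed along any other.\<close>

lemma qp_abs_class_tendsto:
  assumes "p_cauchy p X" shows "(\<lambda>k. abs_p_rat p (X k)) \<longlonglongrightarrow> qp_abs p (qp_class p X)"
proof -
  let ?R = "qp_rep (qp_class p X)"
  have "(\<lambda>k. abs_p_rat p (?R k)) \<longlonglongrightarrow> qp_abs p (qp_class p X)"
    unfolding qp_abs_def
    using abs_seq_convergent[OF qp_rep_class(1)[OF assms]] by (simp add: convergent_LIMSEQ_iff)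
  moreover have "(\<lambda>k. abs_p_rat p (X k) - abs_p_rat p (?R k)) \<longlonglongrightarrow> 0"
  proof (rule tendsto_rabs_zero_cancel, rule tendsto_0_squeeze)
    show "(\<lambda>k. abs_p_rat p (X k - ?R k)) \<longlonglongrightarrow> 0"
      using qp_rep_class(2)[OF assms] by (simp add: p_equiv_def)
  qed (use abs_p_rat_abs_diff_le in auto)
  ultimately have "(\<lambda>k. (abs_p_rat p (X k) - abs_p_rat p (?R k)) + abs_p_rat p (?R k))
      \<longlonglongrightarrow> 0 + qp_abs p (qp_class p X)" by (intro tendsto_add)
  then show ?thesis by simp
qed

lemma qp_zero_in [simp]: "qp_zero p \<in> Qp p" and qp_one_in [simp]: "qp_one p \<in> Qp p"
  by (auto simp: qp_zero_def qp_one_def p_cauchy_const)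

lemma qp_add_in [simp]: "x \<in> Qp p \<Longrightarrow> y \<in> Qp p \<Longrightarrow> qp_add p x y \<in> Qp p"
  unfolding qp_add_def by (intro qp_class_in_Qp p_cauchy_add p_cauchy_rep)

lemma qp_uminus_in [simp]: "x \<in> Qp p \<Longrightarrow> qp_uminus p x \<in> Qp p"
  unfolding qp_uminus_def by (intro qp_class_in_Qp p_cauchy_uminus p_cauchy_rep)

lemma qp_mult_in [simp]: "x \<in> Qp p \<Longrightarrow> y \<in> Qp p \<Longrightarrow> qp_mult p x y \<in> Qp p"
  unfolding qp_mult_def by (intro qp_class_in_Qp p_cauchy_mult p_cauchy_rep)

text \<open>The fold is evaluated through its graph: every value reached by adding the members of a
  subset J of I in some order is the class of the pointwise sum over J, which gives the uniqueness
  behind \<open>THE\<close>. The induction stays among classes of Cauchy sequences, where addition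
  is pointwise.\<close>

lemma qp_sum_class:
  assumes "finite I" "\<And>i. i \<in> I \<Longrightarrow> p_cauchy p (X i)"
  shows "qp_sum p (\<lambda>i. qp_class p (X i)) I = qp_class p (\<lambda>k. \<Sum>i\<in>I. X i k)"
proof -
  let ?f = "\<lambda>j acc. qp_add p (qp_class p (X j)) acc"
  have uniq: "J \<subseteq> I \<Longrightarrow> y = qp_class p (\<lambda>k. \<Sum>i\<in>J. X i k)"
    if "fold_graph ?f (qp_zero p) J y" for J y
    using that
  proof (induction rule: fold_graph.induct)
    case emptyI
    then show ?case by (simp add: qp_zero_def)
  next
    case (insertI x A y)
    have "finite A" using insertI.prems assms(1) finite_subset by auto
    have "y = qp_class p (\<lambda>k. \<Sum>i\<in>A. X i k)" using insertI by auto
    moreover have "p_cauchy p (\<lambda>k. \<Sum>i\<in>A. X i k)"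
      using insertI.prems \<open>finite A\<close> by (intro p_cauchy_sum assms(2)) auto
    ultimately show ?case
      using insertI \<open>finite A\<close> assms(2) by (auto simp: qp_add_class)
  qed
  obtain y where y: "fold_graph ?f (qp_zero p) I y" using finite_imp_fold_graph[OF assms(1), of ?f "qp_zero p"] by blast
  have "(THE y. fold_graph ?f (qp_zero p) I y) = qp_class p (\<lambda>k. \<Sum>i\<in>I. X i k)"
    using y uniq by (intro the_equality) auto
  then show ?thesis using assms(1) by (simp add: qp_sum_def Finite_Set.fold_def)
qed

lemma qp_sum_rep:
  assumes "finite I" "\<And>i. i \<in> I \<Longrightarrow> f i \<in> Qp p"
  shows "qp_sum p f I = qp_class p (\<lambda>k. \<Sum>i\<in>I. qp_rep (f i) k)"
proof -
  have "Finite_Set.fold (\<lambda>j acc. qp_add p (f j) acc) (qp_zero p) I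
      = Finite_Set.fold (\<lambda>j acc. qp_add p (qp_class p (qp_rep (f j))) acc) (qp_zero p) I"
    by (rule fold_closed_eq[where B=UNIV]) (simp_all add: qp_class_rep assms)
  then have "qp_sum p f I = qp_sum p (\<lambda>i. qp_class p (qp_rep (f i))) I"
    by (simp add: qp_sum_def)
  also have "\<dots> = qp_class p (\<lambda>k. \<Sum>i\<in>I. qp_rep (f i) k)"
    using assms by (intro qp_sum_class p_cauchy_rep)
  finally show ?thesis .
qed

lemma qp_sum_in [simp]: "finite I \<Longrightarrow> (\<And>i. i \<in> I \<Longrightarrow> f i \<in> Qp p) \<Longrightarrow> qp_sum p f I \<in> Qp p"
  by (simp add: qp_sum_rep qp_class_in_Qp p_cauchy_sum p_cauchy_rep)

lemma qp_sum_empty: "qp_sum p f {} = qp_zero p"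
  by (simp add: qp_sum_def)

lemma qp_sum_insert:
  assumes "finite I" "i \<notin> I" "\<And>j. j \<in> insert i I \<Longrightarrow> f j \<in> Qp p"
  shows "qp_sum p f (insert i I) = qp_add p (f i) (qp_sum p f I)"
proof -
  have "qp_add p (f i) (qp_sum p f I)
      = qp_add p (qp_class p (qp_rep (f i))) (qp_class p (\<lambda>k. \<Sum>i\<in>I. qp_rep (f i) k))"
    using assms by (simp add: qp_sum_rep qp_class_rep)
  also have "\<dots> = qp_class p (\<lambda>k. qp_rep (f i) k + (\<Sum>i\<in>I. qp_rep (f i) k))"
    using assms by (intro qp_add_class p_cauchy_rep p_cauchy_sum) auto
  also have "\<dots> = qp_sum p f (insert i I)"
    using assms by (subst qp_sum_rep) auto
  finally show ?thesis by simp
qed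

section \<open>The p-adic absolute value\<close>

lemma qp_abs_nonneg [simp]: "x \<in> Qp p \<Longrightarrow> 0 \<le> qp_abs p x"
  by (elim Qp_cases) (use LIMSEQ_le_const[OF qp_abs_class_tendsto] in auto)

lemma qp_abs_range:
  assumes "x \<in> Qp p" shows "qp_abs p x = 0 \<or> (\<exists>z. qp_abs p x = real p powi z)"
proof -
  obtain X where X: "p_cauchy p X" "x = qp_class p X" using assms by (rule Qp_cases)
  then show ?thesis
    using abs_seq_cases[OF X(1)] qp_abs_class_tendsto[OF X(1)] tendsto_eventually LIMSEQ_unique
    by metis
qed

lemma qp_abs_zero [simp]: "qp_abs p (qp_zero p) = 0"
  using qp_abs_class_tendsto[OF p_cauchy_const, of 0] by (simp add: qp_zero_def LIMSEQ_const_iff)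

lemma qp_abs_one [simp]: "qp_abs p (qp_one p) = 1"
  using qp_abs_class_tendsto[OF p_cauchy_const, of 1] by (simp add: qp_one_def LIMSEQ_const_iff)

lemma qp_abs_eq_0: "x \<in> Qp p \<Longrightarrow> qp_abs p x = 0 \<Longrightarrow> x = qp_zero p"
  by (elim Qp_cases)
    (auto simp: qp_zero_def p_equiv_def intro!: qp_class_eqI dest: qp_abs_class_tendsto)

lemma qp_abs_add:
  assumes "x \<in> Qp p" "y \<in> Qp p"
  shows "qp_abs p (qp_add p x y) \<le> max (qp_abs p x) (qp_abs p y)"
proof -
  obtain X where X: "p_cauchy p X" "x = qp_class p X" using assms(1) by (rule Qp_cases)
  obtain Y where Y: "p_cauchy p Y" "y = qp_class p Y" using assms(2) by (rule Qp_cases)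
  show ?thesis
    unfolding X(2) Y(2) qp_add_class[OF X(1) Y(1)]
    by (rule LIMSEQ_le[OF qp_abs_class_tendsto tendsto_max[OF qp_abs_class_tendsto qp_abs_class_tendsto]])
      (use X Y abs_p_rat_add p_cauchy_add in auto)
qed

lemma qp_abs_mult:
  assumes "x \<in> Qp p" "y \<in> Qp p"
  shows "qp_abs p (qp_mult p x y) = qp_abs p x * qp_abs p y"
proof -
  obtain X where X: "p_cauchy p X" "x = qp_class p X" using assms(1) by (rule Qp_cases)
  obtain Y where Y: "p_cauchy p Y" "y = qp_class p Y" using assms(2) by (rule Qp_cases)
  have "(\<lambda>k. abs_p_rat p (X k * Y k)) \<longlonglongrightarrow> qp_abs p x * qp_abs p y"
    unfolding abs_p_rat_mult X(2) Y(2) by (intro tendsto_mult qp_abs_class_tendsto X Y)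
  moreover have "(\<lambda>k. abs_p_rat p (X k * Y k)) \<longlonglongrightarrow> qp_abs p (qp_mult p x y)"
    unfolding X(2) Y(2) qp_mult_class[OF X(1) Y(1)] by (intro qp_abs_class_tendsto p_cauchy_mult X Y)
  ultimately show ?thesis using LIMSEQ_unique by blast
qed

lemma qp_abs_uminus:
  assumes "x \<in> Qp p" shows "qp_abs p (qp_uminus p x) = qp_abs p x"
proof -
  obtain X where X: "p_cauchy p X" "x = qp_class p X" using assms by (rule Qp_cases)
  have "(\<lambda>k. abs_p_rat p (- X k)) \<longlonglongrightarrow> qp_abs p x"
    unfolding abs_p_rat_minus X(2) by (intro qp_abs_class_tendsto X)
  moreover have "(\<lambda>k. abs_p_rat p (- X k)) \<longlonglongrightarrow> qp_abs p (qp_uminus p x)"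
    unfolding X(2) qp_uminus_class[OF X(1)] by (intro qp_abs_class_tendsto p_cauchy_uminus X)
  ultimately show ?thesis using LIMSEQ_unique by blast
qed

lemma qp_abs_sum_le:
  assumes "finite I" "\<And>i. i \<in> I \<Longrightarrow> f i \<in> Qp p" "\<And>i. i \<in> I \<Longrightarrow> qp_abs p (f i) \<le> B" "0 \<le> B"
  shows "qp_abs p (qp_sum p f I) \<le> B"
  using assms
proof (induction I rule: finite_induct)
  case (insert i I)
  have "qp_abs p (qp_sum p f (insert i I)) \<le> max (qp_abs p (f i)) (qp_abs p (qp_sum p f I))"
    using insert by (subst qp_sum_insert) (auto intro!: qp_abs_add)
  then show ?case using insert by fastforce
qed (simp add: qp_sum_empty)

section \<open>Ring identities in Q_p and rational approximation\<close>

lemma p_cauchy_diff: "p_cauchy p X \<Longrightarrow> p_cauchy p Y \<Longrightarrow> p_cauchy p (\<lambda>k. X k - Y k)"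
  using p_cauchy_add[OF _ p_cauchy_uminus, of X Y] by simp

lemmas qp_class_simps = p_cauchy_diff qp_add_class qp_uminus_class qp_mult_class
  p_cauchy_add p_cauchy_uminus p_cauchy_mult p_cauchy_const p_cauchy_sum

lemma qp_add_uminus: "x \<in> Qp p \<Longrightarrow> qp_add p x (qp_uminus p x) = qp_zero p"
  by (elim Qp_cases) (simp add: qp_class_simps qp_zero_def)

lemma qp_uminus_diff:
  "\<lbrakk>x \<in> Qp p; y \<in> Qp p\<rbrakk> \<Longrightarrow>
    qp_uminus p (qp_add p x (qp_uminus p y)) = qp_add p y (qp_uminus p x)"
  by (elim Qp_cases) (simp add: qp_class_simps)

lemma qp_diff_zero: "x \<in> Qp p \<Longrightarrow> qp_add p x (qp_uminus p (qp_zero p)) = x"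
  by (elim Qp_cases) (simp add: qp_class_simps qp_zero_def)

lemma qp_diff_chain:
  "\<lbrakk>x \<in> Qp p; y \<in> Qp p; z \<in> Qp p\<rbrakk> \<Longrightarrow> qp_add p x (qp_uminus p z)
    = qp_add p (qp_add p x (qp_uminus p y)) (qp_add p y (qp_uminus p z))"
  by (elim Qp_cases) (simp add: qp_class_simps)

lemma qp_diff_diff:
  "\<lbrakk>x \<in> Qp p; y \<in> Qp p; c \<in> Qp p\<rbrakk> \<Longrightarrow> qp_add p (qp_add p x (qp_uminus p c)) (qp_uminus p y)
    = qp_add p x (qp_uminus p (qp_add p y c))"
  by (elim Qp_cases) (simp add: qp_class_simps algebra_simps)

lemma qp_add_diff_add:
  "\<lbrakk>x \<in> Qp p; y \<in> Qp p; a \<in> Qp p; b \<in> Qp p\<rbrakk> \<Longrightarrow>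
    qp_add p (qp_add p x y) (qp_uminus p (qp_add p a b))
    = qp_add p (qp_add p x (qp_uminus p a)) (qp_add p y (qp_uminus p b))"
  by (elim Qp_cases) (simp add: qp_class_simps algebra_simps)

text \<open>Prepares the continuity of multiplication: each summand on the right has one small
  factor.\<close>

lemma qp_mult_diff_mult:
  "\<lbrakk>x \<in> Qp p; y \<in> Qp p; a \<in> Qp p; b \<in> Qp p\<rbrakk> \<Longrightarrow>
    qp_add p (qp_mult p x y) (qp_uminus p (qp_mult p a b))
    = qp_add p (qp_mult p (qp_add p x (qp_uminus p a)) y) (qp_mult p a (qp_add p y (qp_uminus p b)))"
  by (elim Qp_cases) (simp add: qp_class_simps algebra_simps)

text \<open>A late term \<open>X N\<close> of a representing Cauchy sequence is within p^k of all
  later terms, hence of the limit.\<close>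

lemma Qp_rational_approx:
  assumes "x \<in> Qp p"
  shows "\<exists>r. qp_abs p (qp_add p x (qp_uminus p (qp_class p (\<lambda>_. r)))) \<le> real p powi k"
proof -
  obtain X where X: "p_cauchy p X" "x = qp_class p X" using assms by (rule Qp_cases)
  obtain N where N: "\<forall>k'\<ge>N. \<forall>l\<ge>N. abs_p_rat p (X k' - X l) < real p powi k"
    using X(1) powi_pos unfolding p_cauchy_def by meson
  have c: "p_cauchy p (\<lambda>k. X k + - X N)"
    by (intro p_cauchy_add X p_cauchy_const)
  have "qp_abs p (qp_class p (\<lambda>k. X k + - X N)) \<le> real p powi k"
    using N less_imp_le by (intro LIMSEQ_le_const2[OF qp_abs_class_tendsto[OF c]] exI[of _ N]) auto
  also have "qp_class p (\<lambda>k. X k + - X N) = qp_add p x (qp_uminus p (qp_class p (\<lambda>_. X N)))"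
    unfolding X(2) using X(1) by (simp only: qp_uminus_class qp_add_class p_cauchy_const)
  finally have "qp_abs p (qp_add p x (qp_uminus p (qp_class p (\<lambda>_. X N)))) \<le> real p powi k" .
  then show ?thesis ..
qed

subsection \<open>Vectors\<close>

definition vsub :: "('n::finite \<Rightarrow> qp) \<Rightarrow> ('n \<Rightarrow> qp) \<Rightarrow> ('n \<Rightarrow> qp)" where
  "vsub x y = (\<lambda>i. qp_add p (x i) (qp_uminus p (y i)))"

definition vadd :: "('n::finite \<Rightarrow> qp) \<Rightarrow> ('n \<Rightarrow> qp) \<Rightarrow> ('n \<Rightarrow> qp)" where
  "vadd x y = (\<lambda>i. qp_add p (x i) (y i))"

definition vzero :: "'n::finite \<Rightarrow> qp" where
  "vzero = (\<lambda>i. qp_zero p)"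

abbreviation vdist :: "('n::finite \<Rightarrow> qp) \<Rightarrow> ('n \<Rightarrow> qp) \<Rightarrow> real" where
  "vdist x y \<equiv> qpv_norm p (vsub x y)"

lemma Qpn_D: "x \<in> Qpn p \<Longrightarrow> x i \<in> Qp p"
  by (simp add: Qpn_def)

lemma vsub_in [simp]: "x \<in> Qpn p \<Longrightarrow> y \<in> Qpn p \<Longrightarrow> vsub x y \<in> Qpn p"
  and vadd_in [simp]: "x \<in> Qpn p \<Longrightarrow> y \<in> Qpn p \<Longrightarrow> vadd x y \<in> Qpn p"
  and vzero_in [simp]: "vzero \<in> Qpn p"
  by (simp_all add: Qpn_def vsub_def vadd_def vzero_def)

lemma qpv_norm_le_iff: "qpv_norm p x \<le> r \<longleftrightarrow> (\<forall>i. qp_abs p (x i) \<le> r)"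
  by (simp add: qpv_norm_def)

lemma qp_abs_le_qpv_norm: "qp_abs p (x i) \<le> qpv_norm p x"
  using qpv_norm_le_iff by blast

lemma qpv_norm_nonneg [simp]: "x \<in> Qpn p \<Longrightarrow> 0 \<le> qpv_norm p x"
  using order_trans[OF qp_abs_nonneg[OF Qpn_D] qp_abs_le_qpv_norm] .

lemma qpv_norm_attained: "\<exists>i. qpv_norm p x = qp_abs p (x i)"
proof -
  have "Max (range (\<lambda>i. qp_abs p (x i))) \<in> range (\<lambda>i. qp_abs p (x i))"
    by (rule Max_in) auto
  then show ?thesis unfolding qpv_norm_def by blast
qed

lemma qpv_norm_range:
  "x \<in> Qpn p \<Longrightarrow> qpv_norm p x = 0 \<or> (\<exists>z. qpv_norm p x = real p powi z)"
  using qpv_norm_attained[of x] qp_abs_range[OF Qpn_D] by fastforce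

lemma qpv_norm_zero [simp]: "qpv_norm p vzero = 0"
  by (simp add: qpv_norm_def vzero_def)

lemma qpv_norm_eq_0: "x \<in> Qpn p \<Longrightarrow> qpv_norm p x = 0 \<Longrightarrow> x = vzero"
  unfolding vzero_def
  by (intro ext qp_abs_eq_0 antisym) (use qp_abs_le_qpv_norm[of x] in \<open>auto simp: Qpn_D\<close>)

lemma vdist_self [simp]: "x \<in> Qpn p \<Longrightarrow> vdist x x = 0"
  by (simp add: qpv_norm_def vsub_def qp_add_uminus Qpn_D)

lemma vsub_zero [simp]: "x \<in> Qpn p \<Longrightarrow> vsub x vzero = x"
  by (simp add: vsub_def vzero_def qp_diff_zero Qpn_D)

lemma vdist_commute: "x \<in> Qpn p \<Longrightarrow> y \<in> Qpn p \<Longrightarrow> vdist x y = vdist y x"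
proof -
  assume "x \<in> Qpn p" "y \<in> Qpn p"
  note this[THEN Qpn_D]
  then have "qp_abs p (vsub x y i) = qp_abs p (vsub y x i)" for i
    using qp_abs_uminus[of "vsub x y i"] by (simp add: vsub_def qp_uminus_diff)
  then show ?thesis by (simp add: qpv_norm_def)
qed

lemma vdist_ultra:
  assumes "x \<in> Qpn p" "y \<in> Qpn p" "z \<in> Qpn p" "vdist x y \<le> r" "vdist y z \<le> r"
  shows "vdist x z \<le> r"
  unfolding qpv_norm_le_iff
proof
  fix i
  have "qp_abs p (vsub x z i) \<le> max (qp_abs p (vsub x y i)) (qp_abs p (vsub y z i))"
    using assms(1-3)[THEN Qpn_D] unfolding vsub_def
    by (subst qp_diff_chain[of _ "y i"]) (auto intro!: qp_abs_add)
  also have "\<dots> \<le> r"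
    using assms(4,5) by (simp add: qpv_norm_le_iff)
  finally show "qp_abs p (vsub x z i) \<le> r" .
qed

text \<open>Identifies the preimage of a ball under a translation as a ball of the same
  radius.\<close>

lemma vsub_vsub:
  "x \<in> Qpn p \<Longrightarrow> y \<in> Qpn p \<Longrightarrow> c \<in> Qpn p \<Longrightarrow> vsub (vsub x c) y = vsub x (vadd y c)"
  by (simp add: vsub_def vadd_def qp_diff_diff Qpn_D)

lemma vec_rational_approx:
  assumes "x \<in> Qpn p"
  shows "\<exists>r. vdist x (\<lambda>i. qp_class p (\<lambda>_. r i)) \<le> real p powi k"
proof -
  have "\<forall>i. \<exists>r. qp_abs p (qp_add p (x i) (qp_uminus p (qp_class p (\<lambda>_. r)))) \<le> real p powi k"
    using assms[THEN Qpn_D] Qp_rational_approx by simp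
  then obtain r where "\<And>i. qp_abs p (qp_add p (x i) (qp_uminus p (qp_class p (\<lambda>_. r i)))) \<le> real p powi k"
    by metis
  then show ?thesis by (auto simp: qpv_norm_le_iff vsub_def)
qed

subsection \<open>Matrices\<close>

text \<open>Entrywise representatives reduce matrix identities to identities between rational
  matrices, one for each sequence index.\<close>

lemma mat_vec_class:
  assumes "\<And>i j. p_cauchy p (F i j)" "\<And>j. p_cauchy p (X j)"
  shows "qp_mat_vec p (\<lambda>i j. qp_class p (F i j)) (\<lambda>j. qp_class p (X j))
       = (\<lambda>i. qp_class p (\<lambda>k. \<Sum>j\<in>UNIV. F i j k * X j k))"
  using assms by (simp add: qp_mat_vec_def qp_mult_class qp_sum_class p_cauchy_mult)

lemma mat_mult_class:
  assumes "\<And>i j. p_cauchy p (F i j)" "\<And>i j. p_cauchy p (G i j)"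
  shows "qp_mat_mult p (\<lambda>i j. qp_class p (F i j)) (\<lambda>i j. qp_class p (G i j))
       = (\<lambda>i l. qp_class p (\<lambda>k. \<Sum>j\<in>UNIV. F i j k * G j l k))"
  using assms by (simp add: qp_mat_mult_def qp_mult_class qp_sum_class p_cauchy_mult)

lemma qp_matrix_cases:
  assumes "qp_matrix p M"
  obtains F where "\<And>i j. p_cauchy p (F i j)" "M = (\<lambda>i j. qp_class p (F i j))"
proof
  show "p_cauchy p (qp_rep (M i j))" for i j
    using assms by (simp add: qp_matrix_def p_cauchy_rep)
  show "M = (\<lambda>i j. qp_class p (qp_rep (M i j)))"
    using assms by (simp add: qp_matrix_def qp_class_rep)
qed

lemma Qpn_cases:
  assumes "x \<in> Qpn p"
  obtains X where "\<And>i. p_cauchy p (X i)" "x = (\<lambda>i. qp_class p (X i))"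
proof
  show "p_cauchy p (qp_rep (x i))" for i
    using assms[THEN Qpn_D] by (simp add: p_cauchy_rep)
  show "x = (\<lambda>i. qp_class p (qp_rep (x i)))"
    using assms[THEN Qpn_D] by (simp add: qp_class_rep)
qed

lemma mat_vec_in [simp]: "qp_matrix p M \<Longrightarrow> x \<in> Qpn p \<Longrightarrow> qp_mat_vec p M x \<in> Qpn p"
  unfolding qp_mat_vec_def Qpn_def qp_matrix_def by simp

lemma mat_vec_vsub:
  assumes "qp_matrix p M" "x \<in> Qpn p" "y \<in> Qpn p"
  shows "qp_mat_vec p M (vsub x y) = vsub (qp_mat_vec p M x) (qp_mat_vec p M y)"
proof -
  obtain F where F: "\<And>i j. p_cauchy p (F i j)" "M = (\<lambda>i j. qp_class p (F i j))"
    using qp_matrix_cases[OF assms(1)] by metis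
  obtain X where X: "\<And>i. p_cauchy p (X i)" "x = (\<lambda>i. qp_class p (X i))"
    using Qpn_cases[OF assms(2)] by metis
  obtain Y where Y: "\<And>i. p_cauchy p (Y i)" "y = (\<lambda>i. qp_class p (Y i))"
    using Qpn_cases[OF assms(3)] by metis
  show ?thesis
    unfolding F(2) X(2) Y(2) vsub_def
    using F(1) X(1) Y(1)
    by (simp add: mat_vec_class qp_uminus_class qp_add_class p_cauchy_diff p_cauchy_uminus
        p_cauchy_sum p_cauchy_mult sum_subtractf algebra_simps)
qed

lemma mat_vec_mat_vec:
  assumes "qp_matrix p M" "qp_matrix p N" "x \<in> Qpn p"
  shows "qp_mat_vec p M (qp_mat_vec p N x) = qp_mat_vec p (qp_mat_mult p M N) x"
proof -
  obtain F where F: "\<And>i j. p_cauchy p (F i j)" "M = (\<lambda>i j. qp_class p (F i j))"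
    using qp_matrix_cases[OF assms(1)] by metis
  obtain G where G: "\<And>i j. p_cauchy p (G i j)" "N = (\<lambda>i j. qp_class p (G i j))"
    using qp_matrix_cases[OF assms(2)] by metis
  obtain X where X: "\<And>i. p_cauchy p (X i)" "x = (\<lambda>i. qp_class p (X i))"
    using Qpn_cases[OF assms(3)] by metis
  have "(\<Sum>j\<in>UNIV. F i j k * (\<Sum>l\<in>UNIV. G j l k * X l k))
      = (\<Sum>l\<in>UNIV. (\<Sum>j\<in>UNIV. F i j k * G j l k) * X l k)" for i k
    unfolding sum_distrib_left sum_distrib_right by (subst sum.swap) (simp add: mult.assoc)
  then show ?thesis
    unfolding F(2) G(2) X(2)
    using F(1) X(1) G(1)
    by (simp add: mat_vec_class mat_mult_class p_cauchy_sum p_cauchy_mult)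
qed

lemma mat_vec_id: "x \<in> Qpn p \<Longrightarrow> qp_mat_vec p (qp_mat_id p) x = x"
proof -
  assume "x \<in> Qpn p"
  then obtain X where X: "\<And>i. p_cauchy p (X i)" "x = (\<lambda>i. qp_class p (X i))"
    using Qpn_cases by metis
  have I: "qp_mat_id p = (\<lambda>i j. qp_class p (\<lambda>k. if i = j then 1 else 0))"
    by (auto simp: qp_mat_id_def qp_one_def qp_zero_def fun_eq_iff)
  have "(\<Sum>j\<in>UNIV. (if i = j then 1 else 0) * X j k) = X i k" for i k
  proof -
    have "(\<Sum>j\<in>UNIV. (if i = j then 1 else 0) * X j k) = (\<Sum>j\<in>UNIV. if i = j then X j k else 0)"
      by (intro sum.cong) auto
    then show ?thesis by simp
  qed
  then show ?thesis
    unfolding I X(2) using X(1) by (simp add: mat_vec_class p_cauchy_const)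
qed

lemma qpm_norm_ge: "qp_abs p (M i j) \<le> qpm_norm p M"
proof -
  have "qp_abs p (M i j) \<in> range (\<lambda>(i, j). qp_abs p (M i j))"
    by (auto intro: image_eqI[of _ _ "(i, j)"])
  then show ?thesis unfolding qpm_norm_def by (intro Max_ge) auto
qed

lemma qpm_norm_attained: "\<exists>i j. qpm_norm p M = qp_abs p (M i j)"
proof -
  have "Max (range (\<lambda>(i, j). qp_abs p (M i j))) \<in> range (\<lambda>(i, j). qp_abs p (M i j))"
    by (rule Max_in) auto
  then obtain ij where "qpm_norm p M = (\<lambda>(i, j). qp_abs p (M i j)) ij"
    unfolding qpm_norm_def by blast
  then show ?thesis by (cases ij) auto
qed

lemma qpm_norm_nonneg [simp]: "qp_matrix p M \<Longrightarrow> 0 \<le> qpm_norm p M"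
proof -
  assume M: "qp_matrix p M"
  obtain i j where "qpm_norm p M = qp_abs p (M i j)" using qpm_norm_attained by blast
  then show ?thesis using M by (simp add: qp_matrix_def)
qed

lemma qpm_norm_range:
  "qp_matrix p M \<Longrightarrow> qpm_norm p M = 0 \<or> (\<exists>z. qpm_norm p M = real p powi z)"
proof -
  assume M: "qp_matrix p M"
  obtain i j where "qpm_norm p M = qp_abs p (M i j)" using qpm_norm_attained by blast
  then show ?thesis using qp_abs_range[of "M i j"] M by (simp add: qp_matrix_def)
qed

lemma mat_vec_norm_le:
  assumes "qp_matrix p M" "x \<in> Qpn p"
  shows "qpv_norm p (qp_mat_vec p M x) \<le> qpm_norm p M * qpv_norm p x"
  unfolding qpv_norm_le_iff qp_mat_vec_def
proof (intro allI qp_abs_sum_le)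
  show "qp_mult p (M i j) (x j) \<in> Qp p" for i j
    using assms by (simp add: qp_matrix_def Qpn_D)
  show "qp_abs p (qp_mult p (M i j) (x j)) \<le> qpm_norm p M * qpv_norm p x" for i j
    using assms by (simp add: qp_matrix_def Qpn_D qp_abs_mult mult_mono qpm_norm_ge qp_abs_le_qpv_norm)
qed (use assms in auto)

lemma qp_mat_inv:
  assumes "qp_invertible p M"
  shows "qp_matrix p M" "qp_matrix p (qp_mat_inv p M)"
    and "x \<in> Qpn p \<Longrightarrow> qp_mat_vec p M (qp_mat_vec p (qp_mat_inv p M) x) = x"
    and "x \<in> Qpn p \<Longrightarrow> qp_mat_vec p (qp_mat_inv p M) (qp_mat_vec p M x) = x"
proof -
  let ?P = "\<lambda>N. qp_matrix p N \<and> qp_mat_mult p M N = qp_mat_id p \<and> qp_mat_mult p N M = qp_mat_id p"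
  have "\<exists>N. ?P N" using assms by (simp add: qp_invertible_def)
  then have *: "?P (qp_mat_inv p M)" unfolding qp_mat_inv_def by (rule someI_ex)
  show M: "qp_matrix p M" using assms by (simp add: qp_invertible_def)
  show "qp_matrix p (qp_mat_inv p M)" using * by simp
  show "x \<in> Qpn p \<Longrightarrow> qp_mat_vec p M (qp_mat_vec p (qp_mat_inv p M) x) = x"
    and "x \<in> Qpn p \<Longrightarrow> qp_mat_vec p (qp_mat_inv p M) (qp_mat_vec p M x) = x"
    using * M by (simp_all add: mat_vec_mat_vec mat_vec_id)
qed

lemma mat_vec_norm_ge:
  assumes "qp_invertible p M" "x \<in> Qpn p"
  shows "qpv_norm p x \<le> qpm_norm p (qp_mat_inv p M) * qpv_norm p (qp_mat_vec p M x)"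
  using mat_vec_norm_le[OF qp_mat_inv(2)[OF assms(1)], of "qp_mat_vec p M x"] assms
  by (simp add: qp_mat_inv)

text \<open>Multiplication by M and back, applied to the all-ones vector of norm 1. It keeps both
  norms away from 0 and makes \<open>1 / qpm_norm p M\<close> a lower bound for the norm of the
  inverse.\<close>

lemma qpm_norm_inv_ge_1:
  fixes M :: "'n::finite \<Rightarrow> 'n \<Rightarrow> qp"
  assumes "qp_invertible p M"
  shows "1 \<le> qpm_norm p M * qpm_norm p (qp_mat_inv p M)"
proof -
  define e :: "'n \<Rightarrow> qp" where "e = (\<lambda>_. qp_one p)"
  have e: "e \<in> Qpn p" "qpv_norm p e = 1" by (auto simp: e_def Qpn_def qpv_norm_def)
  have "1 \<le> qpm_norm p (qp_mat_inv p M) * qpv_norm p (qp_mat_vec p M e)"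
    using mat_vec_norm_ge[OF assms e(1)] e by simp
  also have "\<dots> \<le> qpm_norm p (qp_mat_inv p M) * (qpm_norm p M * qpv_norm p e)"
    using mat_vec_norm_le[OF qp_mat_inv(1)[OF assms] e(1)] qp_mat_inv(2)[OF assms]
    by (intro mult_left_mono) auto
  finally show ?thesis using e by (simp add: mult.commute)
qed

subsection \<open>Measurability\<close>

abbreviation sdist :: "qp \<Rightarrow> qp \<Rightarrow> real" where
  "sdist x y \<equiv> qp_abs p (qp_add p x (qp_uminus p y))"

lemma sdist_commute: "x \<in> Qp p \<Longrightarrow> y \<in> Qp p \<Longrightarrow> sdist x y = sdist y x"
  using qp_abs_uminus[of "qp_add p x (qp_uminus p y)"] by (simp add: qp_uminus_diff)

lemma sdist_ultra:
  assumes "x \<in> Qp p" "y \<in> Qp p" "z \<in> Qp p" "sdist x y \<le> r" "sdist y z \<le> r"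
  shows "sdist x z \<le> r"
proof -
  have "sdist x z \<le> max (sdist x y) (sdist y z)"
    using assms(1-3) by (subst qp_diff_chain[of _ y]) (auto intro!: qp_abs_add)
  with assms(4,5) show ?thesis by linarith
qed

lemma sdist_self: "x \<in> Qp p \<Longrightarrow> sdist x x = 0"
  by (simp add: qp_add_uminus)

text \<open>By the ultrametric inequality the distances to x and to a drop below the radius
  together. A rational approximation inside a ball thus serves as its centre, which leaves only
  countably many balls.\<close>

lemma qp_ball_center:
  assumes "x \<in> Qp p" "a \<in> qp_ball p x k" shows "qp_ball p a k = qp_ball p x k"
proof -
  have a: "a \<in> Qp p" "sdist a x \<le> real p powi k" "sdist x a \<le> real p powi k"
    using assms sdist_commute[of a x] by (auto simp: qp_ball_def)
  have "sdist y a \<le> real p powi k \<longleftrightarrow> sdist y x \<le> real p powi k" if "y \<in> Qp p" for y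
    using sdist_ultra[OF that a(1) assms(1)] sdist_ultra[OF that assms(1) a(1)] a(2,3) by blast
  then show ?thesis by (auto simp: qp_ball_def)
qed

lemma qpn_ball_iff: "x \<in> qpn_ball p a k \<longleftrightarrow> x \<in> Qpn p \<and> vdist x a \<le> real p powi k"
  by (simp add: qpn_ball_def vsub_def)

lemma qpn_ball_center:
  assumes "x \<in> Qpn p" "a \<in> qpn_ball p x k" shows "qpn_ball p a k = qpn_ball p x k"
proof -
  have a: "a \<in> Qpn p" "vdist a x \<le> real p powi k" "vdist x a \<le> real p powi k"
    using assms vdist_commute[of a x] by (auto simp: qpn_ball_iff)
  have "vdist y a \<le> real p powi k \<longleftrightarrow> vdist y x \<le> real p powi k" if "y \<in> Qpn p" for y
    using vdist_ultra[OF that a(1) assms(1)] vdist_ultra[OF that assms(1) a(1)] a(2,3) by blast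
  then show ?thesis by (auto simp: qpn_ball_iff)
qed

lemma qpn_ball_self: "x \<in> Qpn p \<Longrightarrow> x \<in> qpn_ball p x k"
  using powi_pos[of k] by (simp add: qpn_ball_iff)

lemma qp_ball_self: "x \<in> Qp p \<Longrightarrow> x \<in> qp_ball p x k"
  using powi_pos[of k] by (simp add: qp_ball_def sdist_self)

text \<open>The embedded rationals; they meet every ball and so provide centres for all of
  them.\<close>

definition ratpts :: "qp set" where "ratpts = range (\<lambda>r. qp_class p (\<lambda>_. r))"

definition ratvecs :: "('n::finite \<Rightarrow> qp) set" where
  "ratvecs = range (\<lambda>r i. qp_class p (\<lambda>_. r i))"

lemma countable_ratpts: "countable ratpts"
  by (simp add: ratpts_def)

lemma countable_ratvecs: "countable (ratvecs :: ('n::finite \<Rightarrow> qp) set)"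
proof -
  have "countable (UNIV :: ('n \<Rightarrow> rat) set)"
    using countable_PiE[of "UNIV :: 'n set" "\<lambda>_. UNIV :: rat set"] by simp
  then show ?thesis by (simp add: ratvecs_def)
qed

lemma ratpts_in: "ratpts \<subseteq> Qp p" and ratvecs_in: "ratvecs \<subseteq> Qpn p"
  by (auto simp: ratpts_def ratvecs_def Qpn_def p_cauchy_const)

lemma qp_ball_ratpt:
  assumes "x \<in> Qp p" shows "\<exists>c\<in>ratpts. qp_ball p x k = qp_ball p c k"
proof -
  obtain r where r: "sdist x (qp_class p (\<lambda>_. r)) \<le> real p powi k"
    using Qp_rational_approx[OF assms] by blast
  moreover have c: "qp_class p (\<lambda>_. r) \<in> Qp p"
    by (simp add: p_cauchy_const)
  ultimately have "qp_class p (\<lambda>_. r) \<in> qp_ball p x k"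
    using assms sdist_commute[OF assms c] c by (simp add: qp_ball_def)
  then have "qp_ball p x k = qp_ball p (qp_class p (\<lambda>_. r)) k"
    using qp_ball_center[OF assms] by blast
  then show ?thesis by (auto simp: ratpts_def)
qed

lemma qpn_ball_ratvec:
  assumes "x \<in> Qpn p" shows "\<exists>c\<in>ratvecs. qpn_ball p x k = qpn_ball p c k"
proof -
  obtain r where r: "vdist x (\<lambda>i. qp_class p (\<lambda>_. r i)) \<le> real p powi k"
    using vec_rational_approx[OF assms] by blast
  moreover have c: "(\<lambda>i. qp_class p (\<lambda>_. r i)) \<in> Qpn p"
    by (simp add: Qpn_def p_cauchy_const)
  ultimately have "(\<lambda>i. qp_class p (\<lambda>_. r i)) \<in> qpn_ball p x k"
    using assms vdist_commute[OF assms c] by (simp add: qpn_ball_iff)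
  then have "qpn_ball p x k = qpn_ball p (\<lambda>i. qp_class p (\<lambda>_. r i)) k"
    using qpn_ball_center[OF assms] by blast
  then show ?thesis by (auto simp: ratvecs_def)
qed

definition qpn_balls :: "('n::finite \<Rightarrow> qp) set set" where
  "qpn_balls = {qpn_ball p a k |a k. a \<in> Qpn p}"

lemma qpn_balls_subset: "qpn_balls \<subseteq> Pow (Qpn p)"
  by (auto simp: qpn_balls_def qpn_ball_def)

lemma haar_index_image:
  "(\<lambda>(a, k). qpn_ball p a k) ` {(a, k). a \<in> Qpn p} = qpn_balls"
  by (auto simp: qpn_balls_def image_iff)

lemma space_haar [simp]: "space (haar p :: ('n::finite \<Rightarrow> qp) measure) = Qpn p"
  unfolding haar_def by (subst space_extend_measure; simp only: haar_index_image qpn_balls_subset)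

lemma sets_haar: "sets (haar p :: ('n::finite \<Rightarrow> qp) measure) = sigma_sets (Qpn p) qpn_balls"
  unfolding haar_def by (subst sets_extend_measure; simp only: haar_index_image qpn_balls_subset)

lemma space_qp_borel [simp]: "space (qp_borel p) = Qp p"
  unfolding qp_borel_def by (subst space_measure_of) (auto simp: qp_ball_def)

lemma qp_ball_in_sets: "a \<in> Qp p \<Longrightarrow> qp_ball p a k \<in> sets (qp_borel p)"
  unfolding qp_borel_def by (subst sets_measure_of) (auto simp: qp_ball_def)

lemma qpn_ball_in_sets: "a \<in> Qpn p \<Longrightarrow> qpn_ball p a k \<in> sets (haar p)"
  unfolding sets_haar by (auto simp: qpn_balls_def)

text \<open>Radii are integer powers of p and centres may be taken rational, so a union of balls is
  a countable union.\<close>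

lemma haar_open_in_sets:
  fixes U :: "('n::finite \<Rightarrow> qp) set"
  assumes "U \<subseteq> Qpn p" "\<And>x. x \<in> U \<Longrightarrow> \<exists>k. qpn_ball p x k \<subseteq> U"
  shows "U \<in> sets (haar p)"
proof -
  let ?I = "{(c, k). c \<in> ratvecs \<and> qpn_ball p c k \<subseteq> U}"
  have "U = (\<Union>(c, k)\<in>?I. qpn_ball p c k)"
  proof
    show "U \<subseteq> (\<Union>(c, k)\<in>?I. qpn_ball p c k)"
    proof
      fix x assume x: "x \<in> U"
      then obtain k where k: "qpn_ball p x k \<subseteq> U" using assms by blast
      obtain c where "c \<in> ratvecs" "qpn_ball p x k = qpn_ball p c k"
        using qpn_ball_ratvec x assms(1) by blast
      with k x assms(1) qpn_ball_self[of x k] show "x \<in> (\<Union>(c, k)\<in>?I. qpn_ball p c k)" by auto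
    qed
  qed auto
  moreover have "countable ?I"
    by (rule countable_subset[OF _ countable_SIGMA[OF countable_ratvecs, of "\<lambda>_. UNIV"]]) auto
  then have "(\<Union>(c, k)\<in>?I. qpn_ball p c k) \<in> sets (haar p)"
    using ratvecs_in by (intro sets.countable_UN'') (auto intro!: qpn_ball_in_sets)
  ultimately show ?thesis by simp
qed

text \<open>The same countability puts the open sets of the product into the sigma-algebra generated
  by rectangles.\<close>

lemma qp_borel_pair_open_in_sets:
  assumes "U \<subseteq> Qp p \<times> Qp p"
    and "\<And>x y. (x, y) \<in> U \<Longrightarrow> \<exists>k. qp_ball p x k \<times> qp_ball p y k \<subseteq> U"
  shows "U \<in> sets (qp_borel p \<Otimes>\<^sub>M qp_borel p)"
proof -
  let ?B = "\<lambda>(c, d, k). qp_ball p c k \<times> qp_ball p d k"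
  let ?I = "{t \<in> ratpts \<times> ratpts \<times> UNIV. ?B t \<subseteq> U}"
  have "U = (\<Union>t\<in>?I. ?B t)"
  proof
    show "U \<subseteq> (\<Union>t\<in>?I. ?B t)"
    proof
      fix z assume z: "z \<in> U"
      obtain x y where xy: "z = (x, y)" by fastforce
      then obtain k where k: "qp_ball p x k \<times> qp_ball p y k \<subseteq> U" using assms(2) z by blast
      have x: "x \<in> Qp p" "y \<in> Qp p" using z xy assms(1) by auto
      obtain c where c: "c \<in> ratpts" "qp_ball p x k = qp_ball p c k" using qp_ball_ratpt x by blast
      obtain d where d: "d \<in> ratpts" "qp_ball p y k = qp_ball p d k" using qp_ball_ratpt x by blast
      have "z \<in> ?B (c, d, k)" using xy c d qp_ball_self x by auto
      moreover have "(c, d, k) \<in> ?I" using c d k by auto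
      ultimately show "z \<in> (\<Union>t\<in>?I. ?B t)" by blast
    qed
  qed auto
  moreover have "countable ?I"
    by (rule countable_subset[of _ "ratpts \<times> ratpts \<times> UNIV"]) (auto intro: countable_ratpts)
  then have "(\<Union>t\<in>?I. ?B t) \<in> sets (qp_borel p \<Otimes>\<^sub>M qp_borel p)"
    using ratpts_in by (intro sets.countable_UN'') (auto intro!: pair_measureI qp_ball_in_sets)
  ultimately show ?thesis by simp
qed

section \<open>Measurability of the algebraic operations and norms\<close>

lemma measurable_qp_borelI:
  assumes "\<And>x. x \<in> space M \<Longrightarrow> f x \<in> Qp p"
    and "\<And>a k. a \<in> Qp p \<Longrightarrow> {x \<in> space M. f x \<in> qp_ball p a k} \<in> sets M"
  shows "f \<in> measurable M (qp_borel p)"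
  unfolding qp_borel_def
  by (rule measurable_measure_of) (use assms in \<open>auto simp: qp_ball_def vimage_def Int_def conj_commute\<close>)

lemma qp_abs_add_le:
  "\<lbrakk>x \<in> Qp p; y \<in> Qp p; qp_abs p x \<le> r; qp_abs p y \<le> r\<rbrakk> \<Longrightarrow> qp_abs p (qp_add p x y) \<le> r"
  using qp_abs_add[of x y] by linarith

text \<open>Moving both summands by at most p^k moves the sum by at most p^k, so the preimage of a
  ball of radius p^k is a union of products of balls of that radius.\<close>

lemma qp_add_measurable:
  "(\<lambda>(x, y). qp_add p x y) \<in> measurable (qp_borel p \<Otimes>\<^sub>M qp_borel p) (qp_borel p)"
proof (rule measurable_qp_borelI)
  fix a k assume a: "a \<in> Qp p"
  show "{z \<in> space (qp_borel p \<Otimes>\<^sub>M qp_borel p). (case z of (x, y) \<Rightarrow> qp_add p x y) \<in> qp_ball p a k}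
      \<in> sets (qp_borel p \<Otimes>\<^sub>M qp_borel p)"
  proof (rule qp_borel_pair_open_in_sets, goal_cases)
    case (2 x y)
    then have xy: "x \<in> Qp p" "y \<in> Qp p" "sdist (qp_add p x y) a \<le> real p powi k"
      by (auto simp: space_pair_measure qp_ball_def)
    have "sdist (qp_add p x' y') a \<le> real p powi k"
      if "x' \<in> qp_ball p x k" "y' \<in> qp_ball p y k" for x' y'
    proof (rule sdist_ultra[of _ "qp_add p x y"])
      show "sdist (qp_add p x' y') (qp_add p x y) \<le> real p powi k"
        using that xy by (subst qp_add_diff_add) (auto simp: qp_ball_def intro!: qp_abs_add_le)
    qed (use that xy a in \<open>auto simp: qp_ball_def\<close>)
    then show ?case
      by (intro exI[of _ k]) (auto simp: space_pair_measure qp_ball_def)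
  qed (auto simp: space_pair_measure)
qed (auto simp: space_pair_measure)

lemma qp_mult_measurable:
  "(\<lambda>(x, y). qp_mult p x y) \<in> measurable (qp_borel p \<Otimes>\<^sub>M qp_borel p) (qp_borel p)"
proof (rule measurable_qp_borelI)
  fix a k assume a: "a \<in> Qp p"
  show "{z \<in> space (qp_borel p \<Otimes>\<^sub>M qp_borel p). (case z of (x, y) \<Rightarrow> qp_mult p x y) \<in> qp_ball p a k}
      \<in> sets (qp_borel p \<Otimes>\<^sub>M qp_borel p)"
  proof (rule qp_borel_pair_open_in_sets, goal_cases)
    case (2 x y)
    then have xy: "x \<in> Qp p" "y \<in> Qp p" "sdist (qp_mult p x y) a \<le> real p powi k"
      by (auto simp: space_pair_measure qp_ball_def)
    \<comment> \<open>A bound for both factors that is at least 1, so that it also bounds a factor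
      displaced by at most \<open>?e \<le> 1\<close>.\<close>
    define B where "B = max 1 (max (qp_abs p x) (qp_abs p y))"
    have B: "B \<ge> 1" "qp_abs p x \<le> B" "qp_abs p y \<le> B" by (auto simp: B_def)
    \<comment> \<open>By \<open>qp_mult_diff_mult\<close> the error consists of displacements times
      factors of size at most B, so \<open>?e * B\<close> has to stay below p^k.\<close>
    obtain j :: nat where j: "real p powi (- int j) < min 1 (real p powi k / B)"
      using powi_tendsto_0[of "min 1 (real p powi k / B)"] powi_pos[of k] B(1) by auto
    let ?e = "real p powi (- int j)"
    have e: "?e \<le> 1" "?e * B \<le> real p powi k" "0 \<le> ?e"
      using j B(1) powi_pos[of "- int j"] by (auto simp: field_simps)
    have "sdist (qp_mult p x' y') a \<le> real p powi k"
      if x': "x' \<in> qp_ball p x (- int j)" and y': "y' \<in> qp_ball p y (- int j)" for x' y'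
    proof (rule sdist_ultra[of _ "qp_mult p x y"])
      have in': "x' \<in> Qp p" "y' \<in> Qp p" and d: "sdist x' x \<le> ?e" "sdist y' y \<le> ?e"
        using x' y' by (auto simp: qp_ball_def)
      have "y' = qp_add p (qp_add p y' (qp_uminus p y)) y"
        using in' xy qp_diff_chain[of y' y "qp_zero p"] by (simp add: qp_diff_zero)
      then have "qp_abs p y' \<le> B"
        using qp_abs_add_le[of "qp_add p y' (qp_uminus p y)" y B] d e B in' xy by simp
      then have "sdist x' x * qp_abs p y' \<le> real p powi k"
        using mult_mono[OF d(1), of "qp_abs p y'" B] e in' by simp
      moreover have "qp_abs p x * sdist y' y \<le> real p powi k"
        using mult_mono[OF B(2) d(2)] e B(1) in' xy by (simp add: mult.commute)
      ultimately show "sdist (qp_mult p x' y') (qp_mult p x y) \<le> real p powi k"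
        using in' xy by (subst qp_mult_diff_mult) (auto simp: qp_abs_mult intro!: qp_abs_add_le)
    qed (use that xy a in \<open>auto simp: qp_ball_def\<close>)
    then show ?case
      by (intro exI[of _ "- int j"]) (auto simp: space_pair_measure qp_ball_def)
  qed (auto simp: space_pair_measure)
qed (auto simp: space_pair_measure)

lemma measurable_qp_add:
  assumes "f \<in> measurable M (qp_borel p)" "g \<in> measurable M (qp_borel p)"
  shows "(\<lambda>x. qp_add p (f x) (g x)) \<in> measurable M (qp_borel p)"
  using measurable_compose[OF measurable_Pair[OF assms] qp_add_measurable] by simp

lemma measurable_qp_mult:
  assumes "f \<in> measurable M (qp_borel p)" "g \<in> measurable M (qp_borel p)"
  shows "(\<lambda>x. qp_mult p (f x) (g x)) \<in> measurable M (qp_borel p)"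
  using measurable_compose[OF measurable_Pair[OF assms] qp_mult_measurable] by simp

lemma measurable_qp_space:
  "f \<in> measurable M (qp_borel p) \<Longrightarrow> x \<in> space M \<Longrightarrow> f x \<in> Qp p"
  using measurable_space[of f M "qp_borel p" x] by simp

lemma measurable_qp_sum:
  assumes "finite I" "\<And>i. i \<in> I \<Longrightarrow> f i \<in> measurable M (qp_borel p)"
  shows "(\<lambda>x. qp_sum p (\<lambda>i. f i x) I) \<in> measurable M (qp_borel p)"
  using assms
proof (induction I rule: finite_induct)
  case empty
  then show ?case by (simp add: qp_sum_empty)
next
  case (insert i I)
  have "(\<lambda>x. qp_add p (f i x) (qp_sum p (\<lambda>i. f i x) I)) \<in> measurable M (qp_borel p)"
    using insert by (intro measurable_qp_add) auto
  moreover have "qp_sum p (\<lambda>i. f i x) (insert i I) = qp_add p (f i x) (qp_sum p (\<lambda>i. f i x) I)"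
    if "x \<in> space M" for x
    using insert.prems that by (intro qp_sum_insert insert.hyps measurable_qp_space[OF _ that]) auto
  ultimately show ?case by (simp cong: measurable_cong)
qed

lemma measurable_coord: "(\<lambda>x. x i) \<in> measurable (haar p :: ('n::finite \<Rightarrow> qp) measure) (qp_borel p)"
proof (rule measurable_qp_borelI)
  fix a k assume a: "a \<in> Qp p"
  show "{x \<in> space (haar p :: ('n \<Rightarrow> qp) measure). x i \<in> qp_ball p a k} \<in> sets (haar p)"
  proof (rule haar_open_in_sets, goal_cases)
    case (2 x)
    have "y i \<in> qp_ball p a k" if "y \<in> qpn_ball p x k" for y
    proof -
      have "sdist (y i) (x i) \<le> real p powi k"
        using that by (simp add: qpn_ball_def qpv_norm_le_iff)
      then show ?thesis
        using 2 that sdist_ultra[of "y i" "x i" a "real p powi k"] a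
        by (auto simp: qpn_ball_def qp_ball_def Qpn_D)
    qed
    then show ?case by (intro exI[of _ k]) (auto simp: qpn_ball_def)
  qed auto
qed (simp add: Qpn_D)

text \<open>The norm is a maximum over coordinates, so a ball is a product of balls of Q_p and its
  preimage a finite intersection.\<close>

lemma measurable_haarI:
  fixes f :: "'a \<Rightarrow> 'n::finite \<Rightarrow> qp"
  assumes "\<And>i. (\<lambda>x. f x i) \<in> measurable M (qp_borel p)"
  shows "f \<in> measurable M (haar p)"
proof (rule measurable_sigma_sets[OF sets_haar qpn_balls_subset])
  show "f \<in> space M \<rightarrow> Qpn p"
    using measurable_qp_space[OF assms] by (auto simp: Qpn_def)
  fix B :: "('n \<Rightarrow> qp) set" assume "B \<in> qpn_balls"
  then obtain a k where a: "a \<in> Qpn p" and B: "B = qpn_ball p a k" by (auto simp: qpn_balls_def)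
  have "f -` B \<inter> space M = (\<Inter>i. (\<lambda>x. f x i) -` qp_ball p (a i) k \<inter> space M)"
    unfolding B using measurable_qp_space[OF assms]
    by (auto simp: qpn_ball_def qp_ball_def qpv_norm_le_iff Qpn_def)
  also have "\<dots> \<in> sets M"
    using measurable_sets[OF assms qp_ball_in_sets[OF Qpn_D[OF a]]]
    by (intro sets.finite_INT) auto
  finally show "f -` B \<inter> space M \<in> sets M" .
qed

lemma measurable_mat_vec:
  fixes A :: "'a \<Rightarrow> 'n::finite \<Rightarrow> 'n \<Rightarrow> qp"
  assumes "\<And>i j. (\<lambda>z. A z i j) \<in> measurable M (qp_borel p)" "g \<in> measurable M (haar p)"
  shows "(\<lambda>z. qp_mat_vec p (A z) (g z)) \<in> measurable M (haar p)"
proof (rule measurable_haarI)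
  show "(\<lambda>z. qp_mat_vec p (A z) (g z) i) \<in> measurable M (qp_borel p)" for i
    unfolding qp_mat_vec_def
    using measurable_compose[OF assms(2) measurable_coord] assms(1)
    by (intro measurable_qp_sum measurable_qp_mult) auto
qed

text \<open>Isosceles triangles again, now for classes. It makes superlevel sets of the absolute
  value open, whence the measurability of the norms.\<close>

lemma qp_abs_eq_of_close:
  assumes "x \<in> Qp p" "y \<in> Qp p" "sdist y x < qp_abs p x"
  shows "qp_abs p y = qp_abs p x"
proof (rule antisym)
  have "y = qp_add p (qp_add p y (qp_uminus p x)) x"
    using assms qp_diff_chain[of y x "qp_zero p"] by (simp add: qp_diff_zero)
  then show "qp_abs p y \<le> qp_abs p x"
    using qp_abs_add_le[of "qp_add p y (qp_uminus p x)" x "qp_abs p x"] assms by simp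
  have "x = qp_add p (qp_add p x (qp_uminus p y)) y"
    using assms qp_diff_chain[of x y "qp_zero p"] by (simp add: qp_diff_zero)
  then have "qp_abs p x \<le> max (sdist x y) (qp_abs p y)"
    using qp_abs_add[of "qp_add p x (qp_uminus p y)" y] assms by simp
  then show "qp_abs p x \<le> qp_abs p y"
    using assms sdist_commute[of x y] by linarith
qed

lemma qpn_norm_measurable: "qpv_norm p \<in> borel_measurable (haar p)"
  unfolding borel_measurable_iff_greater
proof
  fix r :: real
  show "{x \<in> space (haar p). r < qpv_norm p x} \<in> sets (haar p)"
  proof (rule haar_open_in_sets, goal_cases)
    case (2 x)
    then have x: "x \<in> Qpn p" "r < qpv_norm p x" by auto
    show ?case
    proof (cases "r < 0")
      case True
      then have "r < qpv_norm p y" if "y \<in> Qpn p" for y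
        using qpv_norm_nonneg[OF that] by linarith
      then have "qpn_ball p x 0 \<subseteq> {x \<in> space (haar p). r < qpv_norm p x}"
        by (auto simp: qpn_ball_def)
      then show ?thesis by blast
    next
      case False
      \<comment> \<open>Near x the coordinate attaining the maximum keeps its absolute value, and
        the other coordinates cannot lower the maximum.\<close>
      obtain i where i: "qpv_norm p x = qp_abs p (x i)" using qpv_norm_attained by blast
      obtain j where j: "real p powi (- int j) < qp_abs p (x i)"
        using powi_tendsto_0[of "qpv_norm p x"] x False i by auto
      have "r < qpv_norm p y" if y: "y \<in> qpn_ball p x (- int j)" for y
      proof -
        have yQ: "y \<in> Qpn p" using y by (simp add: qpn_ball_def)
        have "sdist (y i) (x i) \<le> real p powi (- int j)"
          using y by (simp add: qpn_ball_def qpv_norm_le_iff)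
        then have "qp_abs p (y i) = qp_abs p (x i)"
          using j x yQ by (intro qp_abs_eq_of_close) (auto simp: Qpn_D)
        then show ?thesis using qp_abs_le_qpv_norm[of y i] x(2) i by simp
      qed
      then show ?thesis by (intro exI[of _ "- int j"]) (auto simp: qpn_ball_def)
    qed
  qed auto
qed

lemma qp_abs_measurable: "qp_abs p \<in> borel_measurable (qp_borel p)"
  unfolding borel_measurable_iff_greater
proof
  fix r :: real
  have "{x \<in> space (qp_borel p). r < qp_abs p x} =
      (\<Union>(c, k)\<in>{(c, k). c \<in> ratpts \<and> qp_ball p c k \<subseteq> {x \<in> Qp p. r < qp_abs p x}}. qp_ball p c k)"
    (is "?U = (\<Union>(c, k)\<in>?I. _ c k)")
  proof
    show "?U \<subseteq> (\<Union>(c, k)\<in>?I. qp_ball p c k)"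
    proof
      fix x assume "x \<in> ?U"
      then have x: "x \<in> Qp p" "r < qp_abs p x" by auto
      obtain k where k: "qp_ball p x k \<subseteq> {x \<in> Qp p. r < qp_abs p x}"
      proof (cases "r < 0")
        case True
        then have "r < qp_abs p y" if "y \<in> Qp p" for y
          using qp_abs_nonneg[OF that] by linarith
        then have "qp_ball p x 0 \<subseteq> {x \<in> Qp p. r < qp_abs p x}"
          by (auto simp: qp_ball_def)
        with that show thesis by blast
      next
        case False
        obtain j where j: "real p powi (- int j) < qp_abs p x"
          using powi_tendsto_0[of "qp_abs p x"] x False by auto
        have "qp_ball p x (- int j) \<subseteq> {x \<in> Qp p. r < qp_abs p x}"
        proof
          fix y assume y: "y \<in> qp_ball p x (- int j)"
          then have "y \<in> Qp p" "sdist y x < qp_abs p x" using j by (auto simp: qp_ball_def)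
          with qp_abs_eq_of_close[OF x(1)] x(2) show "y \<in> {x \<in> Qp p. r < qp_abs p x}" by simp
        qed
        with that show thesis by blast
      qed
      obtain c where c: "c \<in> ratpts" "qp_ball p x k = qp_ball p c k" using qp_ball_ratpt x by blast
      have "(c, k) \<in> ?I" "x \<in> qp_ball p c k" using c k qp_ball_self[OF x(1), of k] by auto
      then show "x \<in> (\<Union>(c, k)\<in>?I. qp_ball p c k)" by blast
    qed
  qed auto
  moreover have "countable ?I"
    by (rule countable_subset[OF _ countable_SIGMA[OF countable_ratpts, of "\<lambda>_. UNIV"]]) auto
  then have "(\<Union>(c, k)\<in>?I. qp_ball p c k) \<in> sets (qp_borel p)"
    using ratpts_in by (intro sets.countable_UN'') (auto intro!: qp_ball_in_sets)
  ultimately show "?U \<in> sets (qp_borel p)" by simp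
qed

lemma qpm_norm_measurable:
  fixes A :: "'a \<Rightarrow> 'n::finite \<Rightarrow> 'n \<Rightarrow> qp"
  assumes "\<And>i j. (\<lambda>z. A z i j) \<in> measurable M (qp_borel p)"
  shows "(\<lambda>z. qpm_norm p (A z)) \<in> borel_measurable M"
proof -
  have "(\<lambda>z. Max ((\<lambda>ij. qp_abs p (A z (fst ij) (snd ij))) ` UNIV)) \<in> borel_measurable M"
    using measurable_compose[OF assms qp_abs_measurable] by (intro borel_measurable_Max) auto
  then show ?thesis by (simp only: qpm_norm_def case_prod_unfold)
qed

end

subsection \<open>Haar measure\<close>

text \<open>Assuming the ball masses isolates the existence question, which
  \<open>haar_cases\<close> settles by a dichotomy. Naming the measure \<open>\<mu>\<close> also
  fixes the dimension type once and for all.\<close>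

locale padic_haar = padic +
  fixes \<mu> :: "('n::finite \<Rightarrow> qp) measure"
  assumes haar_eq: "haar p = \<mu>"
    and emeasure_ball:
      "\<And>a k. a \<in> Qpn p \<Longrightarrow> emeasure \<mu> (qpn_ball p a k) = ennreal (real p powi (k * int CARD('n)))"
begin

lemma space_mu [simp]: "space \<mu> = Qpn p"
  using space_haar unfolding haar_eq[symmetric] .

lemma sets_mu: "sets \<mu> = sigma_sets (Qpn p) qpn_balls"
  using sets_haar unfolding haar_eq[symmetric] .

lemma ball_in_sets [measurable]: "a \<in> Qpn p \<Longrightarrow> qpn_ball p a k \<in> sets \<mu>"
  using qpn_ball_in_sets unfolding haar_eq[symmetric] .

lemma norm_measurable [measurable]: "qpv_norm p \<in> borel_measurable \<mu>"
  using qpn_norm_measurable unfolding haar_eq[symmetric] .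

lemma Qpn_eq_UN_balls: "(Qpn p :: ('n \<Rightarrow> qp) set) = (\<Union>i. qpn_ball p vzero (int i))"
proof
  show "(Qpn p :: ('n \<Rightarrow> qp) set) \<subseteq> (\<Union>i. qpn_ball p vzero (int i))"
  proof
    fix x :: "'n \<Rightarrow> qp" assume x: "x \<in> Qpn p"
    obtain i where "qpv_norm p x \<le> real p powi int i" using powi_unbounded by blast
    with x show "x \<in> (\<Union>i. qpn_ball p vzero (int i))" by (auto simp: qpn_ball_iff)
  qed
qed (auto simp: qpn_ball_def)

lemma qpn_ball_mono: "k \<le> l \<Longrightarrow> qpn_ball p a k \<subseteq> qpn_ball p a l"
  by (auto simp: qpn_ball_def intro: order_trans simp: powi_le_iff)

text \<open>Balls that meet are nested, because a common point is a centre of both. The empty set is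
  added for the disjoint ones.\<close>

lemma Int_stable_balls: "Int_stable (insert {} (qpn_balls :: ('n \<Rightarrow> qp) set set))"
proof -
  have *: "qpn_ball p a k \<inter> qpn_ball p b l \<in> insert {} qpn_balls"
    if ab: "a \<in> Qpn p" "b \<in> Qpn p" and kl: "k \<le> l" for a b :: "'n \<Rightarrow> qp" and k l
  proof (cases "qpn_ball p a k \<inter> qpn_ball p b l = {}")
    case False
    then obtain c where c: "c \<in> qpn_ball p a k" "c \<in> qpn_ball p b l" by blast
    then have "qpn_ball p a k = qpn_ball p c k" "qpn_ball p b l = qpn_ball p c l"
      using qpn_ball_center ab by blast+
    then have "qpn_ball p a k \<inter> qpn_ball p b l = qpn_ball p a k"
      using qpn_ball_mono[OF kl] by blast
    then show ?thesis using ab by (auto simp: qpn_balls_def)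
  qed simp
  show ?thesis
  proof (rule Int_stableI)
    fix B C :: "('n \<Rightarrow> qp) set" assume BC: "B \<in> insert {} qpn_balls" "C \<in> insert {} qpn_balls"
    show "B \<inter> C \<in> insert {} qpn_balls"
    proof (cases "B = {} \<or> C = {}")
      case False
      then obtain a k b l where "a \<in> Qpn p" "b \<in> Qpn p" "B = qpn_ball p a k" "C = qpn_ball p b l"
        using BC by (auto simp: qpn_balls_def)
      then show ?thesis using *[of a b k l] *[of b a l k] by (cases "k \<le> l") (simp_all add: Int_commute)
    qed auto
  qed
qed

lemma sets_mu': "sets \<mu> = sigma_sets (Qpn p) (insert {} qpn_balls)"
  unfolding sets_mu
proof
  show "sigma_sets (Qpn p) (insert {} qpn_balls) \<subseteq> sigma_sets (Qpn p) (qpn_balls :: ('n \<Rightarrow> qp) set set)"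
    by (rule sigma_sets_mono) (auto intro: sigma_sets.Empty)
qed (auto intro!: sigma_sets_mono')

text \<open>Uniqueness on an intersection-stable generator. Finiteness of \<open>c\<close> keeps the
  masses of the exhausting balls finite, so a scaling factor has to be bounded before it is
  identified.\<close>

lemma haar_unique:
  fixes M :: "('n \<Rightarrow> qp) measure"
  assumes "sets M = sets \<mu>" "c < \<infinity>"
    and "\<And>a k. a \<in> Qpn p \<Longrightarrow> emeasure M (qpn_ball p a k) = c * emeasure \<mu> (qpn_ball p a k)"
  shows "M = scale_measure c \<mu>"
proof (rule measure_eqI_generator_eq[OF Int_stable_balls, of "Qpn p"])
  show "insert {} qpn_balls \<subseteq> Pow (Qpn p)" using qpn_balls_subset by auto
  show "emeasure M X = emeasure (scale_measure c \<mu>) X" if "X \<in> insert {} qpn_balls" for X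
    using that assms(3) by (auto simp: qpn_balls_def)
  show "sets M = sigma_sets (Qpn p) (insert {} qpn_balls)"
    and "sets (scale_measure c \<mu>) = sigma_sets (Qpn p) (insert {} qpn_balls)"
    using assms(1) sets_mu' by auto
  show "range (\<lambda>i. qpn_ball p (vzero :: 'n \<Rightarrow> qp) (int i)) \<subseteq> insert {} qpn_balls"
    by (auto simp: qpn_balls_def)
  show "(\<Union>i. qpn_ball p (vzero :: 'n \<Rightarrow> qp) (int i)) = Qpn p"
    by (rule Qpn_eq_UN_balls[symmetric])
  show "emeasure M (qpn_ball p vzero (int i)) \<noteq> \<infinity>" for i
    using assms(2,3) by (simp add: emeasure_ball ennreal_mult_eq_top_iff less_top)
qed

lemma sigma_finite_mu: "sigma_finite_measure \<mu>"
proof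
  show "\<exists>A. countable A \<and> A \<subseteq> sets \<mu> \<and> \<Union>A = space \<mu> \<and> (\<forall>a\<in>A. emeasure \<mu> a \<noteq> \<infinity>)"
    by (intro exI[of _ "range (\<lambda>i. qpn_ball p vzero (int i))"])
      (auto simp: Qpn_eq_UN_balls[symmetric] emeasure_ball ball_in_sets)
qed

lemma vsub_measurable:
  assumes "c \<in> Qpn p" shows "(\<lambda>x. vsub x c) \<in> measurable \<mu> \<mu>"
  unfolding haar_eq[symmetric] vsub_def
  using assms by (intro measurable_haarI measurable_qp_add measurable_coord measurable_const) (simp add: Qpn_D)

lemma haar_translate:
  assumes c: "c \<in> Qpn p" shows "distr \<mu> \<mu> (\<lambda>x. vsub x c) = \<mu>"
proof -
  have "distr \<mu> \<mu> (\<lambda>x. vsub x c) = scale_measure 1 \<mu>"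
  proof (rule haar_unique)
    fix a :: "'n \<Rightarrow> qp" and k assume a: "a \<in> Qpn p"
    have "(\<lambda>x. vsub x c) -` qpn_ball p a k \<inter> Qpn p = qpn_ball p (vadd a c) k"
      using a c by (auto simp: qpn_ball_iff vsub_vsub)
    then show "emeasure (distr \<mu> \<mu> (\<lambda>x. vsub x c)) (qpn_ball p a k) = 1 * emeasure \<mu> (qpn_ball p a k)"
      using a c by (simp add: emeasure_distr vsub_measurable ball_in_sets emeasure_ball)
  qed auto
  then show ?thesis by simp
qed

text \<open>The index of \<open>B\<^sub>k\<close> in \<open>B\<^sub>l\<close> is read off from the masses of the balls, so no residue
  system has to be constructed.\<close>
lemma emeasure_ball_scaling:
  fixes M :: "('n \<Rightarrow> qp) measure"
  assumes M: "sets M = sets \<mu>" and v: "\<And>c. c \<in> Qpn p \<Longrightarrow> emeasure M (qpn_ball p c k) = v"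
    and a: "a \<in> Qpn p" and kl: "k \<le> l"
  shows "emeasure M (qpn_ball p a l) = v * ennreal (real p powi ((l - k) * int CARD('n)))"
proof -
  \<comment> \<open>The pieces form a set of balls and are not indexed by centres, because many
    centres give the same ball.\<close>
  define D where "D = (\<lambda>c. qpn_ball p c k) ` qpn_ball p a l"
  have ball_Q: "c \<in> Qpn p" if "c \<in> qpn_ball p a l" for c using that by (simp add: qpn_ball_def)
  have D_sub: "B \<subseteq> qpn_ball p a l" if B: "B \<in> D" for B
  proof -
    obtain c where c: "c \<in> qpn_ball p a l" "B = qpn_ball p c k" using B by (auto simp: D_def)
    then have "qpn_ball p c l = qpn_ball p a l" using qpn_ball_center[OF a] by blast
    with c qpn_ball_mono[OF kl] show ?thesis by blast
  qed
  have UN: "\<Union>(id ` D) = qpn_ball p a l"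
  proof
    show "qpn_ball p a l \<subseteq> \<Union>(id ` D)" using qpn_ball_self ball_Q by (auto simp: D_def)
  qed (use D_sub in auto)
  have "D \<subseteq> (\<lambda>c. qpn_ball p c k) ` ratvecs"
  proof
    fix B assume "B \<in> D"
    then obtain c where "c \<in> qpn_ball p a l" "B = qpn_ball p c k" by (auto simp: D_def)
    then show "B \<in> (\<lambda>c. qpn_ball p c k) ` ratvecs"
      using qpn_ball_ratvec[OF ball_Q, of c k] by auto
  qed
  then have count: "countable D"
    by (rule countable_subset[OF _ countable_image[OF countable_ratvecs]])
  have disj: "disjoint_family_on id D"
    unfolding disjoint_family_on_def
  proof (intro ballI impI)
    fix B C assume BC: "B \<in> D" "C \<in> D" "B \<noteq> C"
    obtain b c where bc: "b \<in> Qpn p" "c \<in> Qpn p" "B = qpn_ball p b k" "C = qpn_ball p c k"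
      using BC ball_Q by (auto simp: D_def)
    show "id B \<inter> id C = {}"
    proof (rule ccontr)
      assume "id B \<inter> id C \<noteq> {}"
      then obtain z where "z \<in> qpn_ball p b k" "z \<in> qpn_ball p c k" using bc by auto
      then have "B = C"
        using bc(3,4) qpn_ball_center[OF bc(1)] qpn_ball_center[OF bc(2)] by blast
      with BC show False by blast
    qed
  qed
  \<comment> \<open>Stated for arbitrary N: for \<open>\<mu>\<close> it yields the number of pieces,
    for M it then yields the mass.\<close>
  have sum: "emeasure N (qpn_ball p a l) = w * emeasure (count_space D) D"
    if N: "sets N = sets \<mu>" and w: "\<And>c. c \<in> Qpn p \<Longrightarrow> emeasure N (qpn_ball p c k) = w"
    for N :: "('n \<Rightarrow> qp) measure" and w
  proof -
    have "emeasure N (\<Union>(id ` D)) = (\<integral>\<^sup>+B. emeasure N (id B) \<partial>count_space D)"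
      using N ball_Q by (intro emeasure_UN_countable count disj) (auto simp: D_def ball_in_sets)
    also have "\<dots> = (\<integral>\<^sup>+B. w \<partial>count_space D)"
      using w ball_Q by (intro nn_integral_cong) (auto simp: D_def)
    finally show ?thesis unfolding UN by simp
  qed
  let ?N = "emeasure (count_space D) D"
  have pos: "real p powi (k * int CARD('n)) > 0" by (rule powi_pos)
  \<comment> \<open>For \<open>\<mu>\<close> both masses are known. The small ball has positive
    finite mass, so cancelling it gives the number of pieces, and in particular its
    finiteness.\<close>
  have "ennreal (real p powi (k * int CARD('n))) * ?N = ennreal (real p powi (l * int CARD('n)))"
    using sum[OF refl emeasure_ball] emeasure_ball[OF a] by simp
  also have "l * int CARD('n) = k * int CARD('n) + (l - k) * int CARD('n)"
    by (simp add: algebra_simps)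
  also have "ennreal (real p powi \<dots>)
      = ennreal (real p powi (k * int CARD('n))) * ennreal (real p powi ((l - k) * int CARD('n)))"
    using p_pos by (subst power_int_add) (simp_all add: ennreal_mult)
  finally have "?N = ennreal (real p powi ((l - k) * int CARD('n)))"
    unfolding ennreal_mult_cancel_left using pos p_pos by auto
  then show ?thesis using sum[OF M v] by simp
qed

lemma mat_vec_measurable:
  assumes "qp_matrix p A" shows "qp_mat_vec p A \<in> measurable \<mu> \<mu>"
  unfolding haar_eq[symmetric]
  using assms
  by (intro measurable_mat_vec measurable_const measurable_ident_sets refl) (auto simp: qp_matrix_def)

text \<open>Preimages of balls of equal radius are translates of each other, so the push-forward
  gives them equal mass, and \<open>emeasure_ball_scaling\<close> fixes the growth with the radius:
  this determines the push-forward up to a factor. The factor is the mass of the preimage of the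
  unit ball, which lies in the ball of radius \<open>qpm_norm p (qp_mat_inv p A)\<close>.\<close>

lemma nn_integral_mat_vec_le:
  assumes A: "qp_invertible p A" and g: "g \<in> borel_measurable \<mu>"
  shows "(\<integral>\<^sup>+x. g (qp_mat_vec p A x) \<partial>\<mu>) \<le> ennreal (qpm_norm p (qp_mat_inv p A) ^ CARD('n)) * (\<integral>\<^sup>+x. g x \<partial>\<mu>)"
proof -
  let ?T = "qp_mat_vec p A" and ?J = "qp_mat_inv p A"
  let ?n = "int CARD('n)"
  have M: "qp_matrix p A" "qp_matrix p ?J" using qp_mat_inv[OF A] by auto
  have T[measurable]: "?T \<in> measurable \<mu> \<mu>" using M by (simp add: mat_vec_measurable)
  define \<nu> where "\<nu> = distr \<mu> \<mu> ?T"
  have sets_nu: "sets \<nu> = sets \<mu>" by (simp add: \<nu>_def)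
  define v where "v k = emeasure \<nu> (qpn_ball p vzero k)" for k
  have nu_ball: "emeasure \<nu> (qpn_ball p a k) = v k" if a: "a \<in> Qpn p" for a k
  proof -
    define b where "b = qp_mat_vec p ?J a"
    have b: "b \<in> Qpn p" "?T b = a" using a M qp_mat_inv[OF A] by (auto simp: b_def)
    have eq: "?T -` qpn_ball p a k \<inter> Qpn p = (\<lambda>x. vsub x b) -` (?T -` qpn_ball p vzero k \<inter> Qpn p) \<inter> Qpn p"
      using b a M by (auto simp: qpn_ball_iff mat_vec_vsub)
    have "?T -` qpn_ball p vzero k \<inter> Qpn p \<in> sets \<mu>"
      using measurable_sets[OF T ball_in_sets[OF vzero_in]] by simp
    then have "emeasure \<mu> (?T -` qpn_ball p vzero k \<inter> Qpn p)
        = emeasure \<mu> ((\<lambda>x. vsub x b) -` (?T -` qpn_ball p vzero k \<inter> Qpn p) \<inter> Qpn p)"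
      using emeasure_distr[OF vsub_measurable[OF b(1)], of "?T -` qpn_ball p vzero k \<inter> Qpn p"]
      by (simp add: haar_translate[OF b(1)])
    then show ?thesis
      using a by (simp add: \<nu>_def v_def emeasure_distr T ball_in_sets eq)
  qed
  have scaling: "v l = v k * ennreal (real p powi ((l - k) * ?n))" if "k \<le> l" for k l
    using emeasure_ball_scaling[OF sets_nu nu_ball vzero_in that] by (simp add: v_def)
  have v_eq: "v k = v 0 * ennreal (real p powi (k * ?n))" for k
  proof (cases "k \<ge> 0")
    case True
    then show ?thesis using scaling[of 0 k] by simp
  next
    case False
    \<comment> \<open>For negative k the unit ball is the larger one: scale from k up to 0 and
      cancel the two reciprocal powers.\<close>
    have "v 0 * ennreal (real p powi (k * ?n))
       = v k * (ennreal (real p powi ((0 - k) * ?n)) * ennreal (real p powi (k * ?n)))"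
      using scaling[of k 0] False by (simp add: mult.assoc)
    also have "ennreal (real p powi ((0 - k) * ?n)) * ennreal (real p powi (k * ?n))
       = ennreal (real p powi ((0 - k) * ?n + k * ?n))"
      using p_pos by (subst power_int_add) (simp_all add: ennreal_mult)
    finally show ?thesis by simp
  qed
  \<comment> \<open>A nonzero norm is an exact power of p, hence the radius of a ball in the sense
    of \<open>qpn_ball\<close>.\<close>
  have J_pos: "qpm_norm p ?J \<noteq> 0" using qpm_norm_inv_ge_1[OF A] by auto
  then obtain j where j: "qpm_norm p ?J = real p powi j" using qpm_norm_range[OF M(2)] by blast
  have "v 0 = emeasure \<mu> (?T -` qpn_ball p vzero 0 \<inter> Qpn p)"
    by (simp add: v_def \<nu>_def emeasure_distr T ball_in_sets)
  also have "\<dots> \<le> emeasure \<mu> (qpn_ball p vzero j)"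
  proof (rule emeasure_mono)
    show "?T -` qpn_ball p vzero 0 \<inter> Qpn p \<subseteq> qpn_ball p vzero j"
    proof
      fix x assume "x \<in> ?T -` qpn_ball p vzero 0 \<inter> Qpn p"
      then have x: "x \<in> Qpn p" "qpv_norm p (?T x) \<le> 1" using M by (auto simp: qpn_ball_iff)
      have "qpv_norm p x \<le> qpm_norm p ?J * qpv_norm p (?T x)" by (rule mat_vec_norm_ge[OF A x(1)])
      also have "\<dots> \<le> qpm_norm p ?J * 1" using x M by (intro mult_left_mono) auto
      finally show "x \<in> qpn_ball p vzero j" using x j by (simp add: qpn_ball_iff)
    qed
  qed (simp add: ball_in_sets)
  also have "\<dots> = ennreal (qpm_norm p ?J ^ CARD('n))"
    by (simp add: emeasure_ball j power_int_mult)
  finally have v0: "v 0 \<le> ennreal (qpm_norm p ?J ^ CARD('n))" .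
  then have "v 0 < \<infinity>" using le_less_trans by fastforce
  then have nu_eq: "\<nu> = scale_measure (v 0) \<mu>"
  proof (intro haar_unique sets_nu)
    show "emeasure \<nu> (qpn_ball p a k) = v 0 * emeasure \<mu> (qpn_ball p a k)" if "a \<in> Qpn p" for a k
      unfolding nu_ball[OF that] emeasure_ball[OF that] by (rule v_eq)
  qed
  have "(\<integral>\<^sup>+x. g (?T x) \<partial>\<mu>) = (\<integral>\<^sup>+x. g x \<partial>\<nu>)"
    unfolding \<nu>_def using g by (subst nn_integral_distr) auto
  also have "\<dots> = v 0 * (\<integral>\<^sup>+x. g x \<partial>\<mu>)"
    unfolding nu_eq using g by (rule nn_integral_scale_measure)
  also have "\<dots> \<le> ennreal (qpm_norm p ?J ^ CARD('n)) * (\<integral>\<^sup>+x. g x \<partial>\<mu>)"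
    using v0 by (rule mult_right_mono) simp
  finally show ?thesis .
qed

section \<open>The null origin and spherical shells\<close>

lemma emeasure_vzero: "emeasure \<mu> {vzero} = 0"
proof (rule ccontr)
  assume nz: "emeasure \<mu> {vzero} \<noteq> 0"
  have le: "emeasure \<mu> {vzero} \<le> ennreal (real p powi (- int k))" for k
  proof -
    have "emeasure \<mu> {vzero} \<le> emeasure \<mu> (qpn_ball p vzero (- int k))"
      by (intro emeasure_mono ball_in_sets) (auto simp: qpn_ball_self)
    also have "\<dots> = ennreal (real p powi (- int k * int CARD('n)))" by (simp add: emeasure_ball)
    also have "\<dots> \<le> ennreal (real p powi (- int k))"
      unfolding ennreal_le_iff[OF less_imp_le[OF powi_pos]] powi_le_iff
      using mult_left_mono[of 1 "int CARD('n)" "int k"] by (simp add: Suc_leI)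
    finally show ?thesis .
  qed
  then obtain e where e: "emeasure \<mu> {vzero} = ennreal e" "0 \<le> e"
    by (metis ennreal_cases ennreal_neq_top top.extremum_unique)
  then have "e > 0" using nz by (cases "e = 0") auto
  then obtain k where "real p powi (- int k) < e" using powi_tendsto_0 by blast
  then show False using le[of k] e by (simp add: ennreal_le_iff)
qed

text \<open>At the origin division by 0 and \<open>0 powr a\<close> both return 0; discarding this
  null set allows norms to be treated as positive.\<close>

lemma AE_norm_pos: "AE x in \<mu>. 0 < qpv_norm p x"
proof -
  have "{x \<in> space \<mu>. \<not> 0 < qpv_norm p x} \<subseteq> {vzero}"
    using qpv_norm_eq_0 qpv_norm_nonneg by (force intro: antisym)
  moreover have "{vzero} \<in> sets \<mu>"
  proof -
    have "{vzero} = {x \<in> space \<mu>. qpv_norm p x = 0}"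
      using qpv_norm_eq_0 by auto
    also have "\<dots> \<in> sets \<mu>" by measurable
    finally show ?thesis .
  qed
  ultimately show ?thesis
    by (intro AE_I'[of "{vzero}"]) (auto simp: emeasure_vzero)
qed

text \<open>These are N consecutive spheres, of radii p^a up to p^(a+N-1); the half-open upper end
  lets shells fit together without overlap.\<close>

definition shell :: "int \<Rightarrow> nat \<Rightarrow> ('n \<Rightarrow> qp) set" where
  "shell a N = {x \<in> Qpn p. real p powi a \<le> qpv_norm p x \<and> qpv_norm p x < real p powi (a + int N)}"

text \<open>The mass of the unit sphere, that is, of B_0 without B_(-1).\<close>

definition sphere_mass :: real where
  "sphere_mass = 1 - 1 / real p ^ CARD('n)"

lemma sphere_mass_pos: "sphere_mass > 0"
proof -
  have "real p ^ CARD('n) > 1" using p_gt_1 by (intro one_less_power) auto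
  then show ?thesis by (simp add: sphere_mass_def divide_simps)
qed

lemma shell_in_sets [measurable]: "shell a N \<in> sets \<mu>"
proof -
  have "shell a N = {x \<in> space \<mu>. real p powi a \<le> qpv_norm p x \<and> qpv_norm p x < real p powi (a + int N)}"
    by (simp add: shell_def)
  also have "\<dots> \<in> sets \<mu>" by measurable
  finally show ?thesis .
qed

lemma norm_sphere:
  assumes "x \<in> Qpn p" "real p powi k \<le> qpv_norm p x" "qpv_norm p x < real p powi (k + 1)"
  shows "qpv_norm p x = real p powi k"
proof -
  obtain z where z: "qpv_norm p x = real p powi z"
    using qpv_norm_range[OF assms(1)] assms(2) powi_pos[of k] by auto
  with assms show ?thesis by (simp add: powi_le_iff powi_less_iff powi_eq_iff)
qed

text \<open>The sphere of radius p^k has p^(k n) times the mass of the unit sphere, and |x|^(-n) is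
  constantly p^(-k n) on it; the factors cancel and k disappears.\<close>

lemma nn_integral_sphere:
  "(\<integral>\<^sup>+x. ennreal (indicator (shell k 1) x * qpv_norm p x powr (- real CARD('n))) \<partial>\<mu>) = ennreal sphere_mass"
proof -
  let ?n = "CARD('n)"
  have sub: "qpn_ball p vzero (k - 1) \<subseteq> qpn_ball p vzero k" by (rule qpn_ball_mono) simp
  have eq: "shell k 1 = qpn_ball p vzero k - qpn_ball p vzero (k - 1)"
  proof -
    \<comment> \<open>Norms are 0 or integer powers of p, so lying below p^(k+1) is the same as
      being at most p^k.\<close>
    have *: "real p powi k \<le> qpv_norm p x \<and> qpv_norm p x < real p powi (k + 1)
        \<longleftrightarrow> qpv_norm p x \<le> real p powi k \<and> \<not> qpv_norm p x \<le> real p powi (k - 1)"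
      if "x \<in> Qpn p" for x :: "'n \<Rightarrow> qp"
      using qpv_norm_range[OF that] powi_pos[of k] powi_pos[of "k - 1"]
      by (auto simp: powi_le_iff powi_less_iff)
    have "x \<in> shell k 1 \<longleftrightarrow> x \<in> qpn_ball p vzero k - qpn_ball p vzero (k - 1)" for x
    proof (cases "x \<in> Qpn p")
      case True
      show ?thesis
        using True *[OF True]
        unfolding shell_def Diff_iff qpn_ball_iff mem_Collect_eq vsub_zero[OF True] of_nat_1 by blast
    qed (simp add: shell_def qpn_ball_iff)
    then show ?thesis by blast
  qed
  have "emeasure \<mu> (shell k 1) = ennreal (real p powi (k * int ?n)) - ennreal (real p powi ((k - 1) * int ?n))"
    unfolding eq using sub by (subst emeasure_Diff) (auto simp: emeasure_ball ball_in_sets)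
  also have "\<dots> = ennreal (real p powi (k * int ?n) - real p powi ((k - 1) * int ?n))"
    using powi_pos by (intro ennreal_minus) (simp add: less_imp_le)
  also have "real p powi (k * int ?n) - real p powi ((k - 1) * int ?n) = real p powi (k * int ?n) * sphere_mass"
    using p_pos by (simp add: sphere_mass_def algebra_simps power_int_diff)
  finally have m: "emeasure \<mu> (shell k 1) = ennreal (real p powi (k * int ?n) * sphere_mass)" .
  have val: "indicator (shell k 1) x * qpv_norm p x powr (- real ?n)
      = real p powi (- (k * int ?n)) * indicator (shell k 1) x" for x
  proof (cases "x \<in> shell k 1")
    case True
    then have "qpv_norm p x = real p powi k" using norm_sphere[of x k] by (simp add: shell_def)
    moreover have "(real p powi k) powr (- real ?n) = real p powi (- (k * int ?n))"
    proof -
      have "(real p powi k) powr (- real ?n) = (real p powr real_of_int k) powr (- real ?n)"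
        using p_pos by (simp add: powr_real_of_int')
      also have "\<dots> = real p powr real_of_int (- (k * int ?n))"
        by (simp add: powr_powr)
      also have "\<dots> = real p powi (- (k * int ?n))"
        using p_pos by (intro powr_real_of_int') auto
      finally show ?thesis .
    qed
    ultimately show ?thesis using True by simp
  qed simp
  have "(\<integral>\<^sup>+x. ennreal (indicator (shell k 1) x * qpv_norm p x powr (- real ?n)) \<partial>\<mu>)
      = (\<integral>\<^sup>+x. ennreal (real p powi (- (k * int ?n))) * indicator (shell k 1) x \<partial>\<mu>)"
    unfolding val
    by (intro nn_integral_cong) (simp add: ennreal_mult less_imp_le[OF powi_pos] ennreal_indicator)
  also have "\<dots> = ennreal (real p powi (- (k * int ?n)) * (real p powi (k * int ?n) * sphere_mass))"
    unfolding nn_integral_cmult_indicator[OF shell_in_sets] m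
    by (rule ennreal_mult[symmetric]) (simp_all add: less_imp_le[OF powi_pos] less_imp_le[OF sphere_mass_pos])
  also have "real p powi (- (k * int ?n)) * (real p powi (k * int ?n) * sphere_mass) = sphere_mass"
    using p_pos by (simp add: power_int_minus)
  finally show ?thesis .
qed

text \<open>Linear growth in the number of spheres is the logarithmic divergence of |x|^(-n):
  doubling the number of spheres only doubles the integral, and this is all that the lower bound
  pays.\<close>

lemma nn_integral_shell:
  "(\<integral>\<^sup>+x. ennreal (indicator (shell a N) x * qpv_norm p x powr (- real CARD('n))) \<partial>\<mu>)
    = ennreal (real N * sphere_mass)"
proof (induction N)
  case 0
  have "shell a 0 = {}" by (auto simp: shell_def)
  then show ?case by simp
next
  case (Suc N)
  have split: "shell a (Suc N) = shell a N \<union> shell (a + int N) 1" "shell a N \<inter> shell (a + int N) 1 = {}"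
    using powi_le_iff[of a "a + int N"] powi_less_iff[of "a + int N" "a + int (Suc N)"]
    by (auto simp: shell_def algebra_simps)
  have "ennreal (indicator (shell a (Suc N)) x * r)
     = ennreal (indicator (shell a N) x * r) + ennreal (indicator (shell (a + int N) 1) x * r)" for x r
    unfolding split(1) using split(2) by (auto simp: indicator_def)
  then have "(\<integral>\<^sup>+x. ennreal (indicator (shell a (Suc N)) x * qpv_norm p x powr (- real CARD('n))) \<partial>\<mu>)
    = (\<integral>\<^sup>+x. ennreal (indicator (shell a N) x * qpv_norm p x powr (- real CARD('n)))
        + ennreal (indicator (shell (a + int N) 1) x * qpv_norm p x powr (- real CARD('n))) \<partial>\<mu>)"
    by (simp only:)
  also have "\<dots> = (\<integral>\<^sup>+x. ennreal (indicator (shell a N) x * qpv_norm p x powr (- real CARD('n))) \<partial>\<mu>)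
        + (\<integral>\<^sup>+x. ennreal (indicator (shell (a + int N) 1) x * qpv_norm p x powr (- real CARD('n))) \<partial>\<mu>)"
    by (rule nn_integral_add) measurable
  also have "\<dots> = ennreal (real N * sphere_mass) + ennreal sphere_mass"
    unfolding Suc.IH nn_integral_sphere ..
  also have "\<dots> = ennreal (real (Suc N) * sphere_mass)"
    using sphere_mass_pos by (subst ennreal_plus[symmetric]) (auto simp: algebra_simps)
  finally show ?case .
qed

end

subsection \<open>Hoelder's inequality\<close>

text \<open>Convexity of the exponential at the points \<open>ln (a i)\<close>. A vanishing
  \<open>a i\<close> is handled apart: it makes the product 0 even if \<open>w i = 0\<close>, since
  \<open>0 powr 0 = 0\<close>.\<close>

lemma weighted_arith_geom_mean:
  fixes a w :: "'i \<Rightarrow> real"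
  assumes I: "finite I" "(\<Sum>i\<in>I. w i) = 1" "\<And>i. i \<in> I \<Longrightarrow> 0 \<le> w i" "\<And>i. i \<in> I \<Longrightarrow> 0 \<le> a i"
  shows "(\<Prod>i\<in>I. a i powr w i) \<le> (\<Sum>i\<in>I. w i * a i)"
proof (cases "\<exists>i\<in>I. a i = 0")
  case True
  then have "(\<Prod>i\<in>I. a i powr w i) = 0" using I(1) by (auto intro!: prod_zero)
  moreover have "0 \<le> (\<Sum>i\<in>I. w i * a i)" using I by (intro sum_nonneg) auto
  ultimately show ?thesis by linarith
next
  case False
  then have pos: "a i > 0" if "i \<in> I" for i using I(4)[OF that] that by fastforce
  have "I \<noteq> {}" using I(2) by auto
  have "(\<Prod>i\<in>I. a i powr w i) = (\<Prod>i\<in>I. exp (w i * ln (a i)))"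
    using pos by (intro prod.cong) (force simp: powr_def)+
  also have "\<dots> = exp (\<Sum>i\<in>I. w i *\<^sub>R ln (a i))"
    using I(1) by (simp add: exp_sum)
  also have "\<dots> \<le> (\<Sum>i\<in>I. w i * exp (ln (a i)))"
    by (rule convex_on_sum[OF I(1) \<open>I \<noteq> {}\<close> exp_convex I(2)]) (use I(3) in auto)
  also have "\<dots> = (\<Sum>i\<in>I. w i * a i)"
    using pos by (intro sum.cong) auto
  finally show ?thesis .
qed

lemma nn_integral_eq_0_AE_real:
  assumes "f \<in> borel_measurable M" "(\<integral>\<^sup>+x. ennreal (f x) \<partial>M) \<le> ennreal 0"
    and nonneg: "\<And>x. x \<in> space M \<Longrightarrow> 0 \<le> f x"
  shows "AE x in M. f x = 0"
proof -
  have "(\<integral>\<^sup>+x. ennreal (f x) \<partial>M) = 0" using assms(2) by simp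
  then have "AE x in M. ennreal (f x) = 0"
    using assms(1) by (subst (asm) nn_integral_0_iff_AE) auto
  then show ?thesis
    using AE_space by eventually_elim (use nonneg in \<open>auto simp: ennreal_eq_0_iff intro: antisym\<close>)
qed

text \<open>Normalise every \<open>F i\<close> by its bound \<open>T i\<close>, apply the
  arithmetic-geometric mean inequality pointwise and integrate; the weights sum to 1. Real bounds in
  place of the integrals allow real powers on the right.\<close>

lemma nn_integral_Hoelder:
  fixes F :: "'i \<Rightarrow> 'a \<Rightarrow> real" and w T :: "'i \<Rightarrow> real"
  assumes I: "finite I" "(\<Sum>i\<in>I. w i) = 1" "\<And>i. i \<in> I \<Longrightarrow> 0 \<le> w i"
    and F: "\<And>i. i \<in> I \<Longrightarrow> F i \<in> borel_measurable M" "\<And>i x. i \<in> I \<Longrightarrow> x \<in> space M \<Longrightarrow> 0 \<le> F i x"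
    and T: "\<And>i. i \<in> I \<Longrightarrow> 0 \<le> T i" "\<And>i. i \<in> I \<Longrightarrow> (\<integral>\<^sup>+x. ennreal (F i x) \<partial>M) \<le> ennreal (T i)"
  shows "(\<integral>\<^sup>+x. ennreal (\<Prod>i\<in>I. F i x powr w i) \<partial>M) \<le> ennreal (\<Prod>i\<in>I. T i powr w i)"
proof (cases "\<exists>i\<in>I. T i = 0")
  case True
  \<comment> \<open>A zero bound cannot be normalised; but then \<open>F i\<close> vanishes almost
    everywhere, and with it the product.\<close>
  then obtain i where i: "i \<in> I" "T i = 0" by blast
  have "AE x in M. F i x = 0"
    using T(2)[OF i(1)] i(2) F[OF i(1)] by (intro nn_integral_eq_0_AE_real) simp_all
  then have "AE x in M. ennreal (\<Prod>i\<in>I. F i x powr w i) = 0"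
  proof eventually_elim
    case (elim x)
    have "(\<Prod>i\<in>I. F i x powr w i) = 0"
      using I(1) i(1) elim by (intro prod_zero bexI[of _ i]) auto
    then show ?case by simp
  qed
  then have "(\<integral>\<^sup>+x. ennreal (\<Prod>i\<in>I. F i x powr w i) \<partial>M) = (\<integral>\<^sup>+x. 0 \<partial>M)"
    by (rule nn_integral_cong_AE)
  then show ?thesis by simp
next
  case False
  then have pos: "T i > 0" if "i \<in> I" for i using T(1)[OF that] that by fastforce
  define P where "P = (\<Prod>i\<in>I. T i powr w i)"
  have P: "P \<ge> 0" by (auto simp: P_def intro!: prod_nonneg)
  have "(\<Prod>i\<in>I. F i x powr w i) \<le> P * (\<Sum>i\<in>I. w i * (F i x / T i))" if "x \<in> space M" for x
  proof -
    have "(\<Prod>i\<in>I. F i x powr w i) = (\<Prod>i\<in>I. T i powr w i * (F i x / T i) powr w i)"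
      using pos F(2)[OF _ that] by (intro prod.cong refl) (force simp: powr_divide less_imp_le)
    also have "\<dots> = P * (\<Prod>i\<in>I. (F i x / T i) powr w i)"
      by (simp add: P_def prod.distrib)
    also have "\<dots> \<le> P * (\<Sum>i\<in>I. w i * (F i x / T i))"
      using P I F(2)[OF _ that] T(1) by (intro mult_left_mono weighted_arith_geom_mean) auto
    finally show ?thesis .
  qed
  then have "(\<integral>\<^sup>+x. ennreal (\<Prod>i\<in>I. F i x powr w i) \<partial>M)
      \<le> (\<integral>\<^sup>+x. ennreal (P * (\<Sum>i\<in>I. w i * (F i x / T i))) \<partial>M)"
    by (intro nn_integral_mono ennreal_leI)
  also have "\<dots> = (\<integral>\<^sup>+x. ennreal P * (\<Sum>i\<in>I. ennreal (w i / T i) * ennreal (F i x)) \<partial>M)"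
  proof (rule nn_integral_cong)
    fix x assume x: "x \<in> space M"
    note F = F(1) F(2)[OF _ x]
    have "ennreal (P * (\<Sum>i\<in>I. w i * (F i x / T i))) = ennreal P * ennreal (\<Sum>i\<in>I. w i * (F i x / T i))"
      using P I F(2) T(1) by (intro ennreal_mult sum_nonneg) auto
    also have "ennreal (\<Sum>i\<in>I. w i * (F i x / T i)) = (\<Sum>i\<in>I. ennreal (w i * (F i x / T i)))"
      using I F(2) T(1) by (intro sum_ennreal[symmetric]) auto
    also have "\<dots> = (\<Sum>i\<in>I. ennreal (w i / T i) * ennreal (F i x))"
      using I F(2) T(1) by (intro sum.cong refl) (simp add: ennreal_mult[symmetric])
    finally show "ennreal (P * (\<Sum>i\<in>I. w i * (F i x / T i)))
      = ennreal P * (\<Sum>i\<in>I. ennreal (w i / T i) * ennreal (F i x))" .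
  qed
  also have "\<dots> = ennreal P * (\<Sum>i\<in>I. ennreal (w i / T i) * (\<integral>\<^sup>+x. ennreal (F i x) \<partial>M))"
    using F(1) by (simp add: nn_integral_cmult nn_integral_sum borel_measurable_sum)
  also have "\<dots> \<le> ennreal P * (\<Sum>i\<in>I. ennreal (w i / T i) * ennreal (T i))"
    using T(2) by (intro mult_left_mono sum_mono) auto
  also have "(\<Sum>i\<in>I. ennreal (w i / T i) * ennreal (T i)) = (\<Sum>i\<in>I. ennreal (w i))"
  proof (intro sum.cong refl)
    fix i assume "i \<in> I"
    then have "T i > 0" "0 \<le> w i" using pos I(3) by auto
    then show "ennreal (w i / T i) * ennreal (T i) = ennreal (w i)"
      by (subst ennreal_mult[symmetric]) auto
  qed
  also have "\<dots> = 1"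
    using I by (simp add: sum_ennreal)
  finally show ?thesis by (simp add: P_def)
qed

text \<open>Hoelder for the splitting h G = h^(1 - 1/q) (h G^q)^(1/q), with the two functions
  indexed by \<open>bool\<close>.\<close>

lemma nn_integral_Jensen:
  fixes h G :: "'a \<Rightarrow> real"
  assumes "q \<ge> 1" "h \<in> borel_measurable M" "G \<in> borel_measurable M" "\<And>x. x \<in> space M \<Longrightarrow> 0 \<le> h x" "\<And>x. x \<in> space M \<Longrightarrow> 0 \<le> G x"
    and K: "0 \<le> K" "(\<integral>\<^sup>+x. ennreal (h x) \<partial>M) \<le> ennreal K"
    and Y: "0 \<le> Y" "(\<integral>\<^sup>+x. ennreal (h x * G x powr q) \<partial>M) \<le> ennreal Y"
  shows "(\<integral>\<^sup>+x. ennreal (h x * G x) \<partial>M) \<le> ennreal (K powr (1 - 1 / q) * Y powr (1 / q))"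
proof -
  define F where "F b x = (if b then h x else h x * G x powr q)" for b x
  define w where "w b = (if b then 1 - 1 / q else 1 / q)" for b
  define T where "T b = (if b then K else Y)" for b
  have "(\<integral>\<^sup>+x. ennreal (\<Prod>b\<in>UNIV. F b x powr w b) \<partial>M) \<le> ennreal (\<Prod>b\<in>UNIV. T b powr w b)"
    by (rule nn_integral_Hoelder) (use assms in \<open>auto simp: F_def w_def T_def UNIV_bool split: if_splits\<close>)
  moreover have "(\<Prod>b\<in>UNIV. F b x powr w b) = h x * G x" if "x \<in> space M" for x
  proof (cases "h x = 0")
    case False
    then have "h x powr (1 - 1 / q) * h x powr (1 / q) = h x"
      using assms(4)[OF that] by (simp add: powr_add[symmetric])
    then show ?thesis
      using assms(1) assms(4,5)[OF that] by (simp add: F_def w_def UNIV_bool powr_mult powr_powr mult.assoc mult.left_commute mult.commute)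
  qed (simp add: F_def UNIV_bool)
  moreover have "(\<Prod>b\<in>UNIV. T b powr w b) = K powr (1 - 1 / q) * Y powr (1 / q)"
    by (simp add: T_def w_def UNIV_bool mult.commute)
  ultimately show ?thesis by (simp cong: nn_integral_cong)
qed

subsection \<open>The Hausdorff operator\<close>

locale hausdorff_setting = padic_haar p \<mu>
  for p :: nat and \<mu> :: "('n::finite \<Rightarrow> qp) measure" +
  fixes m :: nat and q \<alpha> :: real and qs \<alpha>s :: "nat \<Rightarrow> real"
    and A :: "nat \<Rightarrow> ('n \<Rightarrow> qp) \<Rightarrow> ('n \<Rightarrow> 'n \<Rightarrow> qp)" and \<nu> :: nat
  assumes m: "m \<ge> 1" and q: "q \<ge> 1" and qs: "\<And>i. i < m \<Longrightarrow> qs i \<ge> 1"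
    and \<alpha>s: "\<And>i. i < m \<Longrightarrow> \<alpha>s i > - real CARD('n)"
    and sum_qs: "(\<Sum>i<m. 1 / qs i) = 1 / q"
    and sum_\<alpha>s: "(\<Sum>i<m. \<alpha>s i / qs i) = \<alpha> / q"
    and A_meas: "\<And>i j k. i < m \<Longrightarrow> (\<lambda>y. A i y j k) \<in> measurable \<mu> (qp_borel p)"
    and A_inv: "\<And>i. i < m \<Longrightarrow> AE y in \<mu>. qp_invertible p (A i y)"
    and A_cond: "\<And>i. i < m \<Longrightarrow> AE y in \<mu>.
      qpm_norm p (A i y) * qpm_norm p (qp_mat_inv p (A i y)) \<le> real p ^ \<nu>"
begin

definition \<kappa> :: real where "\<kappa> = real p ^ \<nu>"

text \<open>The critical exponent: the power \<open>qs i\<close> of \<open>|x| powr (- s i)\<close>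
  times the weight \<open>|x| powr \<alpha>s i\<close> is |x|^(-n).\<close>

definition s :: "nat \<Rightarrow> real" where "s i = (\<alpha>s i + real CARD('n)) / qs i"

definition nA :: "nat \<Rightarrow> ('n \<Rightarrow> qp) \<Rightarrow> real" where "nA i y = qpm_norm p (A i y)"

text \<open>One set of full measure on which all almost-everywhere hypotheses hold, for every i at
  once.\<close>

definition well_cond :: "('n \<Rightarrow> qp) \<Rightarrow> bool" where
  "well_cond y \<longleftrightarrow> y \<in> Qpn p \<and> 0 < qpv_norm p y \<and> (\<forall>i<m. qp_invertible p (A i y) \<and>
      qpm_norm p (A i y) * qpm_norm p (qp_mat_inv p (A i y)) \<le> \<kappa>)"

lemma \<kappa>_ge_1: "\<kappa> \<ge> 1"
  using p_gt_1 by (simp add: \<kappa>_def)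

lemma s_pos: "i < m \<Longrightarrow> s i > 0"
  using qs[of i] \<alpha>s[of i] by (simp add: s_def)

lemma s_mult_qs: "i < m \<Longrightarrow> s i * qs i = \<alpha>s i + real CARD('n)"
  using qs[of i] by (simp add: s_def)

text \<open>Both balance conditions combine to make the product of the powers
  \<open>|x| powr (- s i)\<close> critical for the target weight.\<close>

lemma sum_s: "q * (\<Sum>i<m. s i) = \<alpha> + real CARD('n)"
proof -
  have "(\<Sum>i<m. s i) = (\<Sum>i<m. \<alpha>s i / qs i) + real CARD('n) * (\<Sum>i<m. 1 / qs i)"
    by (simp add: s_def add_divide_distrib sum.distrib sum_distrib_left)
  then show ?thesis using q by (simp add: sum_qs sum_\<alpha>s field_simps)
qed

text \<open>The conjugacy relation for Hoelder's inequality with exponents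
  \<open>qs i / q\<close>.\<close>

lemma sum_weights: "(\<Sum>i<m. q / qs i) = 1"
proof -
  have "(\<Sum>i<m. q / qs i) = q * (\<Sum>i<m. 1 / qs i)" by (simp add: sum_distrib_left)
  then show ?thesis using sum_qs q by simp
qed

lemma AE_well_cond: "AE y in \<mu>. well_cond y"
proof -
  have "AE y in \<mu>. \<forall>i\<in>{..<m}. qp_invertible p (A i y) \<and>
      qpm_norm p (A i y) * qpm_norm p (qp_mat_inv p (A i y)) \<le> \<kappa>"
    using A_inv A_cond by (subst AE_finite_all) (auto simp: \<kappa>_def)
  then show ?thesis
    using AE_norm_pos AE_space by eventually_elim (auto simp: well_cond_def)
qed

lemma well_cond_matrix:
  assumes "well_cond y" "i < m"
  shows "0 < nA i y" "qp_matrix p (A i y)"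
    and "1 / nA i y \<le> qpm_norm p (qp_mat_inv p (A i y))"
    and "qpm_norm p (qp_mat_inv p (A i y)) \<le> \<kappa> / nA i y"
proof -
  have inv: "qp_invertible p (A i y)" and le: "nA i y * qpm_norm p (qp_mat_inv p (A i y)) \<le> \<kappa>"
    using assms by (auto simp: well_cond_def nA_def)
  show M: "qp_matrix p (A i y)" using qp_mat_inv(1)[OF inv] .
  have ge: "1 \<le> nA i y * qpm_norm p (qp_mat_inv p (A i y))"
    using qpm_norm_inv_ge_1[OF inv] by (simp add: nA_def)
  then have "nA i y \<noteq> 0" by auto
  then show pos: "0 < nA i y" using qpm_norm_nonneg[OF M] by (simp add: nA_def)
  show "1 / nA i y \<le> qpm_norm p (qp_mat_inv p (A i y))"
    using ge pos by (simp add: field_simps)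
  show "qpm_norm p (qp_mat_inv p (A i y)) \<le> \<kappa> / nA i y"
    using le pos by (simp add: field_simps)
qed

lemma well_cond_upper:
  assumes "well_cond y" "i < m" "x \<in> Qpn p"
  shows "qpv_norm p (qp_mat_vec p (A i y) x) \<le> nA i y * qpv_norm p x"
  using mat_vec_norm_le[OF well_cond_matrix(2)[OF assms(1,2)] assms(3)] by (simp add: nA_def)

lemma well_cond_lower:
  assumes "well_cond y" "i < m" "x \<in> Qpn p"
  shows "nA i y * qpv_norm p x \<le> \<kappa> * qpv_norm p (qp_mat_vec p (A i y) x)"
proof -
  have inv: "qp_invertible p (A i y)" using assms by (auto simp: well_cond_def)
  let ?T = "qpv_norm p (qp_mat_vec p (A i y) x)"
  have T: "0 \<le> ?T" using well_cond_matrix(2)[OF assms(1,2)] assms(3) by simp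
  have "qpv_norm p x \<le> qpm_norm p (qp_mat_inv p (A i y)) * ?T"
    by (rule mat_vec_norm_ge[OF inv assms(3)])
  also have "\<dots> \<le> \<kappa> / nA i y * ?T"
    using well_cond_matrix(4)[OF assms(1,2)] T by (rule mult_right_mono)
  finally show ?thesis using well_cond_matrix(1)[OF assms(1,2)] by (simp add: field_simps)
qed

lemma nA_measurable [measurable]: "i < m \<Longrightarrow> nA i \<in> borel_measurable \<mu>"
  using qpm_norm_measurable[OF A_meas] by (simp add: nA_def[abs_def])

text \<open>Tonelli and the measurability of the operator in x rest on this joint
  measurability.\<close>

lemma mat_vec_pair_measurable:
  assumes "i < m"
  shows "(\<lambda>(x, y). qp_mat_vec p (A i y) x) \<in> measurable (\<mu> \<Otimes>\<^sub>M \<mu>) \<mu>"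
proof -
  have "(\<lambda>z. qp_mat_vec p (A i (snd z)) (fst z)) \<in> measurable (\<mu> \<Otimes>\<^sub>M \<mu>) (haar p)"
  proof (rule measurable_mat_vec)
    show "(\<lambda>z. A i (snd z) j k) \<in> measurable (\<mu> \<Otimes>\<^sub>M \<mu>) (qp_borel p)" for j k
      by (rule measurable_compose[OF measurable_snd A_meas[OF assms]])
    show "fst \<in> measurable (\<mu> \<Otimes>\<^sub>M \<mu>) (haar p)"
      unfolding haar_eq by (rule measurable_fst)
  qed
  then show ?thesis by (simp add: haar_eq case_prod_unfold)
qed

lemma comp_mat_vec_measurable:
  assumes "i < m" "g \<in> borel_measurable \<mu>"
  shows "(\<lambda>z. g (qp_mat_vec p (A i (snd z)) (fst z))) \<in> borel_measurable (\<mu> \<Otimes>\<^sub>M \<mu>)"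
  using measurable_compose[OF mat_vec_pair_measurable[OF assms(1)] assms(2)]
  by (simp add: case_prod_unfold)

text \<open>\<open>\<parallel>A\<^sub>i\<^sup>-\<^sup>1(y)\<parallel>\<close> is replaced by \<open>1 / \<parallel>A\<^sub>i(y)\<parallel>\<close>, which is comparable by (DK1) and whose
  measurability is immediate.\<close>
definition h :: "(('n \<Rightarrow> qp) \<Rightarrow> real) \<Rightarrow> ('n \<Rightarrow> qp) \<Rightarrow> real" where
  "h \<Phi> y = \<Phi> y / qpv_norm p y ^ CARD('n) * (\<Prod>i<m. nA i y powr (- s i))"

lemma h_measurable [measurable]:
  assumes [measurable]: "\<Phi> \<in> borel_measurable \<mu>" shows "h \<Phi> \<in> borel_measurable \<mu>"
proof -
  have "(\<lambda>y. \<Prod>i<m. nA i y powr (- s i)) \<in> borel_measurable \<mu>"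
  proof (rule borel_measurable_prod)
    fix i assume "i \<in> {..<m}"
    then have [measurable]: "nA i \<in> borel_measurable \<mu>" by simp
    show "(\<lambda>y. nA i y powr (- s i)) \<in> borel_measurable \<mu>" by measurable
  qed
  then show ?thesis unfolding h_def[abs_def] by measurable
qed

lemma h_nonneg:
  assumes "\<And>y. 0 \<le> \<Phi> y" "y \<in> Qpn p" shows "0 \<le> h \<Phi> y"
  using assms by (auto simp: h_def intro!: mult_nonneg_nonneg divide_nonneg_nonneg prod_nonneg)

text \<open>For any invertible matrix \<open>1 / nA i y\<close> is at most the norm of the inverse;
  the power \<open>s i\<close> keeps the order because \<open>\<alpha>s i > - n\<close>.\<close>

lemma C1_ge:
  assumes \<Phi>: "\<And>y. 0 \<le> \<Phi> y"
  shows "(\<integral>\<^sup>+y. ennreal (h \<Phi> y) \<partial>\<mu>) \<le> const_C1 p m \<Phi> A qs \<alpha>s"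
  unfolding const_C1_def haar_eq
proof (rule nn_integral_mono_AE)
  show "AE y in \<mu>. ennreal (h \<Phi> y) \<le> ennreal (\<Phi> y / qpv_norm p y ^ CARD('n) *
    (\<Prod>i<m. qpm_norm p (qp_mat_inv p (A i y)) powr ((\<alpha>s i + real CARD('n)) / qs i)))"
    using AE_well_cond
  proof eventually_elim
    case (elim y)
    have "(\<Prod>i<m. nA i y powr (- s i)) \<le> (\<Prod>i<m. qpm_norm p (qp_mat_inv p (A i y)) powr s i)"
    proof (intro prod_mono conjI)
      fix i assume "i \<in> {..<m}"
      then have i: "i < m" by simp
      have "nA i y powr (- s i) = (1 / nA i y) powr s i"
        using well_cond_matrix(1)[OF elim i] by (simp add: powr_divide powr_minus_divide)
      also have "\<dots> \<le> qpm_norm p (qp_mat_inv p (A i y)) powr s i"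
        using well_cond_matrix(1,3)[OF elim i] s_pos[OF i] by (intro powr_mono2) auto
      finally show "nA i y powr (- s i) \<le> qpm_norm p (qp_mat_inv p (A i y)) powr s i" .
    qed simp
    then show ?case
      using \<Phi>[of y] elim unfolding h_def s_def[symmetric] well_cond_def
      by (intro ennreal_leI mult_left_mono) auto
  qed
qed

text \<open>Here (DK1) enters: the norm of the inverse is at most \<open>\<kappa> / nA i y\<close>,
  at the cost of \<open>\<kappa> powr s i\<close> for each factor.\<close>

lemma C1_le:
  assumes \<Phi>: "\<And>y. 0 \<le> \<Phi> y" "\<Phi> \<in> borel_measurable \<mu>"
  shows "const_C1 p m \<Phi> A qs \<alpha>s \<le> ennreal (\<Prod>i<m. \<kappa> powr s i) * (\<integral>\<^sup>+y. ennreal (h \<Phi> y) \<partial>\<mu>)"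
proof -
  have "const_C1 p m \<Phi> A qs \<alpha>s \<le> (\<integral>\<^sup>+y. ennreal (\<Prod>i<m. \<kappa> powr s i) * ennreal (h \<Phi> y) \<partial>\<mu>)"
    unfolding const_C1_def haar_eq
  proof (rule nn_integral_mono_AE)
    show "AE y in \<mu>. ennreal (\<Phi> y / qpv_norm p y ^ CARD('n) *
      (\<Prod>i<m. qpm_norm p (qp_mat_inv p (A i y)) powr ((\<alpha>s i + real CARD('n)) / qs i)))
      \<le> ennreal (\<Prod>i<m. \<kappa> powr s i) * ennreal (h \<Phi> y)"
      using AE_well_cond
    proof eventually_elim
      case (elim y)
      have "(\<Prod>i<m. qpm_norm p (qp_mat_inv p (A i y)) powr s i) \<le> (\<Prod>i<m. \<kappa> powr s i * nA i y powr (- s i))"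
      proof (intro prod_mono conjI)
        fix i assume "i \<in> {..<m}"
        then have i: "i < m" by simp
        have "qpm_norm p (qp_mat_inv p (A i y)) powr s i \<le> (\<kappa> / nA i y) powr s i"
          using well_cond_matrix[OF elim i] s_pos[OF i] by (intro powr_mono2) (auto intro: order_trans[rotated])
        also have "\<dots> = \<kappa> powr s i * nA i y powr (- s i)"
          using well_cond_matrix(1)[OF elim i] \<kappa>_ge_1 by (simp add: powr_divide powr_minus_divide)
        finally show "qpm_norm p (qp_mat_inv p (A i y)) powr s i \<le> \<kappa> powr s i * nA i y powr (- s i)" .
      qed simp
      then have "\<Phi> y / qpv_norm p y ^ CARD('n) * (\<Prod>i<m. qpm_norm p (qp_mat_inv p (A i y)) powr s i)
        \<le> \<Phi> y / qpv_norm p y ^ CARD('n) * (\<Prod>i<m. \<kappa> powr s i * nA i y powr (- s i))"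
        using \<Phi>(1)[of y] elim unfolding well_cond_def by (intro mult_left_mono) auto
      also have "\<dots> = (\<Prod>i<m. \<kappa> powr s i) * h \<Phi> y"
        by (simp add: h_def prod.distrib)
      finally show ?case
        unfolding s_def[symmetric]
        by (subst ennreal_mult[symmetric]) (use h_nonneg[OF \<Phi>(1)] elim in \<open>auto simp: well_cond_def intro!: prod_nonneg ennreal_leI\<close>)
    qed
  qed
  also have "\<dots> = ennreal (\<Prod>i<m. \<kappa> powr s i) * (\<integral>\<^sup>+y. ennreal (h \<Phi> y) \<partial>\<mu>)"
    using \<Phi>(2) by (intro nn_integral_cmult) simp
  finally show ?thesis .
qed

subsection \<open>The upper bound\<close>

text \<open>The integrand of the i-th norm after substituting \<open>A i y\<close>, normalised by
  the power of \<open>nA i y\<close> that makes its x-integral bounded uniformly in y.\<close>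

definition F :: "(nat \<Rightarrow> ('n \<Rightarrow> qp) \<Rightarrow> real) \<Rightarrow> nat \<Rightarrow> ('n \<Rightarrow> qp) \<Rightarrow> ('n \<Rightarrow> qp) \<Rightarrow> real" where
  "F f i y x = nA i y powr (\<alpha>s i + real CARD('n)) *
    (\<bar>f i (qp_mat_vec p (A i y) x)\<bar> powr qs i * qpv_norm p x powr \<alpha>s i)"

text \<open>The cost of one substitution: the first factor comes from the weight, the second from
  the measure.\<close>

definition D :: "nat \<Rightarrow> real" where
  "D i = \<kappa> powr \<bar>\<alpha>s i\<bar> * \<kappa> ^ CARD('n)"

lemma D_pos: "D i > 0"
  using \<kappa>_ge_1 by (simp add: D_def)

text \<open>The norm of the image and \<open>nA i y * qpv_norm p x\<close> agree up to \<kappa>. The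
  sign of \<open>\<alpha>s i\<close> decides which of the two estimates is used, and only
  \<open>well_cond_lower\<close> costs a power of \<kappa>.\<close>

lemma weight_le:
  assumes "well_cond y" "i < m" "x \<in> Qpn p"
  shows "nA i y powr \<alpha>s i * qpv_norm p x powr \<alpha>s i
    \<le> \<kappa> powr \<bar>\<alpha>s i\<bar> * qpv_norm p (qp_mat_vec p (A i y) x) powr \<alpha>s i"
proof -
  let ?N = "nA i y" and ?x = "qpv_norm p x" and ?z = "qpv_norm p (qp_mat_vec p (A i y) x)"
  have N: "?N > 0" using well_cond_matrix(1)[OF assms(1,2)] .
  have x: "?x \<ge> 0" and z: "?z \<ge> 0" using assms well_cond_matrix(2) by auto
  have up: "?z \<le> ?N * ?x" and lo: "?N * ?x \<le> \<kappa> * ?z"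
    using well_cond_upper[OF assms] well_cond_lower[OF assms] .
  have "?N powr \<alpha>s i * ?x powr \<alpha>s i = (?N * ?x) powr \<alpha>s i"
    using N x by (simp add: powr_mult)
  also have "\<dots> \<le> \<kappa> powr \<bar>\<alpha>s i\<bar> * ?z powr \<alpha>s i"
  proof (cases "\<alpha>s i \<ge> 0")
    case True
    then have "(?N * ?x) powr \<alpha>s i \<le> (\<kappa> * ?z) powr \<alpha>s i"
      using lo N x by (intro powr_mono2) auto
    then show ?thesis using True z \<kappa>_ge_1 by (simp add: powr_mult)
  next
    case False
    show ?thesis
    proof (cases "?z = 0")
      case True
      \<comment> \<open>Negative powers are monotone only on positive bases; at the origin both
        sides are 0 because \<open>0 powr a = 0\<close>.\<close>
      then have "?N * ?x = 0" using lo N x by (auto simp: mult_le_0_iff)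
      then show ?thesis using True by simp
    next
      case z0: False
      then have "(?N * ?x) powr \<alpha>s i \<le> ?z powr \<alpha>s i"
        using up z False by (intro powr_mono2') auto
      also have "\<dots> \<le> \<kappa> powr \<bar>\<alpha>s i\<bar> * ?z powr \<alpha>s i"
        using \<kappa>_ge_1 ge_one_powr_ge_zero[of \<kappa> "\<bar>\<alpha>s i\<bar>"]
          mult_right_mono[of 1 "\<kappa> powr \<bar>\<alpha>s i\<bar>" "?z powr \<alpha>s i"] by simp
      finally show ?thesis .
    qed
  qed
  finally show ?thesis .
qed

text \<open>The factor \<open>nA i y ^ n\<close> of the normalisation meets the bound
  \<open>qpm_norm p (qp_mat_inv p (A i y)) ^ n\<close> for the change of measure; their product is
  at most \<open>\<kappa> ^ n\<close>.\<close>

lemma nn_integral_F_le: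
  assumes y: "well_cond y" "i < m" and f: "f i \<in> borel_measurable \<mu>"
    and t: "0 \<le> t" "(\<integral>\<^sup>+x. ennreal (\<bar>f i x\<bar> powr qs i * qpv_norm p x powr \<alpha>s i) \<partial>\<mu>) \<le> ennreal t"
  shows "(\<integral>\<^sup>+x. ennreal (F f i y x) \<partial>\<mu>) \<le> ennreal (D i * t)"
proof -
  let ?N = "nA i y" and ?J = "qpm_norm p (qp_mat_inv p (A i y))"
  have inv: "qp_invertible p (A i y)" using y by (auto simp: well_cond_def)
  note N = well_cond_matrix[OF y]
  define g where "g z = ennreal (\<bar>f i z\<bar> powr qs i * qpv_norm p z powr \<alpha>s i)" for z
  have [measurable]: "f i \<in> borel_measurable \<mu>" by (rule f)
  have g: "g \<in> borel_measurable \<mu>" unfolding g_def by measurable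
  let ?c = "\<kappa> powr \<bar>\<alpha>s i\<bar> * ?N ^ CARD('n)"
  have c: "?c \<ge> 0" using N by simp
  have "(\<integral>\<^sup>+x. ennreal (F f i y x) \<partial>\<mu>) \<le> (\<integral>\<^sup>+x. ennreal ?c * g (qp_mat_vec p (A i y) x) \<partial>\<mu>)"
  proof (rule nn_integral_mono)
    fix x assume "x \<in> space \<mu>"
    then have x: "x \<in> Qpn p" by simp
    let ?z = "qp_mat_vec p (A i y) x"
    have "F f i y x = (\<bar>f i ?z\<bar> powr qs i * ?N ^ CARD('n)) * (?N powr \<alpha>s i * qpv_norm p x powr \<alpha>s i)"
      using N(1) by (simp add: F_def powr_add powr_realpow)
    also have "\<dots> \<le> (\<bar>f i ?z\<bar> powr qs i * ?N ^ CARD('n)) * (\<kappa> powr \<bar>\<alpha>s i\<bar> * qpv_norm p ?z powr \<alpha>s i)"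
      using weight_le[OF y x] N(1) by (intro mult_left_mono) auto
    also have "\<dots> = ?c * (\<bar>f i ?z\<bar> powr qs i * qpv_norm p ?z powr \<alpha>s i)" by simp
    finally have "ennreal (F f i y x) \<le> ennreal (?c * (\<bar>f i ?z\<bar> powr qs i * qpv_norm p ?z powr \<alpha>s i))"
      by (rule ennreal_leI)
    then show "ennreal (F f i y x) \<le> ennreal ?c * g ?z"
      using c by (simp add: g_def ennreal_mult)
  qed
  also have "\<dots> = ennreal ?c * (\<integral>\<^sup>+x. g (qp_mat_vec p (A i y) x) \<partial>\<mu>)"
    using measurable_compose[OF mat_vec_measurable[OF N(2)] g] by (rule nn_integral_cmult)
  also have "\<dots> \<le> ennreal ?c * (ennreal (?J ^ CARD('n)) * ennreal t)"
  proof (intro mult_left_mono order_trans[OF nn_integral_mat_vec_le[OF inv g]])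
    show "(\<integral>\<^sup>+x. g x \<partial>\<mu>) \<le> ennreal t" using t(2) by (simp add: g_def)
  qed auto
  also have "\<dots> \<le> ennreal ?c * (ennreal ((\<kappa> / ?N) ^ CARD('n)) * ennreal t)"
    using N qp_mat_inv(2)[OF inv]
    by (intro mult_left_mono mult_right_mono ennreal_leI power_mono) auto
  also have "\<dots> = ennreal (?c * ((\<kappa> / ?N) ^ CARD('n) * t))"
    using N \<kappa>_ge_1 t c by (simp add: ennreal_mult)
  also have "?c * ((\<kappa> / ?N) ^ CARD('n) * t) = D i * t"
    using N(1) by (simp add: D_def power_divide)
  finally show ?thesis .
qed

interpretation mu: sigma_finite_measure \<mu>
  by (rule sigma_finite_mu)

interpretation pair: pair_sigma_finite \<mu> \<mu> ..

lemma integrand_measurable: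
  assumes [measurable]: "\<Phi> \<in> borel_measurable \<mu>" and f: "\<And>i. i < m \<Longrightarrow> f i \<in> borel_measurable \<mu>"
  shows "(\<lambda>(x, y). hausdorff_integrand p m \<Phi> A f x y) \<in> borel_measurable (\<mu> \<Otimes>\<^sub>M \<mu>)"
proof -
  have "(\<lambda>z. \<Prod>i<m. f i (qp_mat_vec p (A i (snd z)) (fst z))) \<in> borel_measurable (\<mu> \<Otimes>\<^sub>M \<mu>)"
    using f by (intro borel_measurable_prod comp_mat_vec_measurable) auto
  then have "(\<lambda>z. \<Phi> (snd z) / qpv_norm p (snd z) ^ CARD('n) * (\<Prod>i<m. f i (qp_mat_vec p (A i (snd z)) (fst z))))
      \<in> borel_measurable (\<mu> \<Otimes>\<^sub>M \<mu>)" by measurable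
  then show ?thesis by (simp add: hausdorff_integrand_def case_prod_unfold)
qed

lemma hausdorff_op_measurable:
  assumes "\<Phi> \<in> borel_measurable \<mu>" "\<And>i. i < m \<Longrightarrow> f i \<in> borel_measurable \<mu>"
  shows "hausdorff_op p m \<Phi> A f \<in> borel_measurable \<mu>"
  unfolding hausdorff_op_def[abs_def] haar_eq
  by (rule mu.borel_measurable_lebesgue_integral[OF integrand_measurable[OF assms]])

text \<open>What remains of the integrand after splitting off \<open>h\<close>: the powers of
  \<open>nA i y\<close> put into \<open>h\<close> are compensated here, so that the norm of G in x
  is bounded uniformly in y.\<close>

definition G :: "(nat \<Rightarrow> ('n \<Rightarrow> qp) \<Rightarrow> real) \<Rightarrow> ('n \<Rightarrow> qp) \<Rightarrow> ('n \<Rightarrow> qp) \<Rightarrow> real" where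
  "G f x y = (\<Prod>i<m. nA i y powr s i * \<bar>f i (qp_mat_vec p (A i y) x)\<bar>)"

lemma G_nonneg: "0 \<le> G f x y"
  by (auto simp: G_def intro!: prod_nonneg)

lemma G_measurable:
  assumes f: "\<And>i. i < m \<Longrightarrow> f i \<in> borel_measurable \<mu>"
  shows "(\<lambda>z. G f (fst z) (snd z)) \<in> borel_measurable (\<mu> \<Otimes>\<^sub>M \<mu>)"
  unfolding G_def
proof (rule borel_measurable_prod)
  fix i assume "i \<in> {..<m}"
  then have [measurable]: "nA i \<in> borel_measurable \<mu>"
    "(\<lambda>z. f i (qp_mat_vec p (A i (snd z)) (fst z))) \<in> borel_measurable (\<mu> \<Otimes>\<^sub>M \<mu>)"
    using f comp_mat_vec_measurable by auto
  show "(\<lambda>z. nA i (snd z) powr s i * \<bar>f i (qp_mat_vec p (A i (snd z)) (fst z))\<bar>)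
      \<in> borel_measurable (\<mu> \<Otimes>\<^sub>M \<mu>)" by measurable
qed

lemma abs_integrand:
  assumes "well_cond y" "\<And>y. 0 \<le> \<Phi> y"
  shows "\<bar>hausdorff_integrand p m \<Phi> A f x y\<bar> = h \<Phi> y * G f x y"
proof -
  have "(\<Prod>i<m. nA i y powr (- s i)) * (\<Prod>i<m. nA i y powr s i * \<bar>f i (qp_mat_vec p (A i y) x)\<bar>)
      = (\<Prod>i<m. \<bar>f i (qp_mat_vec p (A i y) x)\<bar>)"
    unfolding prod.distrib[symmetric]
  proof (rule prod.cong[OF refl])
    fix i assume "i \<in> {..<m}"
    then have "nA i y > 0" using well_cond_matrix(1)[OF assms(1)] by simp
    then show "nA i y powr (- s i) * (nA i y powr s i * \<bar>f i (qp_mat_vec p (A i y) x)\<bar>)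
        = \<bar>f i (qp_mat_vec p (A i y) x)\<bar>"
      by (simp add: powr_minus field_simps)
  qed
  then show ?thesis
    using assms by (simp add: hausdorff_integrand_def h_def G_def well_cond_def abs_mult abs_prod mult.assoc)
qed

text \<open>The second balance condition spreads the target weight over the factors. For
  \<open>r = 0\<close>, the convention \<open>0 powr a = 0\<close> and \<open>m \<ge> 1\<close> make
  both sides 0, also when \<open>\<alpha> = 0\<close>.\<close>

lemma prod_weights:
  assumes "0 \<le> r" shows "(\<Prod>i<m. r powr (\<alpha>s i * (q / qs i))) = r powr \<alpha>"
proof (cases "r = 0")
  case True
  have "(\<Prod>i<m. r powr (\<alpha>s i * (q / qs i))) = 0"
    using True m by (intro prod_zero bexI[of _ 0]) auto
  then show ?thesis using True by simp
next
  case False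
  have "(\<Sum>i<m. \<alpha>s i * (q / qs i)) = q * (\<Sum>i<m. \<alpha>s i / qs i)"
    by (simp add: sum_distrib_left mult.commute)
  also have "\<dots> = \<alpha>" using q sum_\<alpha>s by simp
  finally show ?thesis using False by (simp add: powr_sum[symmetric])
qed

text \<open>Brings the weighted q-th power into Hoelder form; the exponents match because
  \<open>(\<alpha>s i + n) * (q / qs i) = s i * q\<close>.\<close>

lemma G_powr_weight:
  assumes "x \<in> Qpn p"
  shows "G f x y powr q * qpv_norm p x powr \<alpha> = (\<Prod>i<m. F f i y x powr (q / qs i))"
proof -
  have *: "F f i y x powr (q / qs i) = (nA i y powr s i * \<bar>f i (qp_mat_vec p (A i y) x)\<bar>) powr q
      * qpv_norm p x powr (\<alpha>s i * (q / qs i))" if "i < m" for i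
  proof -
    have "(\<alpha>s i + real CARD('n)) * (q / qs i) = s i * q" "qs i * (q / qs i) = q"
      using qs[OF that] by (auto simp: s_def)
    then show ?thesis
      using assms by (simp add: F_def powr_mult powr_powr)
  qed
  have "(\<Prod>i<m. F f i y x powr (q / qs i))
     = (\<Prod>i<m. (nA i y powr s i * \<bar>f i (qp_mat_vec p (A i y) x)\<bar>) powr q
      * qpv_norm p x powr (\<alpha>s i * (q / qs i)))"
    by (intro prod.cong refl *) simp
  also have "\<dots> = (\<Prod>i<m. (nA i y powr s i * \<bar>f i (qp_mat_vec p (A i y) x)\<bar>) powr q) * qpv_norm p x powr \<alpha>"
    by (simp only: prod.distrib prod_weights[OF qpv_norm_nonneg[OF assms]])
  finally show ?thesis by (simp add: G_def prod_powr_distrib)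
qed

lemma F_measurable:
  assumes "well_cond y" "i < m" and [measurable]: "f i \<in> borel_measurable \<mu>"
  shows "F f i y \<in> borel_measurable \<mu>"
proof -
  have [measurable]: "qp_mat_vec p (A i y) \<in> measurable \<mu> \<mu>"
    using well_cond_matrix(2)[OF assms(1,2)] by (rule mat_vec_measurable)
  show ?thesis unfolding F_def[abs_def] by measurable
qed

text \<open>Hoelder in x at a fixed y. The bound does not involve y, so only \<open>h\<close>
  remains to be integrated in y.\<close>

lemma nn_integral_G_le:
  assumes y: "well_cond y" and f: "\<And>i. i < m \<Longrightarrow> f i \<in> borel_measurable \<mu>"
    and t: "\<And>i. i < m \<Longrightarrow> 0 \<le> t i"
      "\<And>i. i < m \<Longrightarrow> (\<integral>\<^sup>+x. ennreal (\<bar>f i x\<bar> powr qs i * qpv_norm p x powr \<alpha>s i) \<partial>\<mu>) \<le> ennreal (t i)"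
  shows "(\<integral>\<^sup>+x. ennreal (G f x y powr q * qpv_norm p x powr \<alpha>) \<partial>\<mu>)
    \<le> ennreal (\<Prod>i<m. (D i * t i) powr (q / qs i))"
proof -
  have "(\<integral>\<^sup>+x. ennreal (G f x y powr q * qpv_norm p x powr \<alpha>) \<partial>\<mu>)
      = (\<integral>\<^sup>+x. ennreal (\<Prod>i<m. F f i y x powr (q / qs i)) \<partial>\<mu>)"
    by (intro nn_integral_cong) (simp add: G_powr_weight)
  also have "\<dots> \<le> ennreal (\<Prod>i<m. (D i * t i) powr (q / qs i))"
  proof (rule nn_integral_Hoelder)
    fix i assume "i \<in> {..<m}"
    then have i: "i < m" by simp
    show "0 \<le> q / qs i" using q qs[OF i] by simp
    show "F f i y \<in> borel_measurable \<mu>" by (rule F_measurable[where f=f, OF y i f[of i, OF i]])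
    show "0 \<le> F f i y x" for x by (simp add: F_def)
    show "0 \<le> D i * t i" using t(1)[OF i] D_pos[of i] by simp
    show "(\<integral>\<^sup>+x. ennreal (F f i y x) \<partial>\<mu>) \<le> ennreal (D i * t i)"
      by (rule nn_integral_F_le[where f=f, OF y i f[of i, OF i] t(1,2)[OF i]])
  qed (simp_all add: sum_weights)
  finally show ?thesis .
qed

text \<open>Instead of Minkowski's integral inequality: Jensen's inequality for the finite measure
  \<open>h \<Phi> \<cdot> \<mu>\<close> in \<open>y\<close>, followed by Tonelli.\<close>
lemma hausdorff_upper:
  assumes \<Phi>: "\<Phi> \<in> borel_measurable \<mu>" "\<And>y. 0 \<le> \<Phi> y"
    and K: "0 \<le> K" "(\<integral>\<^sup>+y. ennreal (h \<Phi> y) \<partial>\<mu>) \<le> ennreal K"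
  shows "hausdorff_bound p m \<Phi> A qs (\<lambda>i. pow_weight p (\<alpha>s i)) q (pow_weight p \<alpha>)
    (K * (\<Prod>i<m. D i powr (1 / qs i)))"
  unfolding hausdorff_bound_def
proof (intro allI impI)
  fix f :: "nat \<Rightarrow> ('n \<Rightarrow> qp) \<Rightarrow> real"
  assume inLq: "\<forall>i<m. in_Lq p (qs i) (pow_weight p (\<alpha>s i)) (f i)"
  let ?int = "hausdorff_integrand p m \<Phi> A f" and ?H = "hausdorff_op p m \<Phi> A f"
  have f: "f i \<in> borel_measurable \<mu>" if "i < m" for i
    using inLq that unfolding in_Lq_def haar_eq by blast
  define I where "I i = (\<integral>\<^sup>+x. ennreal (\<bar>f i x\<bar> powr qs i * qpv_norm p x powr \<alpha>s i) \<partial>\<mu>)" for i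
  define t where "t i = enn2real (I i)" for i
  have t: "0 \<le> t i" for i by (simp add: t_def)
  have It: "I i \<le> ennreal (t i)" if "i < m" for i
  proof -
    have "I i < \<infinity>" using inLq that unfolding in_Lq_def haar_eq pow_weight_def I_def by blast
    then show ?thesis by (simp add: t_def ennreal_enn2real)
  qed
  define E where "E = (\<Prod>i<m. (D i * t i) powr (q / qs i))"
  have E: "E \<ge> 0" by (auto simp: E_def intro!: prod_nonneg)
  have hm: "h \<Phi> \<in> borel_measurable \<mu>" using \<Phi>(1) by (rule h_measurable)
  have h0: "0 \<le> h \<Phi> y" if "y \<in> Qpn p" for y using h_nonneg[OF \<Phi>(2) that] .
  note Gm = G_measurable[OF f]
  \<comment> \<open>Jensen in y will bound \<open>\<bar>?H x\<bar> powr q\<close> by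
    \<open>K powr (q - 1) * W x\<close>, and Tonelli bounds the weighted integral of W by
    \<open>K * E\<close>.\<close>
  define W where "W x = (\<integral>\<^sup>+y. ennreal (h \<Phi> y * G f x y powr q) \<partial>\<mu>)" for x
  let ?w = "\<lambda>x. qpv_norm p x powr \<alpha>"
  have hG: "(\<lambda>z. h \<Phi> (snd z) * G f (fst z) (snd z) powr q) \<in> borel_measurable (\<mu> \<Otimes>\<^sub>M \<mu>)"
    using Gm hm by measurable
  have hGw: "(\<lambda>z. h \<Phi> (snd z) * (G f (fst z) (snd z) powr q * ?w (fst z))) \<in> borel_measurable (\<mu> \<Otimes>\<^sub>M \<mu>)"
    using Gm hm by measurable
  have Wm: "W \<in> borel_measurable \<mu>"
    unfolding W_def[abs_def]
    by (rule mu.borel_measurable_nn_integral) (use hG in \<open>simp add: case_prod_unfold\<close>)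
  have Ww: "(\<lambda>x. W x * ennreal (?w x)) \<in> borel_measurable \<mu>"
    using Wm by measurable
  have G1: "(\<lambda>y. G f x y) \<in> borel_measurable \<mu>" if "x \<in> Qpn p" for x
    using measurable_compose[OF measurable_Pair1'[of x \<mu> \<mu>] Gm] that by simp
  have G2: "(\<lambda>x. G f x y) \<in> borel_measurable \<mu>" if "y \<in> Qpn p" for y
    using measurable_compose[OF measurable_Pair2'[of y \<mu> \<mu>] Gm] that by simp
  have Wint: "(\<integral>\<^sup>+x. W x * ennreal (?w x) \<partial>\<mu>) \<le> ennreal (K * E)"
  proof -
    have "(\<integral>\<^sup>+x. W x * ennreal (?w x) \<partial>\<mu>)
        = (\<integral>\<^sup>+x. \<integral>\<^sup>+y. ennreal (h \<Phi> y * (G f x y powr q * ?w x)) \<partial>\<mu> \<partial>\<mu>)"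
    proof (rule nn_integral_cong)
      fix x assume "x \<in> space \<mu>"
      then have x: "x \<in> Qpn p" by simp
      have [measurable]: "(\<lambda>y. ennreal (h \<Phi> y * G f x y powr q)) \<in> borel_measurable \<mu>"
        using hm G1[OF x] by measurable
      have "W x * ennreal (?w x) = (\<integral>\<^sup>+y. ennreal (h \<Phi> y * G f x y powr q) * ennreal (?w x) \<partial>\<mu>)"
        unfolding W_def by (rule nn_integral_multc[symmetric]) measurable
      also have "\<dots> = (\<integral>\<^sup>+y. ennreal (h \<Phi> y * (G f x y powr q * ?w x)) \<partial>\<mu>)"
        by (intro nn_integral_cong) (simp add: ennreal_mult[symmetric] h0 mult.assoc)
      finally show "W x * ennreal (?w x) = (\<integral>\<^sup>+y. ennreal (h \<Phi> y * (G f x y powr q * ?w x)) \<partial>\<mu>)" .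
    qed
    also have "\<dots> = (\<integral>\<^sup>+y. \<integral>\<^sup>+x. ennreal (h \<Phi> y * (G f x y powr q * ?w x)) \<partial>\<mu> \<partial>\<mu>)"
      by (rule pair.Fubini'[symmetric]) (use hGw in \<open>simp add: case_prod_unfold\<close>)
    also have "\<dots> \<le> (\<integral>\<^sup>+y. ennreal E * ennreal (h \<Phi> y) \<partial>\<mu>)"
    proof (rule nn_integral_mono_AE)
      show "AE y in \<mu>. (\<integral>\<^sup>+x. ennreal (h \<Phi> y * (G f x y powr q * ?w x)) \<partial>\<mu>) \<le> ennreal E * ennreal (h \<Phi> y)"
        using AE_well_cond
      proof eventually_elim
        case (elim y)
        then have y: "y \<in> Qpn p" by (simp add: well_cond_def)
        have [measurable]: "(\<lambda>x. G f x y) \<in> borel_measurable \<mu>" using G2[OF y] .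
        have "(\<integral>\<^sup>+x. ennreal (h \<Phi> y * (G f x y powr q * ?w x)) \<partial>\<mu>)
            = (\<integral>\<^sup>+x. ennreal (h \<Phi> y) * ennreal (G f x y powr q * ?w x) \<partial>\<mu>)"
          using h0[OF y] by (simp add: ennreal_mult)
        also have "\<dots> = ennreal (h \<Phi> y) * (\<integral>\<^sup>+x. ennreal (G f x y powr q * ?w x) \<partial>\<mu>)"
          by (rule nn_integral_cmult) measurable
        also have "\<dots> \<le> ennreal (h \<Phi> y) * ennreal E"
          unfolding E_def using elim f t It
          by (intro mult_left_mono nn_integral_G_le) (auto simp: I_def)
        finally show ?case by (simp add: mult.commute)
      qed
    qed
    also have "\<dots> = ennreal E * (\<integral>\<^sup>+y. ennreal (h \<Phi> y) \<partial>\<mu>)"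
      by (rule nn_integral_cmult[OF measurable_compose[OF hm measurable_ennreal]])
    also have "\<dots> \<le> ennreal E * ennreal K" using K by (intro mult_left_mono) auto
    finally show ?thesis using E K by (simp add: ennreal_mult mult.commute)
  qed
  have "AE x in \<mu>. W x * ennreal (?w x) \<noteq> \<infinity>"
    using Wm Wint by (intro nn_integral_PInf_AE) (auto simp: top_unique)
  then have key: "AE x in \<mu>. integrable \<mu> (?int x) \<and>
      ennreal (\<bar>?H x\<bar> powr q * ?w x) \<le> ennreal (K powr (q - 1)) * (W x * ennreal (?w x))"
    using AE_norm_pos AE_space
  proof eventually_elim
    case (elim x)
    then have x: "x \<in> Qpn p" "qpv_norm p x > 0" by auto
    \<comment> \<open>Off the origin the weight is positive, so finiteness of the weighted value
      passes to \<open>W x\<close>.\<close>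
    then have "W x \<noteq> \<infinity>" using elim(1) by (auto simp: ennreal_mult_eq_top_iff)
    define Y where "Y = enn2real (W x)"
    have Y: "0 \<le> Y" "W x = ennreal Y"
      using \<open>W x \<noteq> \<infinity>\<close> by (auto simp: Y_def ennreal_enn2real less_top)
    have intm: "?int x \<in> borel_measurable \<mu>"
      using measurable_compose[OF measurable_Pair1'[of x \<mu> \<mu>] integrand_measurable[OF \<Phi>(1) f]] x by simp
    have "(\<integral>\<^sup>+y. ennreal \<bar>?int x y\<bar> \<partial>\<mu>) = (\<integral>\<^sup>+y. ennreal (h \<Phi> y * G f x y) \<partial>\<mu>)"
      by (rule nn_integral_cong_AE) (use AE_well_cond in eventually_elim, simp add: abs_integrand \<Phi>(2))
    also have "\<dots> \<le> ennreal (K powr (1 - 1 / q) * Y powr (1 / q))"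
      by (rule nn_integral_Jensen[OF q hm G1[OF x(1)]])
        (use K Y h0 G_nonneg in \<open>auto simp: W_def\<close>)
    finally have b: "(\<integral>\<^sup>+y. ennreal \<bar>?int x y\<bar> \<partial>\<mu>) \<le> ennreal (K powr (1 - 1 / q) * Y powr (1 / q))" .
    then have int: "integrable \<mu> (?int x)"
      using intm by (intro integrableI_bounded) (auto intro: le_less_trans)
    have "ennreal \<bar>?H x\<bar> \<le> ennreal (K powr (1 - 1 / q) * Y powr (1 / q))"
      unfolding hausdorff_op_def haar_eq
      using order_trans[OF integral_norm_bound_ennreal[OF int]] b by (simp only: real_norm_def)
    then have "\<bar>?H x\<bar> \<le> K powr (1 - 1 / q) * Y powr (1 / q)"
      using K Y by (subst (asm) ennreal_le_iff) auto
    then have "\<bar>?H x\<bar> powr q \<le> (K powr (1 - 1 / q) * Y powr (1 / q)) powr q"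
      using q by (intro powr_mono2) auto
    also have "\<dots> = K powr (q - 1) * Y"
      using q K Y by (simp add: powr_mult powr_powr algebra_simps)
    finally have "\<bar>?H x\<bar> powr q * ?w x \<le> K powr (q - 1) * (Y * ?w x)"
      by (simp add: mult.assoc[symmetric] mult_right_mono)
    then show ?case
      using int Y by (auto simp: ennreal_mult[symmetric] intro!: ennreal_leI)
  qed
  have Hm: "?H \<in> borel_measurable \<mu>" by (rule hausdorff_op_measurable[OF \<Phi>(1) f])
  have "(\<integral>\<^sup>+x. ennreal (\<bar>?H x\<bar> powr q * ?w x) \<partial>\<mu>)
      \<le> (\<integral>\<^sup>+x. ennreal (K powr (q - 1)) * (W x * ennreal (?w x)) \<partial>\<mu>)"
    by (rule nn_integral_mono_AE) (use key in eventually_elim, simp)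
  also have "\<dots> = ennreal (K powr (q - 1)) * (\<integral>\<^sup>+x. W x * ennreal (?w x) \<partial>\<mu>)"
    by (rule nn_integral_cmult[OF Ww])
  also have "\<dots> \<le> ennreal (K powr (q - 1)) * ennreal (K * E)"
    using Wint by (intro mult_left_mono) auto
  also have "\<dots> = ennreal (K powr q * E)"
  proof -
    have "K powr (q - 1) * K = K powr q"
      using K q by (cases "K = 0") (auto simp: powr_mult_base[symmetric] mult.commute powr_diff)
    then show ?thesis using K E by (simp add: ennreal_mult[symmetric] mult.assoc[symmetric])
  qed
  finally have fin: "(\<integral>\<^sup>+x. ennreal (\<bar>?H x\<bar> powr q * ?w x) \<partial>\<mu>) \<le> ennreal (K powr q * E)" .
  have "Lq_norm p q (pow_weight p \<alpha>) ?H \<le> (K powr q * E) powr (1 / q)"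
    unfolding Lq_norm_def haar_eq pow_weight_def
    using fin q E by (intro powr_mono2) (auto intro: enn2real_leI)
  also have "\<dots> = K * (\<Prod>i<m. (D i * t i) powr (1 / qs i))"
  proof -
    have "E powr (1 / q) = (\<Prod>i<m. ((D i * t i) powr (q / qs i)) powr (1 / q))"
      unfolding E_def by (rule prod_powr_distrib)
    also have "\<dots> = (\<Prod>i<m. (D i * t i) powr (1 / qs i))"
      using q by (simp add: powr_powr)
    finally show ?thesis using K q E by (simp add: powr_mult powr_powr)
  qed
  also have "\<dots> = K * (\<Prod>i<m. D i powr (1 / qs i)) * (\<Prod>i<m. Lq_norm p (qs i) (pow_weight p (\<alpha>s i)) (f i))"
    unfolding Lq_norm_def haar_eq pow_weight_def I_def[symmetric] t_def[symmetric]
    using D_pos t by (simp add: powr_mult prod.distrib less_imp_le)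
  finally have norm: "Lq_norm p q (pow_weight p \<alpha>) ?H
    \<le> K * (\<Prod>i<m. D i powr (1 / qs i)) * (\<Prod>i<m. Lq_norm p (qs i) (pow_weight p (\<alpha>s i)) (f i))" .
  show "(AE x in haar p. integrable (haar p) (?int x)) \<and> in_Lq p q (pow_weight p \<alpha>) ?H \<and>
    Lq_norm p q (pow_weight p \<alpha>) ?H
    \<le> K * (\<Prod>i<m. D i powr (1 / qs i)) * (\<Prod>i<m. Lq_norm p (qs i) (pow_weight p (\<alpha>s i)) (f i))"
    using norm Hm key fin unfolding in_Lq_def haar_eq pow_weight_def
    by (auto intro: le_less_trans)
qed

subsection \<open>The lower bound\<close>

text \<open>Bounds on \<open>nA i y\<close> limit how far \<open>A i y\<close> moves a sphere; the
  bounds on |y| and \<open>h\<close> make the integral of \<open>h\<close> over the set finite, so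
  that it can be used as a real number.\<close>

definition truncation :: "(('n \<Rightarrow> qp) \<Rightarrow> real) \<Rightarrow> nat \<Rightarrow> ('n \<Rightarrow> qp) set" where
  "truncation \<Phi> r = {y \<in> Qpn p. qpv_norm p y \<le> real p powi int r \<and> h \<Phi> y \<le> real r \<and>
      (\<forall>i\<in>{..<m}. real p powi (- int r) \<le> nA i y \<and> nA i y \<le> real p powi int r)}"

lemma truncation_in_sets:
  assumes "\<Phi> \<in> borel_measurable \<mu>" shows "truncation \<Phi> r \<in> sets \<mu>"
proof -
  have [measurable]: "h \<Phi> \<in> borel_measurable \<mu>" using assms by (rule h_measurable)
  have "{y \<in> space \<mu>. \<forall>i\<in>{..<m}. real p powi (- int r) \<le> nA i y \<and> nA i y \<le> real p powi int r} \<in> sets \<mu>"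
  proof (intro sets.sets_Collect_finite_All)
    fix i assume "i \<in> {..<m}"
    then have [measurable]: "nA i \<in> borel_measurable \<mu>" by simp
    show "{y \<in> space \<mu>. real p powi (- int r) \<le> nA i y \<and> nA i y \<le> real p powi int r} \<in> sets \<mu>"
      by measurable
  qed simp
  moreover have "{y \<in> space \<mu>. qpv_norm p y \<le> real p powi int r \<and> h \<Phi> y \<le> real r} \<in> sets \<mu>"
    by measurable
  ultimately have "{y \<in> space \<mu>. qpv_norm p y \<le> real p powi int r \<and> h \<Phi> y \<le> real r} \<inter>
    {y \<in> space \<mu>. \<forall>i\<in>{..<m}. real p powi (- int r) \<le> nA i y \<and> nA i y \<le> real p powi int r} \<in> sets \<mu>"
    by (rule sets.Int[rotated])
  also have "{y \<in> space \<mu>. qpv_norm p y \<le> real p powi int r \<and> h \<Phi> y \<le> real r} \<inter>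
    {y \<in> space \<mu>. \<forall>i\<in>{..<m}. real p powi (- int r) \<le> nA i y \<and> nA i y \<le> real p powi int r} = truncation \<Phi> r"
    by (auto simp: truncation_def)
  finally show ?thesis .
qed

lemma truncation_mono: "r \<le> r' \<Longrightarrow> truncation \<Phi> r \<subseteq> truncation \<Phi> r'"
proof
  fix y assume le: "r \<le> r'" and y: "y \<in> truncation \<Phi> r"
  have "real p powi int r \<le> real p powi int r'" "real p powi (- int r') \<le> real p powi (- int r)"
    "real r \<le> real r'"
    using le powi_le_iff[of "int r" "int r'"] powi_le_iff[of "- int r'" "- int r"] by auto
  with y show "y \<in> truncation \<Phi> r'"
    unfolding truncation_def by (auto intro: order_trans)
qed

lemma well_cond_in_truncation:
  assumes "well_cond y" shows "\<exists>r. y \<in> truncation \<Phi> r"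
proof -
  \<comment> \<open>The sum dominates every \<open>nA i y\<close> and every
    \<open>1 / nA i y\<close>, which gives upper and lower bounds at once.\<close>
  define c where "c = max (max (qpv_norm p y) (h \<Phi> y)) (\<Sum>i<m. nA i y + 1 / nA i y)"
  obtain k where k: "c \<le> real p powi int k" using powi_unbounded by blast
  obtain l where l: "h \<Phi> y \<le> real l" using real_arch_simple by blast
  define r where "r = max k l"
  have r: "c \<le> real p powi int r"
    using k powi_le_iff[of "int k" "int r"] by (simp add: r_def)
  have "real p powi (- int r) \<le> nA i y \<and> nA i y \<le> real p powi int r" if i: "i < m" for i
  proof -
    have N: "nA i y > 0" using well_cond_matrix(1)[OF assms i] .
    have "nA i y + 1 / nA i y \<le> (\<Sum>i<m. nA i y + 1 / nA i y)"
      using i well_cond_matrix(1)[OF assms]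
      by (intro member_le_sum) (auto intro!: less_imp_le add_pos_pos)
    also have "\<dots> \<le> real p powi int r" using r by (simp add: c_def)
    finally have le: "nA i y + 1 / nA i y \<le> real p powi int r" .
    moreover have "0 < 1 / nA i y" using N by simp
    ultimately have "nA i y \<le> real p powi int r" "1 / nA i y \<le> real p powi int r"
      using N by linarith+
    moreover from this(2) have "1 / real p powi int r \<le> nA i y"
      using N powi_pos[of "int r"] by (simp add: field_simps)
    ultimately show ?thesis by (simp add: power_int_minus_divide)
  qed
  moreover have "qpv_norm p y \<le> real p powi int r" "h \<Phi> y \<le> real r" "y \<in> Qpn p"
    using r l assms by (auto simp: c_def r_def well_cond_def)
  ultimately show ?thesis by (auto simp: truncation_def)
qed

text \<open>Test functions on \<open>2 * w\<close> spheres bound the operator from below on w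
  spheres whose images under all \<open>A i y\<close> stay in the support. With M the integral of
  |x|^(-n) over w spheres this reads
  \<open>k * M powr (1 / q) \<le> C * (2 * M) powr (1 / q)\<close>: M cancels and the factor left is
  at most 2, whatever r is.\<close>

lemma hausdorff_lower_truncated:
  assumes \<Phi>: "\<Phi> \<in> borel_measurable \<mu>" "\<And>y. 0 \<le> \<Phi> y"
    and bound: "hausdorff_bound p m \<Phi> A qs (\<lambda>i. pow_weight p (\<alpha>s i)) q (pow_weight p \<alpha>) C"
  shows "0 \<le> C \<and> (\<integral>\<^sup>+y. ennreal (h \<Phi> y) * indicator (truncation \<Phi> r) y \<partial>\<mu>) \<le> ennreal (2 * C)"
proof -
  let ?int = "hausdorff_integrand p m \<Phi> A"
  let ?n = "real CARD('n)"
  \<comment> \<open>For x in \<open>?R\<close> below and y in the truncation, the image has norm at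
    least 1 and less than p^(2 r + \<nu> + w), which is within \<open>2 * w\<close> spheres once
    \<open>w \<ge> 2 * r + \<nu>\<close>. The extra 1 keeps w, hence M, positive.\<close>
  define w where "w = 2 * r + \<nu> + 1"
  define f :: "nat \<Rightarrow> ('n \<Rightarrow> qp) \<Rightarrow> real" where
    "f i x = indicator (shell 0 (2 * w)) x * qpv_norm p x powr (- s i)" for i x
  let ?H = "hausdorff_op p m \<Phi> A f"
  have fm: "f i \<in> borel_measurable \<mu>" for i unfolding f_def[abs_def] by measurable
  have f_norm: "(\<integral>\<^sup>+x. ennreal (\<bar>f i x\<bar> powr qs i * pow_weight p (\<alpha>s i) x) \<partial>\<mu>)
      = ennreal (real (2 * w) * sphere_mass)" if i: "i < m" for i
  proof -
    have "\<bar>f i x\<bar> powr qs i * pow_weight p (\<alpha>s i) x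
        = indicator (shell 0 (2 * w)) x * qpv_norm p x powr (- ?n)" for x
    proof (cases "x \<in> shell 0 (2 * w)")
      case True
      have "\<alpha>s i - s i * qs i = - ?n" using s_mult_qs[OF i] by simp
      then show ?thesis using True by (simp add: f_def pow_weight_def powr_powr powr_add[symmetric])
    qed (simp add: f_def)
    then show ?thesis by (simp only: nn_integral_shell)
  qed
  have "\<forall>i<m. in_Lq p (qs i) (pow_weight p (\<alpha>s i)) (f i)"
    unfolding in_Lq_def haar_eq using f_norm fm by auto
  with bound have AE_int: "AE x in \<mu>. integrable \<mu> (?int f x)"
    and H_in: "in_Lq p q (pow_weight p \<alpha>) ?H"
    and H_le: "Lq_norm p q (pow_weight p \<alpha>) ?H
        \<le> C * (\<Prod>i<m. Lq_norm p (qs i) (pow_weight p (\<alpha>s i)) (f i))"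
    unfolding hausdorff_bound_def haar_eq by blast+
  define M where "M = real w * sphere_mass"
  have M: "M > 0" using sphere_mass_pos by (simp add: M_def w_def)
  have "(\<Prod>i<m. Lq_norm p (qs i) (pow_weight p (\<alpha>s i)) (f i)) = (\<Prod>i<m. (2 * M) powr (1 / qs i))"
    unfolding Lq_norm_def haar_eq using f_norm M by (intro prod.cong) (auto simp: M_def mult.assoc)
  \<comment> \<open>First balance condition: all norm integrals equal \<open>2 * M\<close>, and the
    exponents \<open>1 / qs i\<close> add up to \<open>1 / q\<close>.\<close>
  also have "\<dots> = (2 * M) powr (1 / q)"
    using M sum_qs by (simp add: powr_sum[symmetric])
  finally have prod_eq: "(\<Prod>i<m. Lq_norm p (qs i) (pow_weight p (\<alpha>s i)) (f i)) = (2 * M) powr (1 / q)" .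
  have hm: "h \<Phi> \<in> borel_measurable \<mu>" using \<Phi>(1) by (rule h_measurable)
  have hS: "(\<lambda>y. ennreal (h \<Phi> y) * indicator (truncation \<Phi> r) y) \<in> borel_measurable \<mu>"
    using hm truncation_in_sets[OF \<Phi>(1)] by measurable
  define k where "k = enn2real (\<integral>\<^sup>+y. ennreal (h \<Phi> y) * indicator (truncation \<Phi> r) y \<partial>\<mu>)"
  have k0: "k \<ge> 0" by (simp add: k_def)
  have k: "(\<integral>\<^sup>+y. ennreal (h \<Phi> y) * indicator (truncation \<Phi> r) y \<partial>\<mu>) = ennreal k"
  proof -
    have "(\<integral>\<^sup>+y. ennreal (h \<Phi> y) * indicator (truncation \<Phi> r) y \<partial>\<mu>)
        \<le> (\<integral>\<^sup>+y. ennreal (real r) * indicator (qpn_ball p vzero (int r)) y \<partial>\<mu>)"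
      by (intro nn_integral_mono) (auto simp: truncation_def qpn_ball_iff indicator_def intro!: ennreal_leI)
    also have "\<dots> < \<infinity>"
      by (simp add: nn_integral_cmult_indicator ball_in_sets emeasure_ball ennreal_mult_less_top)
    finally show ?thesis by (simp add: k_def ennreal_enn2real)
  qed
  \<comment> \<open>The inner radius p^(r + \<nu>) makes up for a contraction by p^(-r) and the
    distortion p^\<nu>.\<close>
  let ?R = "shell (int (r + \<nu>)) w"
  have f_ge: "nA i y powr (- s i) * qpv_norm p x powr (- s i) \<le> f i (qp_mat_vec p (A i y) x)"
    if x: "x \<in> ?R" and y: "well_cond y" "y \<in> truncation \<Phi> r" and i: "i < m" for x y i
  proof -
    have xQ: "x \<in> Qpn p" and x1: "real p powi (int r + int \<nu>) \<le> qpv_norm p x"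
      and x2: "qpv_norm p x < real p powi (int r + int \<nu> + int w)"
      using x by (auto simp: shell_def)
    have N: "nA i y > 0" "real p powi (- int r) \<le> nA i y" "nA i y \<le> real p powi int r"
      using well_cond_matrix(1)[OF y(1) i] y(2) i by (auto simp: truncation_def)
    let ?z = "qp_mat_vec p (A i y) x"
    have zQ: "?z \<in> Qpn p" using well_cond_matrix(2)[OF y(1) i] xQ by simp
    have up: "qpv_norm p ?z \<le> nA i y * qpv_norm p x"
      and lo: "nA i y * qpv_norm p x \<le> \<kappa> * qpv_norm p ?z"
      using well_cond_upper[OF y(1) i xQ] well_cond_lower[OF y(1) i xQ] .
    have "\<kappa> * 1 = real p powi (- int r) * real p powi (int r + int \<nu>)"
      using p_pos by (simp add: \<kappa>_def power_int_add[symmetric])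
    also have "\<dots> \<le> nA i y * qpv_norm p x"
      using N x1 powi_pos by (intro mult_mono) (auto simp: less_imp_le)
    also note lo
    finally have z1: "1 \<le> qpv_norm p ?z" using \<kappa>_ge_1 by (subst (asm) mult_le_cancel_left_pos) auto
    have "qpv_norm p ?z \<le> real p powi int r * qpv_norm p x"
      using up N(3) mult_right_mono[OF N(3), of "qpv_norm p x"] xQ by (auto intro: order_trans)
    also have "\<dots> < real p powi int r * real p powi (int r + int \<nu> + int w)"
      using x2 powi_pos by (intro mult_strict_left_mono)
    also have "\<dots> = real p powi (int r + (int r + int \<nu> + int w))"
      using p_pos by (subst power_int_add) auto
    also have "\<dots> \<le> real p powi (0 + int (2 * w))"
      unfolding powi_le_iff by (simp add: w_def)
    finally have z2: "qpv_norm p ?z < real p powi (0 + int (2 * w))" .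
    have "f i ?z = qpv_norm p ?z powr (- s i)"
      using z1 z2 zQ by (simp add: f_def shell_def)
    \<comment> \<open>The exponent is negative, so the upper estimate of the norm bounds
      \<open>f i\<close> from below.\<close>
    moreover have "(nA i y * qpv_norm p x) powr (- s i) \<le> qpv_norm p ?z powr (- s i)"
      using up z1 s_pos[OF i] by (intro powr_mono2') auto
    ultimately show ?thesis using N(1) xQ by (simp add: powr_mult)
  qed
  define s' where "s' = (\<Sum>i<m. s i)"
  \<comment> \<open>The integrand is nonnegative, so restricting the y-integral to the truncation
    only decreases it; there \<open>f_ge\<close> bounds each factor.\<close>
  have H_ge: "AE x in \<mu>. x \<in> ?R \<longrightarrow> k * qpv_norm p x powr (- s') \<le> ?H x"
    using AE_int AE_space
  proof eventually_elim
    case (elim x)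
    show ?case
    proof
      assume x: "x \<in> ?R"
      then have xQ: "x \<in> Qpn p" and x0: "qpv_norm p x > 0"
        using powi_pos[of "int (r + \<nu>)"] by (auto simp: shell_def)
      have f0: "0 \<le> f i z" for i z by (simp add: f_def)
      have int0: "AE y in \<mu>. 0 \<le> ?int f x y"
        using AE_well_cond by eventually_elim
          (auto simp: hausdorff_integrand_def well_cond_def \<Phi>(2) f0 intro!: mult_nonneg_nonneg divide_nonneg_nonneg prod_nonneg)
      have "ennreal (k * qpv_norm p x powr (- s')) = ennreal (qpv_norm p x powr (- s')) * (\<integral>\<^sup>+y. ennreal (h \<Phi> y) * indicator (truncation \<Phi> r) y \<partial>\<mu>)"
        unfolding k using k0 by (simp add: ennreal_mult mult.commute)
      also have "\<dots> = (\<integral>\<^sup>+y. ennreal (qpv_norm p x powr (- s')) * (ennreal (h \<Phi> y) * indicator (truncation \<Phi> r) y) \<partial>\<mu>)"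
        by (rule nn_integral_cmult[symmetric, OF hS])
      also have "\<dots> \<le> (\<integral>\<^sup>+y. ennreal (?int f x y) \<partial>\<mu>)"
      proof (rule nn_integral_mono_AE)
        show "AE y in \<mu>. ennreal (qpv_norm p x powr (- s')) * (ennreal (h \<Phi> y) * indicator (truncation \<Phi> r) y)
            \<le> ennreal (?int f x y)"
          using AE_well_cond
        proof eventually_elim
          case (elim y)
          show ?case
          proof (cases "y \<in> truncation \<Phi> r")
            case True
            have "(\<Prod>i<m. nA i y powr (- s i)) * qpv_norm p x powr (- s')
                = (\<Prod>i<m. nA i y powr (- s i) * qpv_norm p x powr (- s i))"
              using x0 by (simp add: prod.distrib s'_def sum_negf[symmetric] powr_sum)
            also have "\<dots> \<le> (\<Prod>i<m. f i (qp_mat_vec p (A i y) x))"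
              using f_ge[OF x elim True] by (intro prod_mono) auto
            finally have le: "(\<Prod>i<m. nA i y powr (- s i)) * qpv_norm p x powr (- s')
                \<le> (\<Prod>i<m. f i (qp_mat_vec p (A i y) x))" .
            have c0: "0 \<le> \<Phi> y / qpv_norm p y ^ CARD('n)"
              using \<Phi>(2)[of y] elim by (simp add: well_cond_def)
            have "qpv_norm p x powr (- s') * h \<Phi> y \<le> ?int f x y"
              using mult_left_mono[OF le c0]
              unfolding h_def hausdorff_integrand_def by (simp only: mult_ac)
            then show ?thesis
              using True elim h_nonneg[OF \<Phi>(2), of y]
              by (auto simp: ennreal_mult[symmetric] well_cond_def intro!: ennreal_leI)
          qed simp
        qed
      qed
      also have "\<dots> = ennreal (?H x)"
        unfolding hausdorff_op_def haar_eq by (rule nn_integral_eq_integral[OF elim(1) int0])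
      finally show "k * qpv_norm p x powr (- s') \<le> ?H x"
        using integral_nonneg_AE[OF int0] unfolding hausdorff_op_def haar_eq
        by (subst (asm) ennreal_le_iff) auto
    qed
  qed
  \<comment> \<open>Criticality of the product: the lower bound for \<open>?H\<close> becomes a
    multiple of |x|^(-n) under the weighted q-th power, so \<open>?R\<close> contributes M.\<close>
  have exp_eq: "- s' * q + \<alpha> = - ?n" using sum_s by (simp add: s'_def algebra_simps)
  let ?I = "\<integral>\<^sup>+x. ennreal (\<bar>?H x\<bar> powr q * pow_weight p \<alpha> x) \<partial>\<mu>"
  have "ennreal (k powr q * M) = ennreal (k powr q) * (\<integral>\<^sup>+x. ennreal (indicator ?R x * qpv_norm p x powr (- ?n)) \<partial>\<mu>)"
    unfolding nn_integral_shell M_def using M by (intro ennreal_mult) (auto simp: M_def)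
  also have "\<dots> = (\<integral>\<^sup>+x. ennreal (k powr q) * ennreal (indicator ?R x * qpv_norm p x powr (- ?n)) \<partial>\<mu>)"
    by (rule nn_integral_cmult[symmetric]) measurable
  also have "\<dots> \<le> ?I"
  proof (rule nn_integral_mono_AE)
    show "AE x in \<mu>. ennreal (k powr q) * ennreal (indicator ?R x * qpv_norm p x powr (- ?n))
        \<le> ennreal (\<bar>?H x\<bar> powr q * pow_weight p \<alpha> x)"
      using H_ge
    proof eventually_elim
      case (elim x)
      show ?case
      proof (cases "x \<in> ?R")
        case True
        then have "k * qpv_norm p x powr (- s') \<le> \<bar>?H x\<bar>" using elim by auto
        then have "(k * qpv_norm p x powr (- s')) powr q \<le> \<bar>?H x\<bar> powr q"
          using q k0 by (intro powr_mono2) auto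
        then have "(k * qpv_norm p x powr (- s')) powr q * qpv_norm p x powr \<alpha>
            \<le> \<bar>?H x\<bar> powr q * pow_weight p \<alpha> x"
          by (simp add: pow_weight_def mult_right_mono)
        also have "(k * qpv_norm p x powr (- s')) powr q * qpv_norm p x powr \<alpha>
            = k powr q * qpv_norm p x powr (- s' * q + \<alpha>)"
          using k0 by (simp add: powr_mult powr_powr powr_add[symmetric])
        finally show ?thesis
          unfolding exp_eq using True by (simp add: ennreal_mult[symmetric] ennreal_leI)
      qed simp
    qed
  qed
  finally have I_ge: "ennreal (k powr q * M) \<le> ?I" .
  have "?I < \<infinity>" using H_in unfolding in_Lq_def haar_eq by blast
  then have "k powr q * M \<le> enn2real ?I"
    using enn2real_mono[OF I_ge] M by (simp add: less_top)
  then have "(k powr q * M) powr (1 / q) \<le> Lq_norm p q (pow_weight p \<alpha>) ?H"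
    unfolding Lq_norm_def haar_eq using q M by (intro powr_mono2) auto
  also note H_le
  also note prod_eq
  also have "(k powr q * M) powr (1 / q) = k * M powr (1 / q)"
    using q k0 M by (simp add: powr_mult powr_powr)
  also have "(2 * M) powr (1 / q) = 2 powr (1 / q) * M powr (1 / q)"
    using M by (simp add: powr_mult)
  finally have kC: "k \<le> C * 2 powr (1 / q)"
    using M by (simp add: mult.assoc[symmetric])
  then have "0 \<le> C * 2 powr (1 / q)" using k0 by linarith
  \<comment> \<open>\<open>hausdorff_bound\<close> admits negative constants a priori;
    \<open>k \<ge> 0\<close> rules them out.\<close>
  then have C: "0 \<le> C" by (simp add: zero_le_mult_iff)
  have "2 powr (1 / q) \<le> (2 :: real) powr 1" using q by (intro powr_mono) auto
  then have "C * 2 powr (1 / q) \<le> C * 2" using C by (intro mult_left_mono) auto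
  with kC C show ?thesis unfolding k by (simp add: ennreal_leI)
qed

text \<open>The bound \<open>2 * C\<close> is free of r and the truncations increase to almost the
  whole space, so monotone convergence removes them.\<close>

lemma hausdorff_lower:
  assumes \<Phi>: "\<Phi> \<in> borel_measurable \<mu>" "\<And>y. 0 \<le> \<Phi> y"
    and bound: "hausdorff_bound p m \<Phi> A qs (\<lambda>i. pow_weight p (\<alpha>s i)) q (pow_weight p \<alpha>) C"
  shows "0 \<le> C" "(\<integral>\<^sup>+y. ennreal (h \<Phi> y) \<partial>\<mu>) \<le> ennreal (2 * C)"
proof -
  note trunc = hausdorff_lower_truncated[OF \<Phi> bound]
  show "0 \<le> C" using trunc by blast
  let ?g = "\<lambda>r y. ennreal (h \<Phi> y) * indicator (truncation \<Phi> r) y"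
  have hm: "h \<Phi> \<in> borel_measurable \<mu>" using \<Phi>(1) by (rule h_measurable)
  have "(\<integral>\<^sup>+y. ennreal (h \<Phi> y) \<partial>\<mu>) \<le> (\<integral>\<^sup>+y. (SUP r. ?g r y) \<partial>\<mu>)"
  proof (rule nn_integral_mono_AE)
    show "AE y in \<mu>. ennreal (h \<Phi> y) \<le> (SUP r. ?g r y)"
      using AE_well_cond
    proof eventually_elim
      case (elim y)
      then obtain r where "y \<in> truncation \<Phi> r" using well_cond_in_truncation by blast
      then have "ennreal (h \<Phi> y) = ?g r y" by simp
      also have "\<dots> \<le> (SUP r. ?g r y)" by (rule SUP_upper) simp
      finally show ?case .
    qed
  qed
  also have "\<dots> = (SUP r. \<integral>\<^sup>+y. ?g r y \<partial>\<mu>)"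
  proof (rule nn_integral_monotone_convergence_SUP)
    show "incseq ?g"
      using truncation_mono by (auto simp: incseq_def le_fun_def indicator_def)
    show "?g r \<in> borel_measurable \<mu>" for r
      using hm truncation_in_sets[OF \<Phi>(1)] by measurable
  qed
  also have "\<dots> \<le> ennreal (2 * C)"
    using trunc by (intro SUP_least) blast
  finally show "(\<integral>\<^sup>+y. ennreal (h \<Phi> y) \<partial>\<mu>) \<le> ennreal (2 * C)" .
qed

section \<open>The equivalence and the comparison of norms\<close>

lemma hausdorff_characterization:
  "\<exists>C>0. \<forall>\<Phi>. \<Phi> \<in> borel_measurable \<mu> \<and> (\<forall>y. \<Phi> y \<ge> 0) \<longrightarrow>
     (hausdorff_bounded p m \<Phi> A qs (\<lambda>i. pow_weight p (\<alpha>s i)) q (pow_weight p \<alpha>)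
        \<longleftrightarrow> const_C1 p m \<Phi> A qs \<alpha>s < \<infinity>) \<and>
     (hausdorff_bounded p m \<Phi> A qs (\<lambda>i. pow_weight p (\<alpha>s i)) q (pow_weight p \<alpha>) \<longrightarrow>
        enn2real (const_C1 p m \<Phi> A qs \<alpha>s) / C
          \<le> hausdorff_opnorm p m \<Phi> A qs (\<lambda>i. pow_weight p (\<alpha>s i)) q (pow_weight p \<alpha>) \<and>
        hausdorff_opnorm p m \<Phi> A qs (\<lambda>i. pow_weight p (\<alpha>s i)) q (pow_weight p \<alpha>)
          \<le> C * enn2real (const_C1 p m \<Phi> A qs \<alpha>s))"
proof -
  \<comment> \<open>B is the constant of the upper estimate and L that of the lower one: 2 from the
    truncated test, the product from replacing \<open>1 / nA i y\<close> by the norm of the inverse.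
    Neither involves \<Phi>, and their sum serves both directions.\<close>
  define B where "B = (\<Prod>i<m. D i powr (1 / qs i))"
  define L where "L = 2 * (\<Prod>i<m. \<kappa> powr s i)"
  have B: "B > 0" using D_pos by (auto simp: B_def intro!: prod_pos simp: less_imp_neq[symmetric])
  have L: "L > 0" using \<kappa>_ge_1 by (auto simp: L_def intro!: prod_pos)
  show ?thesis
  proof (intro exI[of _ "B + L"] conjI allI impI)
    show "B + L > 0" using B L by simp
    fix \<Phi> :: "('n \<Rightarrow> qp) \<Rightarrow> real"
    assume "\<Phi> \<in> borel_measurable \<mu> \<and> (\<forall>y. \<Phi> y \<ge> 0)"
    then have \<Phi>: "\<Phi> \<in> borel_measurable \<mu>" "\<And>y. 0 \<le> \<Phi> y" by auto
    let ?C1 = "const_C1 p m \<Phi> A qs \<alpha>s"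
    let ?bnd = "hausdorff_bound p m \<Phi> A qs (\<lambda>i. pow_weight p (\<alpha>s i)) q (pow_weight p \<alpha>)"
    let ?bounded = "hausdorff_bounded p m \<Phi> A qs (\<lambda>i. pow_weight p (\<alpha>s i)) q (pow_weight p \<alpha>)"
    let ?norm = "hausdorff_opnorm p m \<Phi> A qs (\<lambda>i. pow_weight p (\<alpha>s i)) q (pow_weight p \<alpha>)"
    have lower: "0 \<le> C \<and> ?C1 \<le> ennreal (L * C)" if C: "?bnd C" for C
    proof -
      note low = hausdorff_lower[OF \<Phi> C]
      have P0: "0 \<le> (\<Prod>i<m. \<kappa> powr s i)" by (auto intro!: prod_nonneg)
      have "?C1 \<le> ennreal (\<Prod>i<m. \<kappa> powr s i) * (\<integral>\<^sup>+y. ennreal (h \<Phi> y) \<partial>\<mu>)"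
        by (rule C1_le[OF \<Phi>(2,1)])
      also have "\<dots> \<le> ennreal (\<Prod>i<m. \<kappa> powr s i) * ennreal (2 * C)"
        using low by (intro mult_left_mono) auto
      also have "\<dots> = ennreal (L * C)"
        using low P0 by (subst ennreal_mult[symmetric]) (auto simp: L_def mult_ac)
      finally show ?thesis using low by blast
    qed
    have upper: "?bnd (B * enn2real ?C1)" if fin: "?C1 < \<infinity>"
    proof -
      have "(\<integral>\<^sup>+y. ennreal (h \<Phi> y) \<partial>\<mu>) \<le> ennreal (enn2real ?C1)"
        using C1_ge[OF \<Phi>(2)] fin by (simp add: ennreal_enn2real)
      from hausdorff_upper[OF \<Phi> _ this] show ?thesis
        by (simp add: B_def mult.commute)
    qed
    show iff: "?bounded \<longleftrightarrow> ?C1 < \<infinity>"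
    proof
      assume "?bounded"
      then obtain C where "?bnd C" by (auto simp: hausdorff_bounded_def)
      then show "?C1 < \<infinity>" using lower le_less_trans[of ?C1 "ennreal (L * C)"] by auto
    next
      assume "?C1 < \<infinity>"
      then show ?bounded using upper by (auto simp: hausdorff_bounded_def)
    qed
    assume ?bounded
    \<comment> \<open>From here on \<open>enn2real\<close> returns the true value of C1.\<close>
    then have fin: "?C1 < \<infinity>" using iff by simp
    let ?X = "{C. C \<ge> 0 \<and> ?bnd C}"
    \<comment> \<open>With this member the set is nonempty, and 0 bounds it below, so
      \<open>Inf\<close> is a genuine infimum.\<close>
    have mem: "B * enn2real ?C1 \<in> ?X" using upper[OF fin] B by simp
    have "enn2real ?C1 / (B + L) \<le> enn2real ?C1 / L"
      using B L by (intro divide_left_mono) auto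
    also have "\<dots> \<le> Inf ?X"
    proof (rule cInf_greatest)
      show "?X \<noteq> {}" using mem by blast
      fix C assume "C \<in> ?X"
      then have C: "0 \<le> C" "?C1 \<le> ennreal (L * C)" using lower by auto
      then have "enn2real ?C1 \<le> L * C" using L by (intro enn2real_leI) auto
      then show "enn2real ?C1 / L \<le> C" using L by (simp add: field_simps)
    qed
    finally show "enn2real ?C1 / (B + L) \<le> ?norm" by (simp add: hausdorff_opnorm_def)
    have "Inf ?X \<le> B * enn2real ?C1"
      by (rule cInf_lower[OF mem]) (auto intro: bdd_belowI[of _ 0])
    also have "\<dots> \<le> (B + L) * enn2real ?C1"
      using L by (intro mult_right_mono) auto
    finally show "?norm \<le> (B + L) * enn2real ?C1" by (simp add: hausdorff_opnorm_def)
  qed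
qed

end

text \<open>\<open>extend_measure\<close> selects a measure with the prescribed values if there is
  one and otherwise falls back to the zero set function; the two cases follow its
  definition.\<close>

lemma (in padic) haar_cases:
  obtains "\<And>(a :: 'n::finite \<Rightarrow> qp) k. a \<in> Qpn p \<Longrightarrow>
      emeasure (haar p) (qpn_ball p a k) = ennreal (real p powi (k * int CARD('n)))"
  | "\<And>X :: ('n::finite \<Rightarrow> qp) set. emeasure (haar p) X = 0"
proof -
  let ?I = "{(a :: 'n \<Rightarrow> qp, k :: int). a \<in> Qpn p}"
  let ?G = "\<lambda>(a :: 'n \<Rightarrow> qp, k). qpn_ball p a k"
  let ?v = "\<lambda>(a :: 'n \<Rightarrow> qp, k). ennreal (real p powi (k * int CARD('n)))"
  let ?P = "\<lambda>\<mu>'. (\<forall>i\<in>?I. \<mu>' (?G i) = ?v i) \<and> measure_space (Qpn p) (sigma_sets (Qpn p) (?G ` ?I)) \<mu>'"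
  have G: "?G ` ?I \<subseteq> Pow (Qpn p)" by (auto simp: qpn_ball_def)
  show thesis
  proof (cases "\<exists>\<mu>'. ?P \<mu>'")
    case True
    then obtain \<mu>' where \<mu>': "?P \<mu>'" ..
    have s: "sets (haar p :: ('n \<Rightarrow> qp) measure) = sigma_sets (Qpn p) (?G ` ?I)"
      unfolding haar_def using G by (rule sets_extend_measure)
    have "emeasure (haar p) (?G i) = ?v i" if "i \<in> ?I" for i
      by (rule emeasure_extend_measure[OF haar_def _ G _ _ that, of \<mu>'])
        (use \<mu>' in \<open>auto simp: s measure_space_def\<close>)
    from this[of "(_, _)"] that(1) show thesis by simp
  next
    case False
    have "emeasure (haar p :: ('n \<Rightarrow> qp) measure) X = 0" for X
    proof (cases "X \<in> sets (haar p :: ('n \<Rightarrow> qp) measure)")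
      case True
      have "haar p = measure_of (Qpn p) (?G ` ?I) (\<lambda>_. 0)"
        unfolding haar_def extend_measure_def by (rule if_not_P) (use False in blast)
      from emeasure_measure_of[OF this G _ _ True] show ?thesis
        by (simp add: positive_def countably_additive_def)
    qed (rule emeasure_notin_sets)
    then show thesis by (rule that(2))
  qed
qed

theorem theorem3p1:
  fixes p m :: nat and q \<alpha> :: real and qs \<alpha>s :: "nat \<Rightarrow> real"
    and A :: "nat \<Rightarrow> ('n::finite \<Rightarrow> qp) \<Rightarrow> ('n \<Rightarrow> 'n \<Rightarrow> qp)"
  assumes "prime p" and "m \<ge> 1"
    and "q \<ge> 1" and "\<forall>i<m. qs i \<ge> 1"
    and "\<forall>i<m. \<alpha>s i > - real CARD('n)"
    and "(\<Sum>i<m. 1 / qs i) = 1 / q"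
    and "(\<Sum>i<m. \<alpha>s i / qs i) = \<alpha> / q"
    and A_meas: "\<forall>i<m. \<forall>j k. (\<lambda>y. A i y j k) \<in> measurable (haar p) (qp_borel p)"
    and A_inv: "\<forall>i<m. AE y in haar p. qp_invertible p (A i y)"
    and DK1: "\<exists>\<nu>::nat. \<forall>i<m. AE y in haar p.
                qpm_norm p (A i y) * qpm_norm p (qp_mat_inv p (A i y)) \<le> real p ^ \<nu>"
  shows "\<exists>C>0. \<forall>\<Phi>. \<Phi> \<in> borel_measurable (haar p) \<and> (\<forall>y. \<Phi> y \<ge> 0) \<longrightarrow>
     (hausdorff_bounded p m \<Phi> A qs (\<lambda>i. pow_weight p (\<alpha>s i)) q (pow_weight p \<alpha>)
        \<longleftrightarrow> const_C1 p m \<Phi> A qs \<alpha>s < \<infinity>) \<and>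
     (hausdorff_bounded p m \<Phi> A qs (\<lambda>i. pow_weight p (\<alpha>s i)) q (pow_weight p \<alpha>) \<longrightarrow>
        enn2real (const_C1 p m \<Phi> A qs \<alpha>s) / C
          \<le> hausdorff_opnorm p m \<Phi> A qs (\<lambda>i. pow_weight p (\<alpha>s i)) q (pow_weight p \<alpha>) \<and>
        hausdorff_opnorm p m \<Phi> A qs (\<lambda>i. pow_weight p (\<alpha>s i)) q (pow_weight p \<alpha>)
          \<le> C * enn2real (const_C1 p m \<Phi> A qs \<alpha>s))"
proof -
  interpret padic p by unfold_locales (rule \<open>prime p\<close>)
  obtain \<nu> :: nat where \<nu>: "\<forall>i<m. AE y in haar p.
      qpm_norm p (A i y) * qpm_norm p (qp_mat_inv p (A i y)) \<le> real p ^ \<nu>"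
    using DK1 by blast
  show ?thesis
  proof (rule haar_cases[where 'n='n])
    assume "\<And>(a :: 'n \<Rightarrow> qp) k. a \<in> Qpn p \<Longrightarrow>
      emeasure (haar p) (qpn_ball p a k) = ennreal (real p powi (k * int CARD('n)))"
    then interpret hausdorff_setting p "haar p" m q \<alpha> qs \<alpha>s A \<nu>
      by unfold_locales (use assms \<nu> in auto)
    show ?thesis by (rule hausdorff_characterization)
  next
    assume null: "\<And>X :: ('n \<Rightarrow> qp) set. emeasure (haar p) X = 0"
    have AE: "AE x in (haar p :: ('n \<Rightarrow> qp) measure). P x" for P
    proof (rule AE_I')
      show "space (haar p) \<in> null_sets (haar p :: ('n \<Rightarrow> qp) measure)"
        using sets.top[of "haar p"] null[of "space (haar p)"] unfolding null_sets_def by blast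
    qed auto
    have nn: "(\<integral>\<^sup>+x. g x \<partial>(haar p :: ('n \<Rightarrow> qp) measure)) = 0" for g
    proof -
      have "AE x in haar p. g x = 0" by (rule AE)
      from nn_integral_cong_AE[OF this] show ?thesis by simp
    qed
    have op: "hausdorff_op p m \<Phi> A f = (\<lambda>_. 0)" for \<Phi> f
      by (auto simp: hausdorff_op_def fun_eq_iff intro!: integral_eq_zero_AE AE)
    have C1: "const_C1 p m \<Phi> A qs \<alpha>s = 0" for \<Phi>
      by (simp add: const_C1_def nn)
    have bound: "hausdorff_bound p m \<Phi> A qs (\<lambda>i. pow_weight p (\<alpha>s i)) q (pow_weight p \<alpha>) 0" for \<Phi>
      by (simp add: hausdorff_bound_def op in_Lq_def Lq_norm_def nn AE)
    \<comment> \<open>The infimum ranges over nonnegative constants only, so the admissible constant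
      0 is its minimum.\<close>
    have norm: "hausdorff_opnorm p m \<Phi> A qs (\<lambda>i. pow_weight p (\<alpha>s i)) q (pow_weight p \<alpha>) = 0" for \<Phi>
      unfolding hausdorff_opnorm_def
      by (rule cInf_eq_minimum) (use bound in auto)
    have bounded: "hausdorff_bounded p m \<Phi> A qs (\<lambda>i. pow_weight p (\<alpha>s i)) q (pow_weight p \<alpha>)" for \<Phi>
      using bound unfolding hausdorff_bounded_def by blast
    show ?thesis
      by (rule exI[of _ 1]) (simp add: C1 norm bounded)
  qed
qed

end
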